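(* Suppose that $\mathbb F=(\mathcal F_t)_{t\ge 0}$ is an augmented and left-continuous filtration. Let $(M_t)_{t\ge 0}$ be a convex and integrably bounded set-valued $\mathbb F$-submartingale, and let $M_{t-}$, $t\ge 0$, be its left limits along the rationals, with $M_{0-}:=M_0$ (as defined in the context). Then: (i) For each $t>0$, $M_{t-}$ is an $\mathcal F_t$-measurable integrably bounded set-valued random variable with compact convex values $\mathbb P$-a.s., and $M_{t-}\subseteq M_t$ $\mathbb P$-a.s. Moreover, $M_{t-}=M_t$ $\mathbb P$-a.s. if and only if, for every $x^*\in\mathscr W$, the function $r\mapsto s(x^*,\mathbb E[M_r])$ is left-continuous at $r=t$. (ii) The process $(M_{t-})_{t\ge 0}$ is a Hausdorff càglàd (left-continuous and right-limited), convex, and integrably bounded set-valued $\mathbb F$-submartingale. Furthermore, if $(M_t)_{t\ge 0}$ is a set-valued $\mathbb F$-martingale, then so is $(M_{t-})_{t\ge 0}$.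
   Context: Sets. $\mathbb R^d$ carries the Euclidean inner product $\langle\cdot,\cdot\rangle$ and norm $|\cdot|$; $\mathbb B=\{x\in\mathbb R^d: |x|\le 1\}$. For nonempty closed $C,D\subseteq\mathbb R^d$: $d(x,C)=\inf_{y\in C}|x-y|$; the Hausdorff distance is $h(C,D)=\max\{\sup_{x\in C}d(x,D),\sup_{y\in D}d(y,C)\}$; $\|C\|=\sup_{x\in C}|x|$; the support function is $s(x^*,C)=\sup_{x\in C}\langle x^*,x\rangle$. "Hausdorff" limits and continuity are with respect to $h$. $\mathscr W$ is a fixed countable dense subset of $\mathbb B$ with $0\notin\mathscr W$. Set-valued random variables. $(\Omega,\mathcal F,\mathbb P)$ is a probability space, $\mathcal G\subseteq\mathcal F$ a sub-$\sigma$-algebra. A map $\Xi$ from $\Omega$ to the nonempty closed subsets of $\mathbb R^d$ is $\mathcal G$-measurable if $\{\omega:\Xi(\omega)\cap C\ne\emptyset\}\in\mathcal G$ for all closed $C$; such maps are identified up to a.s. equality. $S^1_{\mathcal G}(\Xi)$ is the set of $\mathcal G$-measurable integrable random vectors $\xi$ with $\xi\in\Xi$ a.s. $\Xi$ is integrable if $S^1_{\mathcal F}(\Xi)\neq\emptyset$ and integrably bounded if $\mathbb E[\|\Xi\|]<\infty$. $\mathbb E[\Xi]$ is the closure in $\mathbb R^d$ of $\{\mathbb E[\xi]:\xi\in S^1_{\mathcal F}(\Xi)\}$. $\mathbb E[\Xi|\mathcal G]$ is the a.s. unique $\mathcal G$-measurable integrable set-valued random variable such that $S^1_{\mathcal G}(\mathbb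 E[\Xi|\mathcal G])$ is the $L^1$-closure of $\{\mathbb E[\xi|\mathcal G]:\xi\in S^1_{\mathcal F}(\Xi)\}$. Processes. A set-valued process $(M_t)_{t\ge0}$ is a family of $\mathcal F$-measurable (closed nonempty valued) set-valued random variables; it is $\mathbb F$-adapted if each $M_t$ is $\mathcal F_t$-measurable, convex if each $M_t$ has convex values, integrable (integrably bounded) if each $M_t$ is. An $\mathbb F$-adapted integrable set-valued process is a set-valued $\mathbb F$-submartingale if $\mathbb E[M_t|\mathcal F_s]\supseteq M_s$ a.s. for all $s\le t$, and a set-valued $\mathbb F$-martingale if equality holds a.s. for all $s\le t$. Augmented: complete, with all $\mathbb P$-null sets in $\mathcal F_0$. Left-continuous: $\mathcal F_t=\sigma(\bigcup_{r<t}\mathcal F_r)$ for each $t>0$. One-sided limits. For a convex integrably bounded set-valued $\mathbb F$-submartingale there is an event $\bar\Omega$ with $\mathbb P(\bar\Omega)=1$ on which the Hausdorff limits $M_{t-}=\lim_{r\in\mathbb Q,\,r\uparrow t}M_r$ ($t>0$) and $M_{t+}=\lim_{r\in\mathbb Q,\,r\downarrow t}M_r$ ($t\ge0$) all exist as nonempty compact convex sets. Fix such $\bar\Omega$; set $M_{0-}:=M_0$, and for $\omega\notin\bar\Omega$ set $M_{t-}(\omega)=\{0\}$ ($t>0$) and $M_{t+}(\omega)=\{0\}$ ($t\ge 0$). *)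

theory Defs
  imports "HOL-Probability.Probability"
begin

text \<open>
  \<open>P\<close> is the probability space; sub-sigma-algebras are given as measures of which only
  \<open>space\<close> and \<open>sets\<close> matter (\<open>subalgebra P G\<close>). The time set \<open>[0, \<infinity>)\<close> consists of the
  nonnegative elements of \<^typ>\<open>real\<close>; values at negative times are irrelevant.
\<close>

section \<open>Closed sets\<close>

text \<open>The Hausdorff distance and the norm of a set may be infinite, hence \<^typ>\<open>ennreal\<close>, and the
  support function may be infinite, hence \<^typ>\<open>ereal\<close>. The sets are meant to be nonempty
  (\<open>infdist x {} = 0\<close>).\<close>

definition hausdorff_dist :: "'b::metric_space set \<Rightarrow> 'b set \<Rightarrow> ennreal" where
  "hausdorff_dist C D =
     max (SUP x\<in>C. ennreal (infdist x D)) (SUP y\<in>D. ennreal (infdist y C))"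

definition set_norm :: "'b::real_normed_vector set \<Rightarrow> ennreal" where
  "set_norm C = (SUP x\<in>C. ennreal (norm x))"

definition support_fun :: "'b::real_inner \<Rightarrow> 'b set \<Rightarrow> ereal" where
  "support_fun u C = (SUP x\<in>C. ereal (u \<bullet> x))"

definition hausdorff_tendsto ::
    "('t \<Rightarrow> 'b::metric_space set) \<Rightarrow> 'b set \<Rightarrow> 't filter \<Rightarrow> bool" where
  "hausdorff_tendsto f L \<Phi> \<longleftrightarrow>
     closed L \<and> L \<noteq> {} \<and> ((\<lambda>r. hausdorff_dist (f r) L) \<longlongrightarrow> 0) \<Phi>"

definition hausdorff_lim :: "'t filter \<Rightarrow> ('t \<Rightarrow> 'b::metric_space set) \<Rightarrow> 'b set" where
  "hausdorff_lim \<Phi> f = (THE L. hausdorff_tendsto f L \<Phi>)"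

definition hausdorff_caglad :: "(real \<Rightarrow> 'b::metric_space set) \<Rightarrow> bool" where
  "hausdorff_caglad f \<longleftrightarrow>
     (\<forall>t>0. hausdorff_tendsto f (f t) (at_left t)) \<and>
     (\<forall>t\<ge>0. \<exists>L. hausdorff_tendsto f L (at_right t))"

lemma hausdorff_tendsto_infdist:
  assumes "hausdorff_tendsto f L \<Phi>" "e > 0"
  shows "\<forall>\<^sub>F r in \<Phi>. (\<forall>x\<in>f r. infdist x L < e) \<and> (\<forall>y\<in>L. infdist y (f r) < e)"
proof -
  have "\<forall>\<^sub>F r in \<Phi>. hausdorff_dist (f r) L < ennreal e"
    using assms by (auto simp: hausdorff_tendsto_def intro!: order_tendstoD(2))
  then show ?thesis
  proof eventually_elim
    case (elim r)
    have "ennreal (infdist x L) < ennreal e" if "x \<in> f r" for x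
      using elim that SUP_lessD[of "\<lambda>x. ennreal (infdist x L)" "f r"]
      by (simp add: hausdorff_dist_def)
    moreover have "ennreal (infdist y (f r)) < ennreal e" if "y \<in> L" for y
      using elim that SUP_lessD[of "\<lambda>y. ennreal (infdist y (f r))" L]
      by (simp add: hausdorff_dist_def)
    ultimately show ?case
      by (simp add: ennreal_less_iff infdist_nonneg)
  qed
qed

lemma hausdorff_tendsto_subset:
  assumes f: "hausdorff_tendsto f L \<Phi>" "hausdorff_tendsto f L' \<Phi>"
    and "\<Phi> \<noteq> bot" "\<forall>\<^sub>F r in \<Phi>. f r \<noteq> {}"
  shows "L \<subseteq> L'"
proof
  fix x assume x: "x \<in> L"
  have L': "closed L'" "L' \<noteq> {}"
    using f(2) by (auto simp: hausdorff_tendsto_def)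
  have "infdist x L' \<le> e" if e: "e > 0" for e
  proof -
    have e2: "e / 2 > 0" using e by simp
    have "\<forall>\<^sub>F r in \<Phi>. f r \<noteq> {} \<and> infdist x (f r) < e / 2 \<and> (\<forall>z\<in>f r. infdist z L' < e / 2)"
      using assms(4) hausdorff_tendsto_infdist[OF f(1) e2] hausdorff_tendsto_infdist[OF f(2) e2]
      by eventually_elim (use x in auto)
    then obtain r where r: "f r \<noteq> {}" "infdist x (f r) < e / 2" "\<forall>z\<in>f r. infdist z L' < e / 2"
      using eventually_happens'[OF assms(3)] by blast
    have "\<exists>z\<in>f r. dist x z < e / 2"
    proof (rule ccontr)
      assume "\<not> ?thesis"
      then have "e / 2 \<le> infdist x (f r)"
        unfolding infdist_notempty[OF r(1)] by (intro cINF_greatest r(1)) (simp add: not_less)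
      then show False
        using r(2) by linarith
    qed
    then obtain z where z: "z \<in> f r" "dist x z < e / 2"
      by blast
    have "infdist x L' \<le> infdist z L' + dist x z"
      by (rule infdist_triangle)
    also have "\<dots> \<le> e / 2 + e / 2"
      using r(3) z by (intro add_mono) (auto intro: less_imp_le)
    finally show ?thesis by simp
  qed
  then have "infdist x L' = 0"
    by (metis dense_ge infdist_nonneg order_antisym)
  then show "x \<in> L'"
    using in_closed_iff_infdist_zero[OF L'] by simp
qed

lemma hausdorff_lim_eq:
  assumes "hausdorff_tendsto f L \<Phi>" "\<Phi> \<noteq> bot" "\<forall>\<^sub>F r in \<Phi>. f r \<noteq> {}"
  shows "hausdorff_lim \<Phi> f = L"
  unfolding hausdorff_lim_def
proof (rule the_equality)
  fix L' assume "hausdorff_tendsto f L' \<Phi>"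
  then show "L' = L"
    using assms by (intro subset_antisym hausdorff_tendsto_subset[of f _ \<Phi>])
qed (rule assms(1))

section \<open>Set-valued random variables\<close>

definition random_closed_set :: "'w measure \<Rightarrow> ('w \<Rightarrow> 'b::topological_space set) \<Rightarrow> bool" where
  "random_closed_set G X \<longleftrightarrow>
     (\<forall>\<omega>\<in>space G. closed (X \<omega>) \<and> X \<omega> \<noteq> {}) \<and>
     (\<forall>C. closed C \<longrightarrow> {\<omega>\<in>space G. X \<omega> \<inter> C \<noteq> {}} \<in> sets G)"

text \<open>\<open>selections1 P G X\<close> is the set of \<open>G\<close>-measurable, \<open>P\<close>-integrable selections of \<open>X\<close>. Its
  elements are functions rather than classes modulo almost sure equality.\<close>

definition selections1 ::
    "'w measure \<Rightarrow> 'w measure \<Rightarrow> ('w \<Rightarrow> 'b::euclidean_space set) \<Rightarrow> ('w \<Rightarrow> 'b) set" where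
  "selections1 P G X =
     {\<xi> \<in> borel_measurable G. integrable P \<xi> \<and> (AE \<omega> in P. \<xi> \<omega> \<in> X \<omega>)}"

definition set_integrable_rv :: "'w measure \<Rightarrow> ('w \<Rightarrow> 'b::euclidean_space set) \<Rightarrow> bool" where
  "set_integrable_rv P X \<longleftrightarrow> selections1 P P X \<noteq> {}"

definition integrably_bounded :: "'w measure \<Rightarrow> ('w \<Rightarrow> 'b::euclidean_space set) \<Rightarrow> bool" where
  "integrably_bounded P X \<longleftrightarrow> (\<integral>\<^sup>+\<omega>. set_norm (X \<omega>) \<partial>P) < \<infinity>"

definition set_expectation :: "'w measure \<Rightarrow> ('w \<Rightarrow> 'b::euclidean_space set) \<Rightarrow> 'b set" where
  "set_expectation P X = closure ((\<lambda>\<xi>. integral\<^sup>L P \<xi>) ` selections1 P P X)"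

definition vec_cond_exp ::
    "'w measure \<Rightarrow> 'w measure \<Rightarrow> ('w \<Rightarrow> 'b::euclidean_space) \<Rightarrow> 'w \<Rightarrow> 'b" where
  "vec_cond_exp P G \<xi> \<omega> = (\<Sum>b\<in>Basis. real_cond_exp P G (\<lambda>\<omega>. \<xi> \<omega> \<bullet> b) \<omega> *\<^sub>R b)"

text \<open>The closure is taken in the space of \<open>G\<close>-measurable integrable functions, which is
  \<open>L\<^sup>1\<close>-closed, so that no limits are lost up to almost sure equality.\<close>

definition L1_closure ::
    "'w measure \<Rightarrow> 'w measure \<Rightarrow> ('w \<Rightarrow> 'b::euclidean_space) set \<Rightarrow> ('w \<Rightarrow> 'b) set" where
  "L1_closure P G A =
     {\<eta> \<in> borel_measurable G. integrable P \<eta> \<and>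
        (\<forall>e>0. \<exists>\<zeta>\<in>A. (\<integral>\<omega>. norm (\<eta> \<omega> - \<zeta> \<omega>) \<partial>P) < e)}"

text \<open>\<open>is_set_cond_exp P G X Y\<close> says that \<open>Y\<close> is a version of the conditional expectation of
  \<open>X\<close> given \<open>G\<close>; it is a relation because \<open>Y\<close> is unique only up to almost sure equality.\<close>

definition is_set_cond_exp ::
    "'w measure \<Rightarrow> 'w measure \<Rightarrow> ('w \<Rightarrow> 'b::euclidean_space set) \<Rightarrow> ('w \<Rightarrow> 'b set) \<Rightarrow> bool" where
  "is_set_cond_exp P G X Y \<longleftrightarrow>
     random_closed_set G Y \<and> set_integrable_rv P Y \<and>
     selections1 P G Y = L1_closure P G (vec_cond_exp P G ` selections1 P P X)"

section \<open>Filtrations and set-valued processes\<close>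

definition filtration_of :: "'w measure \<Rightarrow> (real \<Rightarrow> 'w measure) \<Rightarrow> bool" where
  "filtration_of P F \<longleftrightarrow>
     (\<forall>t\<ge>0. subalgebra P (F t)) \<and> (\<forall>s t. 0 \<le> s \<and> s \<le> t \<longrightarrow> subalgebra (F t) (F s))"

definition augmented_filtration :: "'w measure \<Rightarrow> (real \<Rightarrow> 'w measure) \<Rightarrow> bool" where
  "augmented_filtration P F \<longleftrightarrow> complete_measure P \<and> null_sets P \<subseteq> sets (F 0)"

definition left_continuous_filtration :: "'w measure \<Rightarrow> (real \<Rightarrow> 'w measure) \<Rightarrow> bool" where
  "left_continuous_filtration P F \<longleftrightarrow>
     (\<forall>t>0. sets (F t) = sigma_sets (space P) (\<Union>r\<in>{0..<t}. sets (F r)))"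

definition adapted_set_process ::
    "(real \<Rightarrow> 'w measure) \<Rightarrow> (real \<Rightarrow> 'w \<Rightarrow> 'b::euclidean_space set) \<Rightarrow> bool" where
  "adapted_set_process F X \<longleftrightarrow> (\<forall>t\<ge>0. random_closed_set (F t) (X t))"

text \<open>Set-valued random variables are identified up to almost sure equality, so convexity of the
  values is an almost sure property of each \<open>X t\<close>.\<close>

definition convex_process ::
    "'w measure \<Rightarrow> (real \<Rightarrow> 'w \<Rightarrow> 'b::euclidean_space set) \<Rightarrow> bool" where
  "convex_process P X \<longleftrightarrow> (\<forall>t\<ge>0. AE \<omega> in P. convex (X t \<omega>))"

definition integrable_process ::
    "'w measure \<Rightarrow> (real \<Rightarrow> 'w \<Rightarrow> 'b::euclidean_space set) \<Rightarrow> bool" where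
  "integrable_process P X \<longleftrightarrow> (\<forall>t\<ge>0. set_integrable_rv P (X t))"

definition integrably_bounded_process ::
    "'w measure \<Rightarrow> (real \<Rightarrow> 'w \<Rightarrow> 'b::euclidean_space set) \<Rightarrow> bool" where
  "integrably_bounded_process P X \<longleftrightarrow> (\<forall>t\<ge>0. integrably_bounded P (X t))"

definition set_submartingale ::
    "'w measure \<Rightarrow> (real \<Rightarrow> 'w measure) \<Rightarrow> (real \<Rightarrow> 'w \<Rightarrow> 'b::euclidean_space set) \<Rightarrow> bool" where
  "set_submartingale P F X \<longleftrightarrow>
     adapted_set_process F X \<and> integrable_process P X \<and>
     (\<forall>s t. 0 \<le> s \<and> s \<le> t \<longrightarrow>
        (\<exists>Y. is_set_cond_exp P (F s) (X t) Y \<and> (AE \<omega> in P. X s \<omega> \<subseteq> Y \<omega>)))"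

definition set_martingale ::
    "'w measure \<Rightarrow> (real \<Rightarrow> 'w measure) \<Rightarrow> (real \<Rightarrow> 'w \<Rightarrow> 'b::euclidean_space set) \<Rightarrow> bool" where
  "set_martingale P F X \<longleftrightarrow>
     adapted_set_process F X \<and> integrable_process P X \<and>
     (\<forall>s t. 0 \<le> s \<and> s \<le> t \<longrightarrow>
        (\<exists>Y. is_set_cond_exp P (F s) (X t) Y \<and> (AE \<omega> in P. X s \<omega> = Y \<omega>)))"

section \<open>One-sided limits along the rationals\<close>

abbreviation rat_left :: "real \<Rightarrow> real filter" where
  "rat_left t \<equiv> at t within (\<rat> \<inter> {0..<t})"

abbreviation rat_right :: "real \<Rightarrow> real filter" where
  "rat_right t \<equiv> at t within (\<rat> \<inter> {t<..})"

definition regularity_event ::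
    "'w measure \<Rightarrow> (real \<Rightarrow> 'w \<Rightarrow> 'b::euclidean_space set) \<Rightarrow> 'w set \<Rightarrow> bool" where
  "regularity_event P X A \<longleftrightarrow>
     A \<in> sets P \<and> measure P A = 1 \<and>
     (\<forall>\<omega>\<in>A.
        (\<forall>t>0. \<exists>L. compact L \<and> convex L \<and> hausdorff_tendsto (\<lambda>r. X r \<omega>) L (rat_left t)) \<and>
        (\<forall>t\<ge>0. \<exists>L. compact L \<and> convex L \<and> hausdorff_tendsto (\<lambda>r. X r \<omega>) L (rat_right t)))"

definition left_limit_process ::
    "'w set \<Rightarrow> (real \<Rightarrow> 'w \<Rightarrow> 'b::euclidean_space set) \<Rightarrow> real \<Rightarrow> 'w \<Rightarrow> 'b set" where
  "left_limit_process A X t \<omega> =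
     (if t = 0 then X 0 \<omega>
      else if \<omega> \<in> A then hausdorff_lim (rat_left t) (\<lambda>r. X r \<omega>)
      else {0})"

end

theory Submission
  imports Defs
begin

text \<open>
  A nonempty compact convex set is determined by its support function on the countable dense set
  \<open>W\<close>, so the theorem reduces to the real processes \<open>s(u, M\<^sub>r)\<close>. Near-maximal measurable selections show
  that these are real submartingales. Hence both \<open>s(u, M\<^sub>r)\<close> and \<open>s(-u, M\<^sub>r) \<ge> -s(u, M\<^sub>r)\<close> have
  excesses over a level \<open>K\<close> dominated by those at time \<open>t\<close>, and \<open>s(u, M\<^sub>r)\<close>, \<open>r \<le> t\<close>, is uniformly
  integrable. Pathwise Hausdorff convergence then becomes \<open>L\<^sup>1\<close> convergence of support functions, and
  all inequalities pass to the limit on events of \<open>F\<^sub>s\<close>, \<open>s < t\<close>; left continuity of the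
  filtration extends them to \<open>F\<^sub>t\<close>.

  The conditional expectation of \<open>M\<^sub>t\<^sub>-\<close> is constructed by the method of Hiai and Umegaki: it is the
  closure of countably many conditional expectations of selections which nearly minimize the
  \<open>L\<^sup>1\<close> distance to the points of a countable dense set.
\<close>

text \<open>In general no integrable function dominates all \<open>M r\<close> with
  \<open>r < t\<close> at once, and a submartingale controls its past only from above; this is why
  convergence of integrals rests on uniform integrability and why the directions \<open>u\<close>
  and \<open>-u\<close> are treated together. All comparisons are inequalities between integrals of
  support functions over events. In that form they survive limits and do not depend on the choice of
  versions; inclusions of sets are recovered at the end from countably many directions. An
  inequality on events before \<open>t\<close> is not inherited by complements, so events of
  \<open>F t\<close> are approximated in the measure whose density is the modulus of the integrand.
  The conditional expectation of the left limit has to be exhibited because the submartingale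
  property asserts its existence. It is the closure of a sequence of measurable functions, so that
  almost sure facts about the sequence, such as convexity with rational weights and bounds in
  coordinate directions, pass to the whole set outside a single null set.\<close>

section \<open>Support functions and Hausdorff limits\<close>

text \<open>For an unbounded set with infinite support function the value is the junk \<open>0\<close>.\<close>

definition ssup :: "'b::real_inner \<Rightarrow> 'b set \<Rightarrow> real" where
  "ssup u C = real_of_ereal (support_fun u C)"

lemma ereal_ssup:
  assumes "bounded C" "C \<noteq> {}"
  shows "ereal (ssup u C) = support_fun u C"
proof -
  obtain x where x: "x \<in> C" using assms by auto
  obtain B where B: "\<And>x. x \<in> C \<Longrightarrow> norm x \<le> B"
    using assms(1) by (auto simp: bounded_iff)
  have "support_fun u C \<le> ereal (norm u * B)"
    unfolding support_fun_def
  proof (rule SUP_least)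
    fix y assume "y \<in> C"
    have "u \<bullet> y \<le> norm u * norm y" by (rule norm_cauchy_schwarz)
    also have "\<dots> \<le> norm u * B" using B[OF \<open>y \<in> C\<close>] by (simp add: mult_left_mono)
    finally show "ereal (u \<bullet> y) \<le> ereal (norm u * B)" by simp
  qed
  moreover have "ereal (u \<bullet> x) \<le> support_fun u C"
    unfolding support_fun_def using x by (rule SUP_upper)
  ultimately show ?thesis
    unfolding ssup_def by (cases "support_fun u C") auto
qed

lemma ssup_upper: "bounded C \<Longrightarrow> x \<in> C \<Longrightarrow> u \<bullet> x \<le> ssup u C"
proof -
  assume a: "bounded C" "x \<in> C"
  have "ereal (u \<bullet> x) \<le> support_fun u C"
    unfolding support_fun_def using a(2) by (rule SUP_upper)
  then show ?thesis using ereal_ssup[of C u] a by (metis empty_iff ereal_less_eq(3))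
qed

lemma ssup_least:
  assumes "C \<noteq> {}" "\<And>x. x \<in> C \<Longrightarrow> u \<bullet> x \<le> c"
  shows "ssup u C \<le> c"
proof -
  have "support_fun u C \<le> ereal c"
    unfolding support_fun_def using assms by (intro SUP_least) simp
  moreover obtain x where x: "x \<in> C" using assms by auto
  have "ereal (u \<bullet> x) \<le> support_fun u C"
    unfolding support_fun_def using x by (rule SUP_upper)
  ultimately show ?thesis unfolding ssup_def by (cases "support_fun u C") auto
qed

text \<open>A point outside \<open>C\<close> is strictly separated by a hyperplane, and the gap
  survives a small change of the normal vector because \<open>C\<close> is bounded. Hence the unit
  normal may be replaced by a nearby direction from \<open>W\<close>.\<close>

lemma mem_iff_ssup:
  fixes C :: "'b::euclidean_space set"
  assumes C: "compact C" "convex C" "C \<noteq> {}" and W: "cball 0 1 \<subseteq> closure W"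
  shows "z \<in> C \<longleftrightarrow> (\<forall>u\<in>W. u \<bullet> z \<le> ssup u C)"
proof
  show "z \<in> C \<Longrightarrow> \<forall>u\<in>W. u \<bullet> z \<le> ssup u C"
    using compact_imp_bounded[OF C(1)] ssup_upper by blast
next
  assume *: "\<forall>u\<in>W. u \<bullet> z \<le> ssup u C"
  show "z \<in> C"
  proof (rule ccontr)
    assume "z \<notin> C"
    then obtain a b where ab: "a \<bullet> z < b" "\<forall>x\<in>C. b < a \<bullet> x"
      using separating_hyperplane_closed_point[OF C(2) compact_imp_closed[OF C(1)]] by blast
    have "a \<noteq> 0" using ab C(3) by force
    \<comment> \<open>The separation puts \<open>z\<close> below the level \<open>b\<close> and
      \<open>C\<close> above it, so the sign is reversed to obtain a unit vector pointing from
      \<open>C\<close> towards \<open>z\<close>; \<open>g\<close> is the gap in that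
      direction.\<close>
    define v where "v = - (a /\<^sub>R norm a)"
    define g where "g = (b - a \<bullet> z) / norm a"
    have g: "g > 0" using ab \<open>a \<noteq> 0\<close> by (simp add: g_def)
    have vg: "v \<bullet> x + g \<le> v \<bullet> z" if "x \<in> C" for x
    proof -
      have "(b - a \<bullet> z) / norm a \<le> (a \<bullet> x - a \<bullet> z) / norm a"
        using ab that by (intro divide_right_mono) (auto simp: less_imp_le)
      then show ?thesis
        by (simp add: v_def g_def divide_inverse algebra_simps)
    qed
    have "v \<in> cball 0 1" using \<open>a \<noteq> 0\<close> by (simp add: v_def)
    obtain B where B: "\<And>x. x \<in> C \<Longrightarrow> norm x \<le> B" "B > 0"
      using compact_imp_bounded[OF C(1)] bounded_pos by metis
    \<comment> \<open>Exchanging \<open>v\<close> for \<open>w\<close> costs at most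
      \<open>d * B\<close> on \<open>C\<close> and \<open>d * norm z\<close> at \<open>z\<close>;
      this \<open>d\<close> makes the total exactly \<open>g / 2\<close>, so half of the gap is
      left.\<close>
    define d where "d = g / (2 * (norm z + B))"
    have nB: "norm z + B > 0" using B(2) by (simp add: add_nonneg_pos)
    have d: "d > 0" using g nB by (simp add: d_def)
    obtain w where w: "w \<in> W" "dist w v < d"
      using \<open>v \<in> cball 0 1\<close> W d closure_approachable by blast
    have wv: "\<bar>(w - v) \<bullet> x\<bar> \<le> d * norm x" for x
      using Cauchy_Schwarz_ineq2[of "w - v" x] w(2)
      by (metis dist_norm less_imp_le mult_right_mono norm_ge_zero order_trans)
    have "w \<bullet> x \<le> w \<bullet> z - g / 2" if "x \<in> C" for x
    proof -
      have "w \<bullet> x \<le> v \<bullet> x + d * norm x" using wv[of x] by (simp add: inner_diff_left abs_le_iff)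
      also have "d * norm x \<le> d * B" using B(1)[OF that] d by simp
      also have "v \<bullet> x \<le> v \<bullet> z - g" using vg[OF that] by simp
      also have "v \<bullet> z \<le> w \<bullet> z + d * norm z" using wv[of z] by (simp add: inner_diff_left abs_le_iff)
      finally have "w \<bullet> x \<le> w \<bullet> z - g + d * (norm z + B)" by (simp add: algebra_simps)
      also have "d * (norm z + B) = g / 2" using nB unfolding d_def by (simp add: field_simps)
      finally show ?thesis by simp
    qed
    then have "ssup w C \<le> w \<bullet> z - g / 2" by (intro ssup_least C(3))
    with * w(1) g show False by fastforce
  qed
qed

text \<open>Convexity is asked only of the larger set: the points of \<open>D\<close> merely have to
  satisfy the inequalities that cut out \<open>C\<close>.\<close>

lemma subset_if_ssup_le:
  fixes C :: "'b::euclidean_space set"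
  assumes C: "compact C" "convex C" "C \<noteq> {}" and W: "cball 0 1 \<subseteq> closure W"
    and "bounded D" "\<And>u. u \<in> W \<Longrightarrow> ssup u D \<le> ssup u C"
  shows "D \<subseteq> C"
  using mem_iff_ssup[OF C W] assms(5,6) ssup_upper order_trans by (metis subsetI)

lemma infdist_lessE:
  assumes "infdist x D < e" "D \<noteq> {}"
  obtains z where "z \<in> D" "dist x z < e"
proof (rule ccontr)
  assume "\<not> thesis"
  with that have "e \<le> dist x z" if "z \<in> D" for z using that by force
  then have "e \<le> infdist x D" unfolding infdist_notempty[OF assms(2)]
    by (intro cINF_greatest assms)
  with assms show False by simp
qed

text \<open>One half of the Lipschitz estimate for support functions with respect to the Hausdorff
  distance, with constant \<open>norm u\<close>; exchanging the two sets gives the other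
  half.\<close>

lemma ssup_le_if_close:
  assumes "bounded C" "C \<noteq> {}" "bounded D" "D \<noteq> {}" "\<And>x. x \<in> C \<Longrightarrow> infdist x D < e"
  shows "ssup u C \<le> ssup u D + norm u * e"
proof (rule ssup_least[OF assms(2)])
  fix x assume "x \<in> C"
  then obtain z where z: "z \<in> D" "dist x z < e" using assms infdist_lessE by metis
  have "u \<bullet> x = u \<bullet> z + u \<bullet> (x - z)" by (simp add: inner_diff_right)
  also have "u \<bullet> (x - z) \<le> norm u * norm (x - z)" by (rule norm_cauchy_schwarz)
  also have "\<dots> \<le> norm u * e" using z by (intro mult_left_mono) (auto simp: dist_norm)
  finally show "u \<bullet> x \<le> ssup u D + norm u * e" using ssup_upper[OF assms(3) z(1), of u] by simp
qed

lemma infdist_le_if_close: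
  assumes "C \<noteq> {}" "\<And>x. x \<in> C \<Longrightarrow> infdist x D \<le> e"
  shows "infdist c D \<le> infdist c C + e"
proof -
  have "infdist c D - e \<le> dist c x" if "x \<in> C" for x
    using infdist_triangle[of c D x] assms(2)[OF that] by simp
  then have "infdist c D - e \<le> infdist c C"
    unfolding infdist_notempty[OF assms(1)] by (intro cINF_greatest assms)
  then show ?thesis by simp
qed

lemma bounded_if_close:
  fixes C D :: "'b::real_normed_vector set"
  assumes "bounded D" "D \<noteq> {}" "\<And>x. x \<in> C \<Longrightarrow> infdist x D < e"
  shows "bounded C"
proof -
  obtain B where B: "\<And>x. x \<in> D \<Longrightarrow> norm x \<le> B"
    using assms(1) by (auto simp: bounded_iff)
  have "norm x \<le> B + e" if x: "x \<in> C" for x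
  proof -
    obtain z where "z \<in> D" "dist x z < e" using infdist_lessE[of x D e] assms x by metis
    then show ?thesis using B[of z] norm_triangle_sub[of x z] by (simp add: dist_norm)
  qed
  then show ?thesis by (auto simp: bounded_iff)
qed

lemma hausdorff_tendstoI:
  assumes "closed L" "L \<noteq> {}"
    and "\<And>e. e > 0 \<Longrightarrow> \<forall>\<^sub>F r in \<Phi>. (\<forall>x\<in>f r. infdist x L \<le> e) \<and> (\<forall>y\<in>L. infdist y (f r) \<le> e)"
  shows "hausdorff_tendsto f L \<Phi>"
proof -
  have "((\<lambda>r. hausdorff_dist (f r) L) \<longlongrightarrow> 0) \<Phi>"
  proof (rule order_tendstoI)
    fix a :: ennreal assume "a > 0"
    \<comment> \<open>The supremum of distances bounded by \<open>e\<close> is again at most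
      \<open>e\<close>, so \<open>e\<close> is taken strictly below \<open>a\<close>, which may be
      infinite.\<close>
    then obtain e where e: "e > 0" "ennreal e < a"
      by (metis antisym_conv3 dense dual_order.asym ennreal_cases ennreal_less_top not_less)
    from assms(3)[OF e(1)] show "\<forall>\<^sub>F r in \<Phi>. hausdorff_dist (f r) L < a"
    proof eventually_elim
      case (elim r)
      have "hausdorff_dist (f r) L \<le> ennreal e"
        unfolding hausdorff_dist_def using elim e(1)
        by (auto intro!: SUP_least ennreal_leI)
      then show ?case using e(2) by simp
    qed
  qed simp
  then show ?thesis using assms by (simp add: hausdorff_tendsto_def)
qed

text \<open>On a fixed path single sets \<open>M r \<omega>\<close> may be unbounded, where
  \<open>ssup\<close> may be the default \<open>0\<close>. Being within distance \<open>1\<close> of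
  a bounded limit eventually excludes this.\<close>

lemma hausdorff_tendsto_bounded:
  fixes L :: "'b::real_normed_vector set"
  assumes "hausdorff_tendsto f L \<Phi>" "bounded L"
  shows "\<forall>\<^sub>F r in \<Phi>. bounded (f r)"
  using hausdorff_tendsto_infdist[OF assms(1) zero_less_one]
proof eventually_elim
  case (elim r)
  then show ?case using bounded_if_close[OF assms(2), of "f r" 1] assms(1)
    by (auto simp: hausdorff_tendsto_def)
qed

lemma tendsto_ssup:
  assumes f: "hausdorff_tendsto f L \<Phi>" "bounded L" "\<forall>\<^sub>F r in \<Phi>. f r \<noteq> {}"
  shows "((\<lambda>r. ssup u (f r)) \<longlongrightarrow> ssup u L) \<Phi>"
proof (rule tendstoI)
  fix e :: real assume e: "e > 0"
  \<comment> \<open>The divisor \<open>norm u + 1\<close> in place of \<open>norm u\<close> also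
    covers \<open>u = 0\<close> and makes \<open>norm u * d < e\<close> strict.\<close>
  define d where "d = e / (norm u + 1)"
  have nu: "norm u + 1 > 0" by (simp add: add_nonneg_pos)
  have d: "d > 0" "norm u * d < e"
    using e nu by (auto simp: d_def divide_simps)
  have L: "L \<noteq> {}" using f by (simp add: hausdorff_tendsto_def)
  show "\<forall>\<^sub>F r in \<Phi>. dist (ssup u (f r)) (ssup u L) < e"
    using hausdorff_tendsto_infdist[OF f(1) d(1)] hausdorff_tendsto_bounded[OF f(1,2)] f(3)
  proof eventually_elim
    case (elim r)
    then show ?case
      using ssup_le_if_close[of "f r" L d u] ssup_le_if_close[of L "f r" d u] f(2) L d(2)
      by (auto simp: dist_real_def)
  qed
qed

text \<open>Distance functions will carry measurability over to a limit set, since pointwise limits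
  of measurable real functions are measurable.\<close>

lemma tendsto_infdist_hausdorff:
  assumes f: "hausdorff_tendsto f L \<Phi>" "\<forall>\<^sub>F r in \<Phi>. f r \<noteq> {}"
  shows "((\<lambda>r. infdist c (f r)) \<longlongrightarrow> infdist c L) \<Phi>"
proof (rule tendstoI)
  fix e :: real assume e: "e > 0"
  have L: "L \<noteq> {}" using f by (simp add: hausdorff_tendsto_def)
  show "\<forall>\<^sub>F r in \<Phi>. dist (infdist c (f r)) (infdist c L) < e"
    using hausdorff_tendsto_infdist[OF f(1) half_gt_zero[OF e]] f(2)
  proof eventually_elim
    case (elim r)
    then show ?case
      using infdist_le_if_close[of "f r" L "e / 2" c] infdist_le_if_close[of L "f r" "e/2" c] L e
      by (auto simp: dist_real_def less_imp_le)
  qed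
qed

text \<open>Finitely many support values control the norm of the whole set, so that integrable
  boundedness can be read off from support functions.\<close>

lemma norm_le_sum_ssup:
  fixes C :: "'b::euclidean_space set"
  assumes "bounded C" "x \<in> C"
  shows "norm x \<le> (\<Sum>b\<in>Basis. \<bar>ssup b C\<bar> + \<bar>ssup (- b) C\<bar>)"
proof -
  have "norm x \<le> (\<Sum>b\<in>Basis. \<bar>x \<bullet> b\<bar>)" by (rule norm_le_l1)
  also have "\<dots> \<le> (\<Sum>b\<in>Basis. \<bar>ssup b C\<bar> + \<bar>ssup (- b) C\<bar>)"
  proof (rule sum_mono)
    fix b :: 'b
    show "\<bar>x \<bullet> b\<bar> \<le> \<bar>ssup b C\<bar> + \<bar>ssup (- b) C\<bar>"
      using ssup_upper[OF assms, of b] ssup_upper[OF assms, of "- b"]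
      by (simp add: inner_commute)
  qed
  finally show ?thesis .
qed

section \<open>Left limits along the rationals\<close>

lemma rat_left_nontriv: "t > 0 \<Longrightarrow> rat_left t \<noteq> bot"
proof -
  assume "t > 0"
  have "\<exists>x\<in>\<rat> \<inter> {0..<t}. x \<noteq> t \<and> dist x t < e" if "e > 0" for e
  proof -
    obtain q where "q \<in> \<rat>" "max 0 (t - e) < q" "q < t"
      using Rats_dense_in_real[of "max 0 (t - e)" t] \<open>t > 0\<close> \<open>e > 0\<close> by force
    then show ?thesis by (intro bexI[of _ q]) (auto simp: dist_real_def)
  qed
  then show ?thesis by (simp add: trivial_limit_within islimpt_approachable)
qed

lemma rat_left_ge: "t > 0 \<Longrightarrow> a < t \<Longrightarrow> \<forall>\<^sub>F r in rat_left t. r \<in> \<rat> \<and> a < r \<and> r < t \<and> 0 \<le> r"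
  unfolding eventually_at by (intro exI[of _ "t - a"]) (auto simp: dist_real_def)

text \<open>Information at rational times is transferred to left limits at arbitrary times:
  \<open>K\<close> is approached by sets \<open>f r\<close> with rational \<open>r\<close> just
  below \<open>s\<close>, and such \<open>r\<close> still lie in the interval. The two distances add
  up to \<open>2 * e\<close>. To the left of a point this yields left continuity, to the right of it
  a right limit.\<close>

lemma close_left_limit:
  assumes close: "\<And>r. r \<in> \<rat> \<Longrightarrow> a < r \<Longrightarrow> r < b \<Longrightarrow>
      (\<forall>x\<in>f r. infdist x L < e) \<and> (\<forall>y\<in>L. infdist y (f r) < e)"
    and K: "hausdorff_tendsto f K (rat_left s)" "\<And>r. r \<ge> 0 \<Longrightarrow> f r \<noteq> {}"
    and s: "0 < s" "a < s" "s \<le> b" and "L \<noteq> {}" "e > 0"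
  shows "(\<forall>x\<in>K. infdist x L \<le> 2 * e) \<and> (\<forall>y\<in>L. infdist y K \<le> 2 * e)"
proof -
  have "\<forall>\<^sub>F r in rat_left s. r \<in> \<rat> \<and> a < r \<and> r < s \<and> 0 \<le> r \<and>
      (\<forall>x\<in>f r. infdist x K < e) \<and> (\<forall>y\<in>K. infdist y (f r) < e)"
    using rat_left_ge[OF s(1,2)] hausdorff_tendsto_infdist[OF K(1) \<open>e > 0\<close>]
    by eventually_elim auto
  then obtain r where r: "r \<in> \<rat>" "a < r" "r < s" "0 \<le> r"
      "\<forall>x\<in>f r. infdist x K < e" "\<forall>y\<in>K. infdist y (f r) < e"
    using eventually_happens'[OF rat_left_nontriv[OF s(1)]] by blast
  have c: "\<forall>x\<in>f r. infdist x L < e" "\<forall>y\<in>L. infdist y (f r) < e"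
    using close[of r] r s by auto
  have "infdist x L \<le> 2 * e" if "x \<in> K" for x
    using infdist_le_if_close[of "f r" L e x] K(2)[OF r(4)] c r(6) that by force
  moreover have "infdist y K \<le> 2 * e" if "y \<in> L" for y
    using infdist_le_if_close[of "f r" K e y] K(2)[OF r(4)] c r(5) that by force
  ultimately show ?thesis by blast
qed

section \<open>Measurable selections\<close>

text \<open>A closed half-space contains the closure as soon as it contains \<open>C\<close>. The
  supremum over a random set can thus be taken over a dense sequence of selections, which makes it
  measurable.\<close>

lemma support_fun_closure: "support_fun u (closure C) = support_fun u C"
proof (rule antisym)
  have "closed {x. ereal (u \<bullet> x) \<le> support_fun u C}"
    by (intro closed_Collect_le continuous_intros)
  then have "closure C \<subseteq> {x. ereal (u \<bullet> x) \<le> support_fun u C}"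
    by (intro closure_minimal) (auto simp: support_fun_def intro: SUP_upper)
  then show "support_fun u (closure C) \<le> support_fun u C"
    unfolding support_fun_def[of u "closure C"] by (auto intro!: SUP_least)
  show "support_fun u C \<le> support_fun u (closure C)"
    unfolding support_fun_def using closure_subset by (intro SUP_subset_mono) auto
qed

lemma set_norm_closure: "set_norm (closure C) = set_norm C"
proof (rule antisym)
  have "closed {x. ennreal (norm x) \<le> set_norm C}"
    by (intro closed_Collect_le continuous_on_ennreal continuous_intros)
  then have "closure C \<subseteq> {x. ennreal (norm x) \<le> set_norm C}"
    by (intro closure_minimal) (auto simp: set_norm_def intro: SUP_upper)
  then show "set_norm (closure C) \<le> set_norm C"
    unfolding set_norm_def[of "closure C"] by (auto intro!: SUP_least)
  show "set_norm C \<le> set_norm (closure C)"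
    unfolding set_norm_def using closure_subset by (intro SUP_subset_mono) auto
qed

text \<open>Closed sets are countable unions of compact sets, and a closed set meets a compact set
  exactly when its distance function vanishes somewhere on it. The infimum of the distance over a
  compact set is computed on a countable dense subset.\<close>

lemma random_closed_setI:
  fixes Y :: "'w \<Rightarrow> 'b::euclidean_space set"
  assumes Y: "\<And>\<omega>. \<omega> \<in> space G \<Longrightarrow> closed (Y \<omega>) \<and> Y \<omega> \<noteq> {}"
    and [measurable]: "\<And>c. (\<lambda>\<omega>. infdist c (Y \<omega>)) \<in> borel_measurable G"
  shows "random_closed_set G Y"
  unfolding random_closed_set_def
proof (intro conjI allI impI ballI)
  fix C :: "'b set" assume C: "closed C"
  define K where "K n = C \<inter> cball 0 (real n)" for n :: nat
  have K: "compact (K n)" for n using C by (simp add: K_def closed_Int_compact)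
  have "\<exists>T. countable T \<and> T \<subseteq> K n \<and> K n \<subseteq> closure T" for n
    using separable by metis
  then obtain T where T: "\<And>n. countable (T n)" "\<And>n. T n \<subseteq> K n" "\<And>n. K n \<subseteq> closure (T n)"
    by metis
  have "{\<omega>\<in>space G. Y \<omega> \<inter> C \<noteq> {}} =
      (\<Union>n. {\<omega>\<in>space G. \<forall>m. \<exists>d\<in>T n. infdist d (Y \<omega>) < 1 / real (Suc m)})" (is "?L = ?R")
  proof (intro subset_antisym subsetI)
    fix \<omega> assume "\<omega> \<in> ?L"
    then obtain y where y: "\<omega> \<in> space G" "y \<in> Y \<omega>" "y \<in> C" by auto
    obtain n where "norm y \<le> real n" using real_arch_simple by blast
    then have "y \<in> closure (T n)" using y T(3)[of n] by (auto simp: K_def)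
    then have "\<exists>d\<in>T n. dist d y < 1 / real (Suc m)" for m
      unfolding closure_approachable by simp
    then have "\<exists>d\<in>T n. infdist d (Y \<omega>) < 1 / real (Suc m)" for m
      using infdist_le[OF y(2)] le_less_trans by blast
    then show "\<omega> \<in> ?R" using y by blast
  next
    fix \<omega> assume "\<omega> \<in> ?R"
    then obtain n where w: "\<omega> \<in> space G"
      and d: "\<And>m. \<exists>d\<in>T n. infdist d (Y \<omega>) < 1 / real (Suc m)" by blast
    have ne: "K n \<noteq> {}" using d[of 0] T(2)[of n] by blast
    \<comment> \<open>Compactness of \<open>K n\<close> yields a minimizer, so that infimum
      \<open>0\<close> becomes an actual common point and not mere closeness.\<close>
    obtain c where c: "c \<in> K n" "\<And>d. d \<in> K n \<Longrightarrow> infdist c (Y \<omega>) \<le> infdist d (Y \<omega>)"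
      using continuous_attains_inf[OF K ne, of "\<lambda>d. infdist d (Y \<omega>)"]
        continuous_on_infdist[OF continuous_on_id, of "K n" "Y \<omega>"] by blast
    have "infdist c (Y \<omega>) < 1 / real (Suc m)" for m
      using d[of m] c(2) T(2)[of n] by (meson le_less_trans subsetD)
    then have "infdist c (Y \<omega>) \<le> 0"
      by (metis linorder_not_le nat_approx_posE order_less_asym)
    then have "c \<in> Y \<omega>"
      using in_closed_iff_infdist_zero Y[OF w] infdist_nonneg by (metis order_antisym)
    then show "\<omega> \<in> ?L" using c(1) w by (auto simp: K_def)
  qed
  also have "\<dots> \<in> sets G"
  proof (intro sets.countable_UN image_subsetI)
    fix n
    have [measurable]: "countable (T n)" by (rule T)
    show "{\<omega>\<in>space G. \<forall>m. \<exists>d\<in>T n. infdist d (Y \<omega>) < 1 / real (Suc m)} \<in> sets G"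
      by measurable
  qed
  finally show "?L \<in> sets G" .
qed (use Y in auto)

lemma random_closed_setD:
  assumes "random_closed_set G X" "\<omega> \<in> space G"
  shows "closed (X \<omega>)" "X \<omega> \<noteq> {}"
  using assms by (auto simp: random_closed_set_def)

lemma random_closed_set_subalgebra:
  "random_closed_set G X \<Longrightarrow> subalgebra P G \<Longrightarrow> random_closed_set P X"
  by (auto simp: random_closed_set_def subalgebra_def)

text \<open>Nonempty closed sets in Euclidean space attain their distance from \<open>c\<close>, so
  sublevel sets are hitting events of closed balls. Together with \<open>random_closed_setI\<close>
  this makes measurability of hitting events and of distances equivalent for such values.\<close>

lemma borel_measurable_infdist_random_closed_set:
  fixes X :: "'w \<Rightarrow> 'b::euclidean_space set"
  assumes X: "random_closed_set G X"
  shows "(\<lambda>\<omega>. infdist c (X \<omega>)) \<in> borel_measurable G"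
  unfolding borel_measurable_iff_le
proof
  fix a
  have "{\<omega> \<in> space G. infdist c (X \<omega>) \<le> a} = {\<omega> \<in> space G. X \<omega> \<inter> cball c a \<noteq> {}}"
  proof (intro Collect_cong conj_cong refl)
    fix \<omega> assume w: "\<omega> \<in> space G"
    show "infdist c (X \<omega>) \<le> a \<longleftrightarrow> X \<omega> \<inter> cball c a \<noteq> {}"
    proof
      assume "infdist c (X \<omega>) \<le> a"
      moreover obtain x where "x \<in> X \<omega>" "infdist c (X \<omega>) = dist c x"
        using infdist_attains_inf[OF random_closed_setD[OF X w]] by metis
      ultimately show "X \<omega> \<inter> cball c a \<noteq> {}" by auto
    next
      assume "X \<omega> \<inter> cball c a \<noteq> {}"
      then obtain x where "x \<in> X \<omega>" "dist c x \<le> a" by auto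
      then show "infdist c (X \<omega>) \<le> a" using infdist_le[of x "X \<omega>" c] by simp
    qed
  qed
  then show "{\<omega> \<in> space G. infdist c (X \<omega>) \<le> a} \<in> sets G"
    using X by (auto simp: random_closed_set_def)
qed

text \<open>\<open>K\<close> is the first index whose ball meets the set; density of the centres
  makes it exist. It takes countably many values, so hitting events of the cut set are countable
  unions of events for fixed \<open>k\<close>. This is one step of the shrinking construction of a
  selection.\<close>

lemma random_closed_set_inter_nearest:
  fixes Z :: "'w \<Rightarrow> 'b::euclidean_space set" and q :: "nat \<Rightarrow> 'b"
  assumes Z: "random_closed_set G Z" and q: "closure (range q) = UNIV" and e: "e > 0"
  defines "K \<equiv> \<lambda>\<omega>. LEAST k. Z \<omega> \<inter> cball (q k) e \<noteq> {}"
  shows "random_closed_set G (\<lambda>\<omega>. Z \<omega> \<inter> cball (q (K \<omega>)) e)"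
  unfolding random_closed_set_def
proof (intro conjI allI impI ballI)
  fix \<omega> assume w: "\<omega> \<in> space G"
  show "closed (Z \<omega> \<inter> cball (q (K \<omega>)) e)"
    using random_closed_setD[OF Z w] by auto
  obtain z where z: "z \<in> Z \<omega>" using random_closed_setD[OF Z w] by auto
  have "z \<in> closure (range q)" using q by simp
  then obtain k where "dist (q k) z < e" using e unfolding closure_approachable by blast
  then have "Z \<omega> \<inter> cball (q k) e \<noteq> {}" using z by auto
  then show "Z \<omega> \<inter> cball (q (K \<omega>)) e \<noteq> {}" unfolding K_def by (rule LeastI)
next
  fix C :: "'b set" assume C: "closed C"
  have m: "{\<omega>\<in>space G. Z \<omega> \<inter> D \<noteq> {}} \<in> sets G" if "closed D" for D
    using Z that by (auto simp: random_closed_set_def)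
  have [measurable]: "Measurable.pred G (\<lambda>\<omega>. Z \<omega> \<inter> cball (q k) e \<noteq> {})" for k
    unfolding pred_def using m[of "cball (q k) e"] by simp
  have [measurable]: "Measurable.pred G (\<lambda>\<omega>. Z \<omega> \<inter> (cball (q k) e \<inter> C) \<noteq> {})" for k
    unfolding pred_def using m[of "cball (q k) e \<inter> C"] C by auto
  have [measurable]: "K \<in> measurable G (count_space UNIV)"
    unfolding K_def by measurable
  have "{\<omega>\<in>space G. Z \<omega> \<inter> cball (q (K \<omega>)) e \<inter> C \<noteq> {}} =
     {\<omega>\<in>space G. \<exists>k. K \<omega> = k \<and> Z \<omega> \<inter> (cball (q k) e \<inter> C) \<noteq> {}}" by (auto simp: Int_assoc)
  also have "\<dots> \<in> sets G" by measurable
  finally show "{\<omega>\<in>space G. Z \<omega> \<inter> cball (q (K \<omega>)) e \<inter> C \<noteq> {}} \<in> sets G" .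
qed

lemma ex_dense_sequence: "\<exists>q :: nat \<Rightarrow> 'b::euclidean_space. closure (range q) = UNIV"
proof -
  obtain T :: "'b set" where T: "countable T" "UNIV \<subseteq> closure T" using separable[of UNIV] by auto
  then have "T \<noteq> {}" by auto
  then have "range (from_nat_into T) = T" using T by (simp add: range_from_nat_into)
  then show ?thesis using T by (metis top.extremum_unique)
qed

text \<open>The sets \<open>Z n \<omega>\<close> below decrease with diameters tending to \<open>0\<close>; the selection is the point they
  shrink to.\<close>

lemma random_closed_set_selection:
  fixes X :: "'w \<Rightarrow> 'b::euclidean_space set"
  assumes X: "random_closed_set G X"
  obtains \<xi> where "\<xi> \<in> borel_measurable G" "\<And>\<omega>. \<omega> \<in> space G \<Longrightarrow> \<xi> \<omega> \<in> X \<omega>"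
proof -
  obtain q :: "nat \<Rightarrow> 'b" where q: "closure (range q) = UNIV" using ex_dense_sequence by blast
  define Z where "Z = rec_nat X (\<lambda>n Z \<omega>.
    Z \<omega> \<inter> cball (q (LEAST k. Z \<omega> \<inter> cball (q k) ((1/2)^n) \<noteq> {})) ((1/2)^n))"
  have Z0: "Z 0 = X" by (simp add: Z_def)
  have ZS: "Z (Suc n) = (\<lambda>\<omega>. Z n \<omega> \<inter>
     cball (q (LEAST k. Z n \<omega> \<inter> cball (q k) ((1/2)^n) \<noteq> {})) ((1/2)^n))" for n
    by (simp add: Z_def)
  have Z: "random_closed_set G (Z n)" for n
  proof (induction n)
    case (Suc n)
    show ?case unfolding ZS by (rule random_closed_set_inter_nearest[OF Suc q]) simp
  qed (simp add: Z0 X)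
  have dec: "Z n \<omega> \<subseteq> Z m \<omega>" if "m \<le> n" for m n \<omega>
    using that by (induction rule: dec_induct) (auto simp: ZS)
  have diam: "\<exists>n. \<forall>x\<in>Z n \<omega>. \<forall>y\<in>Z n \<omega>. dist x y < e" if e: "e > 0" for e \<omega>
  proof -
    obtain n where n: "(1/2)^n < e / 2" using real_arch_pow_inv[of "e / 2" "1 / 2"] e by auto
    have "dist x y < e" if xy: "x \<in> Z (Suc n) \<omega>" "y \<in> Z (Suc n) \<omega>" for x y
    proof -
      obtain c where "dist c x \<le> (1/2)^n" "dist c y \<le> (1/2)^n" using xy by (auto simp: ZS)
      then show ?thesis using dist_triangle3[of x y c] n by linarith
    qed
    then show ?thesis by blast
  qed
  \<comment> \<open>The additional closed set \<open>C\<close> allows a double use: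
    \<open>UNIV\<close> gives the selected point itself, and an arbitrary \<open>C\<close>
    identifies its preimage with an intersection of countably many hitting events.\<close>
  have sing: "\<exists>a. (\<Inter>n. Z n \<omega> \<inter> C) = {a}"
    if "\<omega> \<in> space G" "closed C" "\<And>n. Z n \<omega> \<inter> C \<noteq> {}" for \<omega> C
  proof -
    have "\<exists>a. \<Inter>(range (\<lambda>n. Z n \<omega> \<inter> C)) = {a}"
    proof (rule decreasing_closed_nest_sing)
      show "closed (Z n \<omega> \<inter> C)" for n using random_closed_setD[OF Z that(1)] that by auto
      show "Z n \<omega> \<inter> C \<subseteq> Z m \<omega> \<inter> C" if "m \<le> n" for m n using dec[OF that] by auto
      show "\<exists>n. \<forall>x\<in>Z n \<omega> \<inter> C. \<forall>y\<in>Z n \<omega> \<inter> C. dist x y < e" if "e > 0" for e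
        using diam[OF that] by blast
    qed (rule that)
    then show ?thesis by simp
  qed
  have "\<exists>a. (\<Inter>n. Z n \<omega>) = {a}" if "\<omega> \<in> space G" for \<omega>
    using sing[OF that closed_UNIV] random_closed_setD[OF Z that] by simp
  then obtain \<xi> where \<xi>: "\<And>\<omega>. \<omega> \<in> space G \<Longrightarrow> (\<Inter>n. Z n \<omega>) = {\<xi> \<omega>}" by metis
  have "\<xi> \<omega> \<in> X \<omega>" if "\<omega> \<in> space G" for \<omega> using \<xi>[OF that] Z0 by blast
  moreover have "\<xi> \<in> borel_measurable G"
    unfolding borel_eq_closed
  proof (rule measurable_measure_of)
    fix C :: "'b set" assume "C \<in> Collect closed"
    then have C: "closed C" by simp
    have "\<xi> -` C \<inter> space G = (\<Inter>n. {\<omega>\<in>space G. Z n \<omega> \<inter> C \<noteq> {}})"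
    proof (intro subset_antisym subsetI)
      fix \<omega> assume "\<omega> \<in> \<xi> -` C \<inter> space G"
      then show "\<omega> \<in> (\<Inter>n. {\<omega>\<in>space G. Z n \<omega> \<inter> C \<noteq> {}})" using \<xi>[of \<omega>] by blast
    next
      fix \<omega> assume "\<omega> \<in> (\<Inter>n. {\<omega>\<in>space G. Z n \<omega> \<inter> C \<noteq> {}})"
      then have w: "\<omega> \<in> space G" "\<And>n. Z n \<omega> \<inter> C \<noteq> {}" by auto
      obtain a where a: "(\<Inter>n. Z n \<omega> \<inter> C) = {a}" using sing[OF w(1) C w(2)] by blast
      then have "a \<in> (\<Inter>n. Z n \<omega> \<inter> C)" by simp
      then have "a \<in> C" "a \<in> (\<Inter>n. Z n \<omega>)" by auto
      then show "\<omega> \<in> \<xi> -` C \<inter> space G" using \<xi>[OF w(1)] w(1) by simp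
    qed
    also have "\<dots> \<in> sets G"
      using Z C by (intro sets.countable_INT) (auto simp: random_closed_set_def)
    finally show "\<xi> -` C \<inter> space G \<in> sets G" .
  qed auto
  ultimately show thesis using that by blast
qed

text \<open>Each small ball about a dense centre contributes a selection which lies in the ball
  whenever the ball meets \<open>X \<omega>\<close>. Near any point of \<open>X \<omega>\<close>
  there is such a ball, whence density.\<close>

lemma random_closed_set_castaing:
  fixes X :: "'w \<Rightarrow> 'b::euclidean_space set"
  assumes X: "random_closed_set G X"
  obtains \<xi> :: "nat \<Rightarrow> 'w \<Rightarrow> 'b" where "\<And>k. \<xi> k \<in> borel_measurable G"
    "\<And>\<omega>. \<omega> \<in> space G \<Longrightarrow> X \<omega> = closure (range (\<lambda>k. \<xi> k \<omega>))"
proof -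
  obtain q :: "nat \<Rightarrow> 'b" where q: "closure (range q) = UNIV" using ex_dense_sequence by blast
  define D where "D = (\<lambda>(j, m). cball (q j) (1 / real (Suc m)))"
  \<comment> \<open>When the ball misses \<open>X \<omega>\<close>, the uncut set is the fallback,
    so that the values stay nonempty and a selection exists for every \<open>p\<close>.\<close>
  define Z where "Z p \<omega> = (if X \<omega> \<inter> D p \<noteq> {} then X \<omega> \<inter> D p else X \<omega>)" for p \<omega>
  have D: "closed (D p)" for p by (auto simp: D_def split: prod.split)
  have "random_closed_set G (Z p)" for p
    unfolding random_closed_set_def
  proof (intro conjI allI impI ballI)
    fix \<omega> assume w: "\<omega> \<in> space G"
    show "closed (Z p \<omega>)" "Z p \<omega> \<noteq> {}"
      using random_closed_setD[OF X w] D[of p] by (auto simp: Z_def simp del: split_paired_All)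
  next
    fix C :: "'b set" assume C: "closed C"
    have m: "{\<omega>\<in>space G. X \<omega> \<inter> D \<noteq> {}} \<in> sets G" if "closed D" for D
      using X that by (auto simp: random_closed_set_def)
    have "{\<omega>\<in>space G. Z p \<omega> \<inter> C \<noteq> {}} = {\<omega>\<in>space G. X \<omega> \<inter> (D p \<inter> C) \<noteq> {}} \<union>
       ({\<omega>\<in>space G. X \<omega> \<inter> C \<noteq> {}} - {\<omega>\<in>space G. X \<omega> \<inter> D p \<noteq> {}})"
      by (auto simp: Z_def split: if_splits)
    also have "\<dots> \<in> sets G" using C D[of p] m by (intro sets.Un sets.Diff m closed_Int)
    finally show "{\<omega>\<in>space G. Z p \<omega> \<inter> C \<noteq> {}} \<in> sets G" .
  qed
  then have "\<exists>\<xi>. \<xi> \<in> borel_measurable G \<and> (\<forall>\<omega>\<in>space G. \<xi> \<omega> \<in> Z p \<omega>)" for p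
    using random_closed_set_selection by metis
  then obtain \<xi> where \<xi>: "\<And>p. \<xi> p \<in> borel_measurable G" "\<And>p \<omega>. \<omega> \<in> space G \<Longrightarrow> \<xi> p \<omega> \<in> Z p \<omega>"
    by metis
  have "X \<omega> = closure (range (\<lambda>k. \<xi> (prod_decode k) \<omega>))" if w: "\<omega> \<in> space G" for \<omega>
  proof (intro subset_antisym subsetI)
    fix x assume x: "x \<in> X \<omega>"
    show "x \<in> closure (range (\<lambda>k. \<xi> (prod_decode k) \<omega>))"
      unfolding closure_approachable
    proof (intro allI impI)
      fix e :: real assume e: "e > 0"
      obtain m where m: "1 / real (Suc m) < e / 2" using e nat_approx_posE by (metis half_gt_zero)
      have "x \<in> closure (range q)" using q by simp
      then obtain j where j: "dist (q j) x < 1 / real (Suc m)"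
        unfolding closure_approachable by (metis of_nat_0_less_iff rangeE zero_less_Suc zero_less_divide_1_iff)
      then have "X \<omega> \<inter> D (j, m) \<noteq> {}" using x by (auto simp: D_def)
      then have "\<xi> (j, m) \<omega> \<in> cball (q j) (1 / real (Suc m))"
        using \<xi>(2)[OF w, of "(j, m)"] by (auto simp: Z_def D_def)
      then have "dist (\<xi> (j, m) \<omega>) x < e"
        using dist_triangle3[of "\<xi> (j, m) \<omega>" x "q j"] j m by simp
      then show "\<exists>y\<in>range (\<lambda>k. \<xi> (prod_decode k) \<omega>). dist y x < e"
        by (intro bexI[of _ "\<xi> (j, m) \<omega>"] image_eqI[of _ _ "prod_encode (j, m)"]) simp_all
    qed
  next
    have "range (\<lambda>k. \<xi> (prod_decode k) \<omega>) \<subseteq> X \<omega>"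
    proof (intro image_subsetI)
      show "\<xi> (prod_decode k) \<omega> \<in> X \<omega>" for k
        using \<xi>(2)[OF w, of "prod_decode k"] unfolding Z_def by (auto split: if_splits)
    qed
    then have "closure (range (\<lambda>k. \<xi> (prod_decode k) \<omega>)) \<subseteq> X \<omega>"
      using random_closed_setD[OF X w] by (intro closure_minimal)
    then show "x \<in> closure (range (\<lambda>k. \<xi> (prod_decode k) \<omega>)) \<Longrightarrow> x \<in> X \<omega>" for x by blast
  qed
  with \<xi>(1) that[of "\<lambda>k. \<xi> (prod_decode k)"] show thesis by blast
qed

section \<open>Measurability and integrability of support functions\<close>

lemma borel_measurable_support_fun:
  fixes X :: "'w \<Rightarrow> 'b::euclidean_space set"
  assumes "random_closed_set G X"
  shows "(\<lambda>\<omega>. support_fun u (X \<omega>)) \<in> borel_measurable G"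
proof -
  obtain \<xi> :: "nat \<Rightarrow> 'w \<Rightarrow> 'b" where [measurable]: "\<And>k. \<xi> k \<in> borel_measurable G"
    and \<xi>: "\<And>\<omega>. \<omega> \<in> space G \<Longrightarrow> X \<omega> = closure (range (\<lambda>k. \<xi> k \<omega>))"
    using random_closed_set_castaing[OF assms] by metis
  have "support_fun u (X \<omega>) = (SUP k. ereal (u \<bullet> \<xi> k \<omega>))" if "\<omega> \<in> space G" for \<omega>
    using \<xi>[OF that] by (simp add: support_fun_closure) (simp add: support_fun_def image_comp o_def)
  then show ?thesis by (subst measurable_cong) measurable
qed

lemma borel_measurable_ssup:
  fixes X :: "'w \<Rightarrow> 'b::euclidean_space set"
  assumes "random_closed_set G X"
  shows "(\<lambda>\<omega>. ssup u (X \<omega>)) \<in> borel_measurable G"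
  unfolding ssup_def using borel_measurable_support_fun[OF assms] by measurable

lemma borel_measurable_set_norm:
  fixes X :: "'w \<Rightarrow> 'b::euclidean_space set"
  assumes "random_closed_set G X"
  shows "(\<lambda>\<omega>. set_norm (X \<omega>)) \<in> borel_measurable G"
proof -
  obtain \<xi> :: "nat \<Rightarrow> 'w \<Rightarrow> 'b" where [measurable]: "\<And>k. \<xi> k \<in> borel_measurable G"
    and \<xi>: "\<And>\<omega>. \<omega> \<in> space G \<Longrightarrow> X \<omega> = closure (range (\<lambda>k. \<xi> k \<omega>))"
    using random_closed_set_castaing[OF assms] by metis
  have "set_norm (X \<omega>) = (SUP k. ennreal (norm (\<xi> k \<omega>)))" if "\<omega> \<in> space G" for \<omega>
    using \<xi>[OF that] by (simp add: set_norm_closure) (simp add: set_norm_def image_comp o_def)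
  then show ?thesis by (subst measurable_cong) measurable
qed

text \<open>The first member of a dense sequence of selections that comes within \<open>e\<close> of
  the supremum is a measurable choice. Where \<open>X \<omega>\<close> is unbounded, whatever index
  results still gives a selection; near-maximality is claimed for bounded values only.\<close>

lemma near_max_selection:
  fixes X :: "'w \<Rightarrow> 'b::euclidean_space set"
  assumes X: "random_closed_set G X" and e: "e > 0"
  obtains \<xi> where "\<xi> \<in> borel_measurable G" "\<And>\<omega>. \<omega> \<in> space G \<Longrightarrow> \<xi> \<omega> \<in> X \<omega>"
    "\<And>\<omega>. \<omega> \<in> space G \<Longrightarrow> bounded (X \<omega>) \<Longrightarrow> ssup u (X \<omega>) - e < u \<bullet> \<xi> \<omega>"
proof -
  obtain \<xi> :: "nat \<Rightarrow> 'w \<Rightarrow> 'b" where [measurable]: "\<And>k. \<xi> k \<in> borel_measurable G"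
    and \<xi>: "\<And>\<omega>. \<omega> \<in> space G \<Longrightarrow> X \<omega> = closure (range (\<lambda>k. \<xi> k \<omega>))"
    using random_closed_set_castaing[OF X] by metis
  note borel_measurable_ssup[OF X, measurable]
  define K where "K \<omega> = (LEAST k. ssup u (X \<omega>) - e < u \<bullet> \<xi> k \<omega>)" for \<omega>
  have [measurable]: "K \<in> measurable G (count_space UNIV)"
    unfolding K_def by measurable
  have "(\<lambda>\<omega>. \<xi> (K \<omega>) \<omega>) \<in> borel_measurable G" by measurable
  moreover have "\<xi> (K \<omega>) \<omega> \<in> X \<omega>" if "\<omega> \<in> space G" for \<omega>
    unfolding \<xi>[OF that] by (rule subsetD[OF closure_subset]) simp
  moreover have "ssup u (X \<omega>) - e < u \<bullet> \<xi> (K \<omega>) \<omega>" if w: "\<omega> \<in> space G" "bounded (X \<omega>)" for \<omega>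
  proof -
    have "\<exists>k. ssup u (X \<omega>) - e < u \<bullet> \<xi> k \<omega>"
    proof (rule ccontr)
      assume "\<not> ?thesis"
      then have le: "u \<bullet> \<xi> k \<omega> \<le> ssup u (X \<omega>) - e" for k by (meson not_less)
      \<comment> \<open>If every member stayed \<open>e\<close> below the supremum, a closed
        half-space would contain the whole set, and the supremum itself would drop by
        \<open>e\<close>.\<close>
      have "closure (range (\<lambda>k. \<xi> k \<omega>)) \<subseteq> {x. u \<bullet> x \<le> ssup u (X \<omega>) - e}"
        using le by (intro closure_minimal closed_halfspace_le) auto
      then have "ssup u (X \<omega>) \<le> ssup u (X \<omega>) - e"
        using \<xi>[OF w(1)] random_closed_setD[OF X w(1)] by (intro ssup_least) auto
      then show False using e by simp
    qed
    then show ?thesis unfolding K_def by (rule LeastI_ex)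
  qed
  ultimately show thesis using that by blast
qed

lemma integrably_bounded_dominated:
  fixes X :: "'w \<Rightarrow> 'b::euclidean_space set"
  assumes X: "random_closed_set P X" and b: "integrably_bounded P X"
  obtains g :: "'w \<Rightarrow> real" where "integrable P g" "AE \<omega> in P. \<forall>x\<in>X \<omega>. norm x \<le> g \<omega>"
proof
  note borel_measurable_set_norm[OF X, measurable]
  have fin: "AE \<omega> in P. set_norm (X \<omega>) \<noteq> \<infinity>"
    using b by (intro nn_integral_PInf_AE) (auto simp: integrably_bounded_def)
  show "integrable P (\<lambda>\<omega>. enn2real (set_norm (X \<omega>)))"
  proof (rule integrableI_nonneg)
    have "(\<integral>\<^sup>+\<omega>. ennreal (enn2real (set_norm (X \<omega>))) \<partial>P) = (\<integral>\<^sup>+\<omega>. set_norm (X \<omega>) \<partial>P)"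
      using fin by (intro nn_integral_cong_AE) (auto elim!: eventually_mono simp: less_top)
    then show "(\<integral>\<^sup>+\<omega>. ennreal (enn2real (set_norm (X \<omega>))) \<partial>P) < \<infinity>"
      using b by (simp add: integrably_bounded_def)
  qed auto
  show "AE \<omega> in P. \<forall>x\<in>X \<omega>. norm x \<le> enn2real (set_norm (X \<omega>))"
    using fin
  proof eventually_elim
    case (elim \<omega>)
    have "norm x \<le> enn2real (set_norm (X \<omega>))" if "x \<in> X \<omega>" for x
    proof -
      have "ennreal (norm x) \<le> set_norm (X \<omega>)"
        unfolding set_norm_def using that by (rule SUP_upper)
      then show ?thesis using elim enn2real_mono[of "ennreal (norm x)"] by (simp add: less_top)
    qed
    then show ?case by blast
  qed
qed

lemma integrably_bounded_AE_bounded: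
  fixes X :: "'w \<Rightarrow> 'b::euclidean_space set"
  assumes X: "random_closed_set P X" and b: "integrably_bounded P X"
  shows "AE \<omega> in P. bounded (X \<omega>)"
proof -
  obtain g :: "'w \<Rightarrow> real" where "AE \<omega> in P. \<forall>x\<in>X \<omega>. norm x \<le> g \<omega>"
    using integrably_bounded_dominated[OF assms] by metis
  then show ?thesis by eventually_elim (auto simp: bounded_iff)
qed

lemma integrable_ssup:
  fixes X :: "'w \<Rightarrow> 'b::euclidean_space set"
  assumes X: "random_closed_set P X" and b: "integrably_bounded P X"
  shows "integrable P (\<lambda>\<omega>. ssup u (X \<omega>))"
proof -
  obtain g :: "'w \<Rightarrow> real" where g: "integrable P g" "AE \<omega> in P. \<forall>x\<in>X \<omega>. norm x \<le> g \<omega>"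
    using integrably_bounded_dominated[OF assms] by metis
  show ?thesis
  proof (rule Bochner_Integration.integrable_bound)
    show "integrable P (\<lambda>\<omega>. norm u * g \<omega>)" using g by simp
    show "AE \<omega> in P. norm (ssup u (X \<omega>)) \<le> norm (norm u * g \<omega>)"
      using g(2) AE_space
    proof eventually_elim
      case (elim \<omega>)
      obtain x where x: "x \<in> X \<omega>" using random_closed_setD[OF X elim(2)] by auto
      have bd: "bounded (X \<omega>)" using elim by (auto simp: bounded_iff)
      have le: "\<bar>u \<bullet> y\<bar> \<le> norm u * g \<omega>" if "y \<in> X \<omega>" for y
        using Cauchy_Schwarz_ineq2[of u y] elim that
        by (meson mult_left_mono norm_ge_zero order_trans)
      have "ssup u (X \<omega>) \<le> norm u * g \<omega>" using x le by (intro ssup_least) (auto simp: abs_le_iff)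
      moreover have "- (norm u * g \<omega>) \<le> ssup u (X \<omega>)"
        using ssup_upper[OF bd x, of u] le[OF x] by linarith
      ultimately show ?case by (simp add: abs_le_iff)
    qed
  qed (rule borel_measurable_ssup[OF X])
qed

text \<open>The common dominating function makes every measurable selection integrable.\<close>

lemma selections1I:
  fixes X :: "'w \<Rightarrow> 'b::euclidean_space set"
  assumes X: "random_closed_set P X" and b: "integrably_bounded P X" and G: "subalgebra P G"
    and \<xi>: "\<xi> \<in> borel_measurable G" "AE \<omega> in P. \<xi> \<omega> \<in> X \<omega>"
  shows "\<xi> \<in> selections1 P G X"
proof -
  obtain g :: "'w \<Rightarrow> real" where g: "integrable P g" "AE \<omega> in P. \<forall>x\<in>X \<omega>. norm x \<le> g \<omega>"
    using integrably_bounded_dominated[OF X b] by metis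
  have "integrable P \<xi>"
  proof (rule Bochner_Integration.integrable_bound[OF g(1)])
    show "\<xi> \<in> borel_measurable P" using \<xi>(1) G by (rule measurable_from_subalg[rotated])
    show "AE \<omega> in P. norm (\<xi> \<omega>) \<le> norm (g \<omega>)" using g(2) \<xi>(2) by eventually_elim force
  qed
  with \<xi> show ?thesis by (simp add: selections1_def)
qed

section \<open>Existence of set-valued conditional expectations\<close>

text \<open>The distance from a closure is the distance from the sequence, a countable infimum of
  measurable functions.\<close>

lemma random_closed_set_closure_range:
  fixes g :: "nat \<Rightarrow> 'w \<Rightarrow> 'b::euclidean_space"
  assumes [measurable]: "\<And>k. g k \<in> borel_measurable G"
  shows "random_closed_set G (\<lambda>\<omega>. closure (range (\<lambda>k. g k \<omega>)))"
proof (rule random_closed_setI)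
  fix c
  have "infdist c (closure (range (\<lambda>k. g k \<omega>))) = infdist c (range (\<lambda>k. g k \<omega>))" for \<omega>
    unfolding infdist_eq_setdist by simp
  also have "\<dots> \<omega> = (INF k. dist c (g k \<omega>))" for \<omega>
    by (simp add: infdist_notempty image_comp o_def)
  finally have "infdist c (closure (range (\<lambda>k. g k \<omega>))) = (INF k. dist c (g k \<omega>))" for \<omega> .
  then show "(\<lambda>\<omega>. infdist c (closure (range (\<lambda>k. g k \<omega>)))) \<in> borel_measurable G" by simp
qed auto

text \<open>The set of admissible weights is closed and the rationals are dense in the open unit
  interval. Almost sure statements will be available for countably many weights only, whence this
  form.\<close>

lemma closed_convexI_rational:
  fixes Y :: "'b::real_normed_vector set"
  assumes Y: "closed Y"
    and mid: "\<And>x y q. x \<in> Y \<Longrightarrow> y \<in> Y \<Longrightarrow> q \<in> \<rat> \<Longrightarrow> 0 < q \<Longrightarrow> q < 1 \<Longrightarrow> (1 - q) *\<^sub>R x + q *\<^sub>R y \<in> Y"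
  shows "convex Y"
  unfolding convex_alt
proof (intro ballI allI impI)
  fix x y :: 'b and u :: real assume xy: "x \<in> Y" "y \<in> Y" and u: "0 \<le> u \<and> u \<le> 1"
  show "(1 - u) *\<^sub>R x + u *\<^sub>R y \<in> Y"
  proof (cases "u = 0 \<or> u = 1")
    case False
    then have "u \<in> {0<..<1}" using u by auto
    also have "{0<..<1} \<subseteq> {0<..<1} \<inter> closure (\<rat> :: real set)" by (simp add: Rats_closure_real)
    also have "\<dots> \<subseteq> closure ({0<..<1} \<inter> \<rat>)" by (rule open_Int_closure_subset) simp
    also have "\<dots> \<subseteq> (\<lambda>u. (1 - u) *\<^sub>R x + u *\<^sub>R y) -` Y"
    proof (rule closure_minimal)
      show "closed ((\<lambda>u. (1 - u) *\<^sub>R x + u *\<^sub>R y) -` Y)"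
        by (rule closed_vimage[OF Y]) (intro continuous_intros)
    qed (use mid[OF xy] in auto)
    finally show ?thesis by simp
  qed (use xy in auto)
qed

section \<open>Conditional expectations of random vectors and pasting of selections\<close>

context finite_measure_subalgebra
begin

lemma vec_cond_exp_measurable [measurable]: "vec_cond_exp M F \<xi> \<in> borel_measurable F"
  unfolding vec_cond_exp_def[abs_def] by measurable

lemma vec_cond_exp_measurable' [measurable]: "vec_cond_exp M F \<xi> \<in> borel_measurable M"
  using measurable_from_subalg[OF subalg vec_cond_exp_measurable] .

lemma integrable_vec_cond_exp:
  "integrable M \<xi> \<Longrightarrow> integrable M (vec_cond_exp M F \<xi>)"
  unfolding vec_cond_exp_def[abs_def]
  by (intro Bochner_Integration.integrable_sum integrable_scaleR_left real_cond_exp_int integrable_inner_left)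

lemma vec_cond_exp_inner_Basis:
  "b \<in> Basis \<Longrightarrow> vec_cond_exp M F \<xi> \<omega> \<bullet> b = real_cond_exp M F (\<lambda>\<omega>. \<xi> \<omega> \<bullet> b) \<omega>"
  by (simp add: vec_cond_exp_def inner_sum_left_Basis)

lemma sets_subalgebra: "A \<in> sets F \<Longrightarrow> A \<in> sets M"
  using subalg by (auto simp: subalgebra_def)

text \<open>\<open>vec_cond_exp\<close> is formed coordinatewise, so expanding the inner product in
  the basis reduces the claim to the defining property of real conditional expectations.\<close>

lemma set_integral_inner_vec_cond_exp:
  assumes \<xi>: "integrable M \<xi>" and A: "A \<in> sets F"
  shows "(LINT \<omega>:A|M. u \<bullet> vec_cond_exp M F \<xi> \<omega>) = (LINT \<omega>:A|M. u \<bullet> \<xi> \<omega>)"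
proof -
  have AM: "A \<in> sets M" by (rule sets_subalgebra[OF A])
  have i: "integrable M (\<lambda>\<omega>. \<xi> \<omega> \<bullet> b)" for b using \<xi> by simp
  have si: "set_integrable M A f" if "integrable M f" for f :: "_ \<Rightarrow> real"
    unfolding set_integrable_def using integrable_mult_indicator[OF AM that] .
  have eq: "(LINT \<omega>:A|M. u \<bullet> \<zeta> \<omega>) = (\<Sum>b\<in>Basis. (u \<bullet> b) * (LINT \<omega>:A|M. \<zeta> \<omega> \<bullet> b))"
    if "integrable M \<zeta>" for \<zeta>
  proof -
    have "(LINT \<omega>:A|M. u \<bullet> \<zeta> \<omega>) = (LINT \<omega>:A|M. (\<Sum>b\<in>Basis. (u \<bullet> b) * (\<zeta> \<omega> \<bullet> b)))"
      by (rule arg_cong[where f = "set_lebesgue_integral M A"], rule ext) (rule euclidean_inner)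
    also have "\<dots> = (\<Sum>b\<in>Basis. LINT \<omega>:A|M. (u \<bullet> b) * (\<zeta> \<omega> \<bullet> b))"
      unfolding set_lebesgue_integral_def real_scaleR_def sum_distrib_left
    proof (rule Bochner_Integration.integral_sum)
      fix b :: 'b
      show "integrable M (\<lambda>\<omega>. indicator A \<omega> * ((u \<bullet> b) * (\<zeta> \<omega> \<bullet> b)))"
        using si[of "\<lambda>\<omega>. (u \<bullet> b) * (\<zeta> \<omega> \<bullet> b)"] that by (simp add: set_integrable_def)
    qed
    finally show ?thesis by simp
  qed
  show ?thesis
    unfolding eq[OF \<xi>] eq[OF integrable_vec_cond_exp[OF \<xi>]]
    by (intro sum.cong refl) (simp add: vec_cond_exp_inner_Basis real_cond_exp_intA[OF i A])
qed

text \<open>The events where \<open>\<kappa>\<close> equals \<open>k\<close> belong to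
  \<open>F\<close>, so their indicators can be pulled out of the conditional expectation. The bound
  \<open>N\<close> makes the decomposition a finite sum and secures integrability.\<close>

lemma real_cond_exp_paste:
  fixes f :: "nat \<Rightarrow> 'a \<Rightarrow> real"
  assumes f: "\<And>k. integrable M (f k)" and [measurable]: "\<kappa> \<in> measurable F (count_space UNIV)"
    and le: "\<And>\<omega>. \<kappa> \<omega> \<le> N"
  shows "AE \<omega> in M. real_cond_exp M F (\<lambda>\<omega>. f (\<kappa> \<omega>) \<omega>) \<omega> = real_cond_exp M F (f (\<kappa> \<omega>)) \<omega>"
proof -
  define c :: "nat \<Rightarrow> 'a \<Rightarrow> real" where "c k \<omega> = (if \<kappa> \<omega> = k then 1 else 0)" for k \<omega>
  have [measurable]: "c k \<in> borel_measurable F" for k unfolding c_def[abs_def] by measurable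
  have [measurable]: "c k \<in> borel_measurable M" for k by (rule measurable_from_subalg[OF subalg]) simp
  have [measurable]: "f k \<in> borel_measurable M" for k using f by auto
  have ci: "integrable M (\<lambda>\<omega>. c k \<omega> * f k \<omega>)" for k
  proof (rule Bochner_Integration.integrable_bound[OF f[of k]])
    show "AE \<omega> in M. norm (c k \<omega> * f k \<omega>) \<le> norm (f k \<omega>)" by (simp add: c_def)
  qed measurable
  have "f (\<kappa> \<omega>) \<omega> = (\<Sum>k\<le>N. c k \<omega> * f k \<omega>)" for \<omega>
    using le[of \<omega>] by (simp add: c_def if_distrib[of "\<lambda>x. x * _"] sum.delta cong: if_cong)
  then have eq: "(\<lambda>\<omega>. f (\<kappa> \<omega>) \<omega>) = (\<lambda>\<omega>. \<Sum>k\<in>{..N}. c k \<omega> * f k \<omega>)" by auto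
  have "AE \<omega> in M. \<forall>k. real_cond_exp M F (\<lambda>\<omega>. c k \<omega> * f k \<omega>) \<omega> = c k \<omega> * real_cond_exp M F (f k) \<omega>"
    unfolding AE_all_countable using real_cond_exp_mult ci by auto
  moreover have "AE \<omega> in M. real_cond_exp M F (\<lambda>\<omega>. \<Sum>k\<in>{..N}. c k \<omega> * f k \<omega>) \<omega> =
      (\<Sum>k\<in>{..N}. real_cond_exp M F (\<lambda>\<omega>. c k \<omega> * f k \<omega>) \<omega>)"
    by (rule real_cond_exp_sum[OF ci])
  ultimately show ?thesis unfolding eq
  proof eventually_elim
    case (elim \<omega>)
    then show ?case
      using le[of \<omega>] by (simp add: c_def if_distrib[of "\<lambda>x. x * _"] sum.delta cong: if_cong)
  qed
qed

lemma vec_cond_exp_paste: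
  fixes f :: "nat \<Rightarrow> 'a \<Rightarrow> 'b::euclidean_space"
  assumes f: "\<And>k. integrable M (f k)" and \<kappa>: "\<kappa> \<in> measurable F (count_space UNIV)"
    and le: "\<And>\<omega>. \<kappa> \<omega> \<le> N"
  shows "AE \<omega> in M. vec_cond_exp M F (\<lambda>\<omega>. f (\<kappa> \<omega>) \<omega>) \<omega> = vec_cond_exp M F (f (\<kappa> \<omega>)) \<omega>"
proof -
  have "AE \<omega> in M. \<forall>b\<in>Basis. real_cond_exp M F (\<lambda>\<omega>. f (\<kappa> \<omega>) \<omega> \<bullet> b) \<omega> =
      real_cond_exp M F (\<lambda>\<omega>'. f (\<kappa> \<omega>) \<omega>' \<bullet> b) \<omega>"
  proof (rule AE_finite_allI)
    fix b :: 'b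
    show "AE \<omega> in M. real_cond_exp M F (\<lambda>\<omega>. f (\<kappa> \<omega>) \<omega> \<bullet> b) \<omega> =
      real_cond_exp M F (\<lambda>\<omega>'. f (\<kappa> \<omega>) \<omega>' \<bullet> b) \<omega>"
      using real_cond_exp_paste[of "\<lambda>k \<omega>. f k \<omega> \<bullet> b", OF _ \<kappa> le] f by simp
  qed simp
  then show ?thesis by eventually_elim (simp add: vec_cond_exp_def)
qed

text \<open>Decomposability: switching between selections on events of \<open>F\<close> stays inside
  their set. With infinitely many pieces the pasted function could fail to be integrable, hence the
  bound \<open>N\<close>.\<close>

lemma selections1_paste:
  fixes f :: "nat \<Rightarrow> 'a \<Rightarrow> 'b::euclidean_space"
  assumes f: "\<And>k. f k \<in> selections1 M M X" and \<kappa>: "\<kappa> \<in> measurable F (count_space UNIV)"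
    and le: "\<And>\<omega>. \<kappa> \<omega> \<le> N"
  shows "(\<lambda>\<omega>. f (\<kappa> \<omega>) \<omega>) \<in> selections1 M M X"
proof -
  have [measurable]: "\<kappa> \<in> measurable M (count_space UNIV)"
    by (rule measurable_from_subalg[OF subalg \<kappa>])
  have [measurable]: "f k \<in> borel_measurable M" for k using f by (auto simp: selections1_def)
  have i: "integrable M (\<lambda>\<omega>. \<Sum>k\<le>N. norm (f k \<omega>))"
    using f by (auto simp: selections1_def)
  have "integrable M (\<lambda>\<omega>. f (\<kappa> \<omega>) \<omega>)"
  proof (rule Bochner_Integration.integrable_bound[OF i])
    have "norm (f (\<kappa> \<omega>) \<omega>) \<le> norm (\<Sum>k\<le>N. norm (f k \<omega>))" for \<omega>
      using member_le_sum[of "\<kappa> \<omega>" "{..N}" "\<lambda>k. norm (f k \<omega>)"] le[of \<omega>] by (simp add: sum_nonneg)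
    then show "AE \<omega> in M. norm (f (\<kappa> \<omega>) \<omega>) \<le> norm (\<Sum>k\<le>N. norm (f k \<omega>))" by simp
  qed measurable
  moreover have "AE \<omega> in M. \<forall>k. f k \<omega> \<in> X \<omega>"
    unfolding AE_all_countable using f by (auto simp: selections1_def)
  then have "AE \<omega> in M. f (\<kappa> \<omega>) \<omega> \<in> X \<omega>" by eventually_elim auto
  ultimately show ?thesis by (simp add: selections1_def)
qed

text \<open>On the event \<open>A\<close> where the claim fails, replacing \<open>f i\<close> by \<open>\<xi>\<close> would lower the distance to \<open>q\<close>
  by at least \<open>d * measure M A\<close>, while \<open>f i\<close> is within \<open>1 / Suc i\<close> of the minimum.\<close>

lemma AE_vec_cond_exp_near_minimizers:
  fixes X :: "'a \<Rightarrow> 'b::euclidean_space set"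
  defines "S \<equiv> selections1 M M X"
  assumes \<xi>: "\<xi> \<in> S" and f: "\<And>i. f i \<in> S"
    and min: "\<And>i \<zeta>. \<zeta> \<in> S \<Longrightarrow> (LINT \<omega>|M. norm (vec_cond_exp M F (f i) \<omega> - q)) \<le>
        (LINT \<omega>|M. norm (vec_cond_exp M F \<zeta> \<omega> - q)) + 1 / real (Suc i)"
    and d: "d > 0"
  shows "AE \<omega> in M. norm (vec_cond_exp M F \<xi> \<omega> - q) < d \<longrightarrow>
     (\<exists>i. norm (vec_cond_exp M F (f i) \<omega> - q) < 2 * d)"
proof -
  let ?E = "vec_cond_exp M F"
  \<comment> \<open>The event records failure for all \<open>i\<close> at once and therefore does
    not depend on \<open>i\<close>; the estimate below then holds for the same set with arbitrarily
    small \<open>1 / real (Suc i)\<close>.\<close>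
  define A where "A = {\<omega>\<in>space F. norm (?E \<xi> \<omega> - q) < d \<and> (\<forall>i. \<not> norm (?E (f i) \<omega> - q) < 2 * d)}"
  have A[measurable]: "A \<in> sets F" unfolding A_def by measurable
  have AM[measurable]: "A \<in> sets M" by (rule sets_subalgebra[OF A])
  have "measure M A * d \<le> 1 / real (Suc i)" for i
  proof -
    define \<kappa> :: "'a \<Rightarrow> nat" where "\<kappa> \<omega> = (if \<omega> \<in> A then 0 else 1)" for \<omega>
    have [measurable]: "\<kappa> \<in> measurable F (count_space UNIV)"
      unfolding \<kappa>_def by measurable
    define g where "g k = (if k = (0::nat) then \<xi> else f i)" for k
    have g: "g k \<in> S" for k using \<xi> f by (simp add: g_def)
    have gi: "integrable M (g k)" for k using g by (auto simp: S_def selections1_def)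
    define \<zeta> where "\<zeta> = (\<lambda>\<omega>. g (\<kappa> \<omega>) \<omega>)"
    have k1: "\<kappa> \<omega> \<le> 1" for \<omega> by (simp add: \<kappa>_def)
    have \<zeta>: "\<zeta> \<in> S"
      unfolding \<zeta>_def S_def by (rule selections1_paste[OF _ _ k1]) (use g S_def in auto)
    have \<zeta>i: "integrable M \<zeta>" using \<zeta> by (auto simp: S_def selections1_def)
    have E\<zeta>: "AE \<omega> in M. ?E \<zeta> \<omega> = ?E (g (\<kappa> \<omega>)) \<omega>"
      unfolding \<zeta>_def by (rule vec_cond_exp_paste[OF gi _ k1]) simp
    have int: "integrable M (\<lambda>\<omega>. norm (?E h \<omega> - q))" if "integrable M h" for h
      using integrable_vec_cond_exp[OF that] by simp
    have fi: "integrable M (f i)" using f by (auto simp: S_def selections1_def)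
    have "(LINT \<omega>|M. norm (?E \<zeta> \<omega> - q)) \<le> (LINT \<omega>|M. norm (?E (f i) \<omega> - q) - d * indicator A \<omega>)"
    proof (rule integral_mono_AE)
      show "integrable M (\<lambda>\<omega>. norm (?E (f i) \<omega> - q) - d * indicator A \<omega>)"
        using int[OF fi] by (intro Bochner_Integration.integrable_diff integrable_mult_right
          integrable_real_indicator) (auto simp: less_top[symmetric])
      show "AE \<omega> in M. norm (?E \<zeta> \<omega> - q) \<le> norm (?E (f i) \<omega> - q) - d * indicator A \<omega>"
        using E\<zeta>
      proof eventually_elim
        case (elim \<omega>)
        have "norm (?E \<xi> \<omega> - q) < d" "\<not> norm (?E (f i) \<omega> - q) < 2 * d" if "\<omega> \<in> A"
          using that by (auto simp: A_def)
        then show ?case using elim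
          by (cases "\<omega> \<in> A") (auto simp: \<kappa>_def g_def)
      qed
    qed (rule int[OF \<zeta>i])
    also have "\<dots> = (LINT \<omega>|M. norm (?E (f i) \<omega> - q)) - (LINT \<omega>|M. d * indicator A \<omega>)"
      using int[OF fi] by (intro Bochner_Integration.integral_diff integrable_mult_right
          integrable_real_indicator) (auto simp: less_top[symmetric])
    also have "(LINT \<omega>|M. d * indicator A \<omega>) = measure M A * d" by simp
    finally show ?thesis using min[OF \<zeta>, of i] by simp
  qed
  then have "measure M A * d \<le> 0"
    by (metis linorder_not_le nat_approx_posE order_less_asym)
  then have "measure M A = 0" using d by (simp add: mult_le_0_iff measure_le_0_iff)
  then have "A \<in> null_sets M" by (simp add: null_sets_def emeasure_eq_measure)
  then have "AE \<omega> in M. \<omega> \<notin> A" by (rule AE_not_in)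
  then show ?thesis
    using AE_space by eventually_elim (use subalg in \<open>auto simp: A_def subalgebra_def\<close>)
qed

text \<open>The infimum of the distances need not be attained, so a minimizer is replaced by a
  sequence with vanishing error; the distances are nonnegative, hence bounded below.\<close>

lemma ex_near_minimizers:
  fixes X :: "'a \<Rightarrow> 'b::euclidean_space set"
  defines "S \<equiv> selections1 M M X"
  assumes ne: "S \<noteq> {}"
  obtains f :: "nat \<Rightarrow> 'a \<Rightarrow> 'b" where "\<And>i. f i \<in> S"
    "\<And>i \<zeta>. \<zeta> \<in> S \<Longrightarrow> (LINT \<omega>|M. norm (vec_cond_exp M F (f i) \<omega> - q)) \<le>
        (LINT \<omega>|M. norm (vec_cond_exp M F \<zeta> \<omega> - q)) + 1 / real (Suc i)"
proof -
  define L where "L \<zeta> = (LINT \<omega>|M. norm (vec_cond_exp M F \<zeta> \<omega> - q))" for \<zeta>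
  have bdd: "bdd_below (L ` S)" unfolding L_def by (intro bdd_belowI2[of _ 0]) simp
  have "\<exists>\<xi>\<in>S. L \<xi> < Inf (L ` S) + 1 / real (Suc i)" for i
    using cInf_lessD[of "L ` S" "Inf (L ` S) + 1 / real (Suc i)"] ne by auto
  then obtain f where f: "\<And>i. f i \<in> S" "\<And>i. L (f i) < Inf (L ` S) + 1 / real (Suc i)" by metis
  have "L (f i) \<le> L \<zeta> + 1 / real (Suc i)" if "\<zeta> \<in> S" for i \<zeta>
    using f(2)[of i] cInf_lower[OF _ bdd, of "L \<zeta>"] that by force
  with f(1) that show thesis unfolding L_def by blast
qed

text \<open>An \<open>L1\<close> limit is an almost sure limit along a subsequence, and closed
  values retain such limits.\<close>

lemma L1_closure_subset_selections1:
  fixes X Y :: "'a \<Rightarrow> 'b::euclidean_space set"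
  assumes Y: "\<And>\<omega>. closed (Y \<omega>)"
    and sel: "\<And>\<xi>. \<xi> \<in> selections1 M M X \<Longrightarrow> AE \<omega> in M. vec_cond_exp M F \<xi> \<omega> \<in> Y \<omega>"
  shows "L1_closure M F (vec_cond_exp M F ` selections1 M M X) \<subseteq> selections1 M F Y"
proof
  let ?E = "vec_cond_exp M F"
  fix \<eta> assume \<eta>: "\<eta> \<in> L1_closure M F (?E ` selections1 M M X)"
  then have \<eta>i: "\<eta> \<in> borel_measurable F" "integrable M \<eta>" by (auto simp: L1_closure_def)
  have "\<exists>\<zeta>\<in>selections1 M M X. (LINT \<omega>|M. norm (\<eta> \<omega> - ?E \<zeta> \<omega>)) < 1 / real (Suc n)" for n
  proof -
    have "1 / real (Suc n) > 0" by simp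
    then show ?thesis using \<eta> unfolding L1_closure_def by blast
  qed
  then obtain \<zeta> where \<zeta>: "\<And>n. \<zeta> n \<in> selections1 M M X"
    "\<And>n. (LINT \<omega>|M. norm (\<eta> \<omega> - ?E (\<zeta> n) \<omega>)) < 1 / real (Suc n)" by metis
  have \<zeta>i: "integrable M (?E (\<zeta> n))" for n
    using \<zeta>(1) by (intro integrable_vec_cond_exp) (auto simp: selections1_def)
  have "(\<lambda>n. LINT \<omega>|M. norm (\<eta> \<omega> - ?E (\<zeta> n) \<omega>)) \<longlonglongrightarrow> 0"
  proof (rule tendsto_sandwich[OF _ _ tendsto_const LIMSEQ_inverse_real_of_nat])
    show "\<forall>\<^sub>F n in sequentially. (LINT \<omega>|M. norm (\<eta> \<omega> - ?E (\<zeta> n) \<omega>)) \<le> inverse (real (Suc n))"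
      using \<zeta>(2) by (simp add: inverse_eq_divide less_imp_le)
  qed simp
  then obtain r where r: "strict_mono r" "AE \<omega> in M. (\<lambda>n. \<eta> \<omega> - ?E (\<zeta> (r n)) \<omega>) \<longlonglongrightarrow> 0"
    using tendsto_L1_AE_subseq[of M "\<lambda>n \<omega>. \<eta> \<omega> - ?E (\<zeta> n) \<omega>"] \<eta>i \<zeta>i by auto
  have "AE \<omega> in M. \<forall>n. ?E (\<zeta> n) \<omega> \<in> Y \<omega>"
    unfolding AE_all_countable using sel \<zeta>(1) by blast
  with r(2) have "AE \<omega> in M. \<eta> \<omega> \<in> Y \<omega>"
  proof eventually_elim
    case (elim \<omega>)
    have "(\<lambda>n. \<eta> \<omega> - (\<eta> \<omega> - ?E (\<zeta> (r n)) \<omega>)) \<longlonglongrightarrow> \<eta> \<omega> - 0"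
      by (intro tendsto_diff tendsto_const elim)
    then have "(\<lambda>n. ?E (\<zeta> (r n)) \<omega>) \<longlonglongrightarrow> \<eta> \<omega>" by simp
    with Y[of \<omega>] elim(2) show ?case by (auto intro: closed_sequentially)
  qed
  then show "\<eta> \<in> selections1 M F Y" using \<eta>i by (simp add: selections1_def)
qed

text \<open>Taking at each point the first index whose term is within \<open>d\<close> of
  \<open>\<eta>\<close> is a switch on events of \<open>F\<close>, compatible with conditional
  expectation once it has finitely many values. Cutting the index off at \<open>N\<close> costs an
  error that vanishes in \<open>L1\<close> by dominated convergence.\<close>

lemma selections1_subset_L1_closure:
  fixes X :: "'a \<Rightarrow> 'b::euclidean_space set"
  assumes f: "\<And>k::nat. f k \<in> selections1 M M X"
  shows "selections1 M F (\<lambda>\<omega>. closure (range (\<lambda>k. vec_cond_exp M F (f k) \<omega>)))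
    \<subseteq> L1_closure M F (vec_cond_exp M F ` selections1 M M X)"
proof
  let ?E = "vec_cond_exp M F"
  fix \<eta> assume "\<eta> \<in> selections1 M F (\<lambda>\<omega>. closure (range (\<lambda>k. ?E (f k) \<omega>)))"
  then have \<eta>[measurable]: "\<eta> \<in> borel_measurable F" "integrable M \<eta>"
    and \<eta>Y: "AE \<omega> in M. \<eta> \<omega> \<in> closure (range (\<lambda>k. ?E (f k) \<omega>))" by (auto simp: selections1_def)
  have [measurable]: "\<eta> \<in> borel_measurable M" using \<eta> by auto
  have fi: "integrable M (f k)" for k using f by (auto simp: selections1_def)
  have "\<exists>\<zeta>\<in>?E ` selections1 M M X. (LINT \<omega>|M. norm (\<eta> \<omega> - \<zeta> \<omega>)) < e" if e: "e > 0" for e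
  proof -
    define m where "m = measure M (space M)"
    \<comment> \<open>The tolerance \<open>d\<close> is paid on the whole space, so it is weighed
      against the total mass \<open>m\<close>; the summand \<open>1\<close> keeps the denominator
      positive.\<close>
    define d where "d = e / (2 * (m + 1))"
    have m: "m \<ge> 0" by (simp add: m_def)
    have d: "d > 0" "d * m < e / 2" using e m by (auto simp: d_def field_simps add_pos_nonneg)
    define \<kappa> where "\<kappa> \<omega> = (LEAST k. norm (\<eta> \<omega> - ?E (f k) \<omega>) < d)" for \<omega>
    have \<kappa>[measurable]: "\<kappa> \<in> measurable F (count_space UNIV)" unfolding \<kappa>_def by measurable
    have [measurable]: "\<kappa> \<in> measurable M (count_space UNIV)" by (rule measurable_from_subalg[OF subalg \<kappa>])
    \<comment> \<open>\<open>h N\<close> is the loss incurred where the index exceeds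
      \<open>N\<close> and the term with index \<open>0\<close> is used in its place.\<close>
    define h where "h N \<omega> = (if N < \<kappa> \<omega> then norm (\<eta> \<omega> - ?E (f 0) \<omega>) else 0)" for N \<omega>
    have i0: "integrable M (\<lambda>\<omega>. norm (\<eta> \<omega> - ?E (f 0) \<omega>))"
      using \<eta>(2) integrable_vec_cond_exp[OF fi] by simp
    have hm: "h N \<in> borel_measurable M" for N unfolding h_def[abs_def] by measurable
    have hb: "AE \<omega> in M. norm (h N \<omega>) \<le> norm (\<eta> \<omega> - ?E (f 0) \<omega>)" for N
      by (auto simp: h_def)
    have h0: "(\<lambda>N. h N \<omega>) \<longlonglongrightarrow> 0" for \<omega>
    proof (rule tendsto_eventually)
      show "\<forall>\<^sub>F N in sequentially. h N \<omega> = 0"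
        using eventually_ge_at_top[of "\<kappa> \<omega>"] by eventually_elim (simp add: h_def)
    qed
    have "(\<lambda>N. integral\<^sup>L M (h N)) \<longlonglongrightarrow> integral\<^sup>L M (\<lambda>\<omega>. 0)"
      using h0 by (intro integral_dominated_convergence[OF _ hm i0 _ hb]) auto
    then have "\<forall>\<^sub>F N in sequentially. integral\<^sup>L M (h N) < e / 2"
      using e by (intro order_tendstoD(2)[where y = 0]) auto
    then obtain N where N: "integral\<^sup>L M (h N) < e / 2" by (auto simp: eventually_sequentially)
    have hi: "integrable M (h N)" by (rule Bochner_Integration.integrable_bound[OF i0 hm]) (use hb in auto)
    define \<kappa>' where "\<kappa>' \<omega> = (if \<kappa> \<omega> \<le> N then \<kappa> \<omega> else 0)" for \<omega>
    have [measurable]: "\<kappa>' \<in> measurable F (count_space UNIV)" unfolding \<kappa>'_def by measurable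
    have kN: "\<kappa>' \<omega> \<le> N" for \<omega> by (simp add: \<kappa>'_def)
    define \<zeta> where "\<zeta> = (\<lambda>\<omega>. f (\<kappa>' \<omega>) \<omega>)"
    have \<zeta>: "\<zeta> \<in> selections1 M M X"
      unfolding \<zeta>_def by (rule selections1_paste[OF f _ kN]) simp
    then have \<zeta>i: "integrable M \<zeta>" by (auto simp: selections1_def)
    have "AE \<omega> in M. ?E \<zeta> \<omega> = ?E (f (\<kappa>' \<omega>)) \<omega>"
      unfolding \<zeta>_def by (rule vec_cond_exp_paste[OF fi _ kN]) simp
    with \<eta>Y have "AE \<omega> in M. norm (\<eta> \<omega> - ?E \<zeta> \<omega>) \<le> d + h N \<omega>"
    proof eventually_elim
      case (elim \<omega>)
      obtain k where "dist (?E (f k) \<omega>) (\<eta> \<omega>) < d"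
        using elim(1) d(1) unfolding closure_approachable by blast
      then have "norm (\<eta> \<omega> - ?E (f k) \<omega>) < d" by (simp add: dist_norm norm_minus_commute)
      then have "norm (\<eta> \<omega> - ?E (f (\<kappa> \<omega>)) \<omega>) < d" unfolding \<kappa>_def by (rule LeastI)
      then show ?case using elim(2) d(1) by (auto simp: \<kappa>'_def h_def)
    qed
    then have "(LINT \<omega>|M. norm (\<eta> \<omega> - ?E \<zeta> \<omega>)) \<le> (LINT \<omega>|M. d + h N \<omega>)"
      using \<eta>(2) integrable_vec_cond_exp[OF \<zeta>i] hi by (intro integral_mono_AE) auto
    also have "\<dots> = d * m + integral\<^sup>L M (h N)"
      using hi by (simp add: m_def)
    also have "\<dots> < e" using d(2) N by simp
    finally show ?thesis using \<zeta> by blast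
  qed
  then show "\<eta> \<in> L1_closure M F (?E ` selections1 M M X)" using \<eta> by (simp add: L1_closure_def)
qed

text \<open>Whenever the conditional expectation of a selection comes near a dense point, so does
  that of some near minimizer for this point; hence it lies almost surely in the closure of the
  countable family. The sequence \<open>g\<close> is handed out together with the set, since later
  properties are verified on the \<open>g k\<close> and passed to the closure.\<close>

theorem ex_set_cond_exp:
  fixes X :: "'a \<Rightarrow> 'b::euclidean_space set"
  assumes "set_integrable_rv M X"
  obtains g :: "nat \<Rightarrow> 'a \<Rightarrow> 'b" where
    "is_set_cond_exp M F X (\<lambda>\<omega>. closure (range (\<lambda>k. g k \<omega>)))"
    "\<And>k. g k \<in> selections1 M F (\<lambda>\<omega>. closure (range (\<lambda>k. g k \<omega>)))"
proof -
  let ?E = "vec_cond_exp M F"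
  define S where "S = selections1 M M X"
  have ne: "S \<noteq> {}" using assms by (simp add: S_def set_integrable_rv_def)
  obtain q :: "nat \<Rightarrow> 'b" where q: "closure (range q) = UNIV" using ex_dense_sequence by blast
  have "\<exists>f. (\<forall>i. f i \<in> S) \<and> (\<forall>i. \<forall>\<zeta>\<in>S. (LINT \<omega>|M. norm (?E (f i) \<omega> - q j)) \<le>
        (LINT \<omega>|M. norm (?E \<zeta> \<omega> - q j)) + 1 / real (Suc i))" for j
    by (rule ex_near_minimizers[OF ne[unfolded S_def], of "q j"]) (auto simp: S_def)
  then obtain f where f: "\<And>j i. f j i \<in> S"
    and min: "\<And>j i \<zeta>. \<zeta> \<in> S \<Longrightarrow> (LINT \<omega>|M. norm (?E (f j i) \<omega> - q j)) \<le>
        (LINT \<omega>|M. norm (?E \<zeta> \<omega> - q j)) + 1 / real (Suc i)" by metis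
  define \<phi> where "\<phi> k = (case prod_decode k of (j, i) \<Rightarrow> f j i)" for k
  have \<phi>: "\<phi> k \<in> S" for k using f by (simp add: \<phi>_def split: prod.split)
  have \<phi>f: "\<phi> (prod_encode (j, i)) = f j i" for i j by (simp add: \<phi>_def)
  define Y where "Y \<omega> = closure (range (\<lambda>k. ?E (\<phi> k) \<omega>))" for \<omega>
  have sel: "AE \<omega> in M. ?E \<xi> \<omega> \<in> Y \<omega>" if \<xi>: "\<xi> \<in> S" for \<xi>
  proof -
    have "AE \<omega> in M. \<forall>j m. norm (?E \<xi> \<omega> - q j) < 1 / real (Suc m) \<longrightarrow>
        (\<exists>i. norm (?E (f j i) \<omega> - q j) < 2 * (1 / real (Suc m)))"
      unfolding AE_all_countable
      using \<xi> f min by (intro allI AE_vec_cond_exp_near_minimizers) (auto simp: S_def)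
    then show ?thesis
    proof eventually_elim
      case (elim \<omega>)
      show ?case unfolding Y_def closure_approachable
      proof (intro allI impI)
        fix e :: real assume "e > 0"
        \<comment> \<open>A third of \<open>e\<close>: the given conditional expectation is within
          \<open>1 / real (Suc m)\<close> of \<open>q j\<close>, that of the near minimizer within
          twice as much.\<close>
        then obtain m where m: "1 / real (Suc m) < e / 3"
          using nat_approx_posE[of "e / 3"] by (metis divide_pos_pos zero_less_numeral)
        have "?E \<xi> \<omega> \<in> closure (range q)" using q by simp
        moreover have "1 / real (Suc m) > 0" by simp
        ultimately obtain j where j: "dist (q j) (?E \<xi> \<omega>) < 1 / real (Suc m)"
          unfolding closure_approachable by blast
        then obtain i where i: "dist (?E (f j i) \<omega>) (q j) < 2 * (1 / real (Suc m))"
          using elim by (auto simp: dist_norm norm_minus_commute)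
        have "dist (?E (\<phi> (prod_encode (j, i))) \<omega>) (?E \<xi> \<omega>) < e"
          unfolding \<phi>f using dist_triangle[of "?E (f j i) \<omega>" "?E \<xi> \<omega>" "q j"] i j m by linarith
        then show "\<exists>y\<in>range (\<lambda>k. ?E (\<phi> k) \<omega>). dist y (?E \<xi> \<omega>) < e" by blast
      qed
    qed
  qed
  have eq: "selections1 M F Y = L1_closure M F (?E ` selections1 M M X)"
  proof (rule antisym)
    show "L1_closure M F (?E ` selections1 M M X) \<subseteq> selections1 M F Y"
      by (rule L1_closure_subset_selections1) (use sel in \<open>auto simp: Y_def S_def\<close>)
    show "selections1 M F Y \<subseteq> L1_closure M F (?E ` selections1 M M X)"
      unfolding Y_def[abs_def] using \<phi> by (intro selections1_subset_L1_closure) (simp add: S_def)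
  qed
  have g: "?E (\<phi> k) \<in> selections1 M F Y" for k
    using sel[OF \<phi>[of k]] \<phi>[of k] by (auto simp: selections1_def S_def intro: integrable_vec_cond_exp)
  then have "?E (\<phi> 0) \<in> selections1 M M Y" by (auto simp: selections1_def)
  then have "is_set_cond_exp M F X Y"
    unfolding is_set_cond_exp_def set_integrable_rv_def using eq
    by (auto simp: Y_def[abs_def] intro!: random_closed_set_closure_range)
  with g that[of "\<lambda>k. ?E (\<phi> k)"] show thesis unfolding Y_def[abs_def] by blast
qed

end

section \<open>Comparison with set-valued conditional expectations through support functions\<close>

text \<open>The inequality is tested on the event where it fails; there the difference is positive,
  while its integral is at most zero.\<close>

lemma (in finite_measure) AE_le_if_set_integral_le:
  fixes f g :: "'a \<Rightarrow> real"
  assumes G: "subalgebra M G"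
    and f: "integrable M f" "f \<in> borel_measurable G"
    and g: "integrable M g" "g \<in> borel_measurable G"
    and le: "\<And>A. A \<in> sets G \<Longrightarrow> (LINT \<omega>:A|M. f \<omega>) \<le> (LINT \<omega>:A|M. g \<omega>)"
  shows "AE \<omega> in M. f \<omega> \<le> g \<omega>"
proof -
  note [measurable] = f(2) g(2)
  define A where "A = {\<omega>\<in>space G. g \<omega> < f \<omega>}"
  have A[measurable]: "A \<in> sets G" unfolding A_def by measurable
  have AM: "A \<in> sets M" using A G by (auto simp: subalgebra_def)
  have i: "integrable M (\<lambda>\<omega>. indicator A \<omega> *\<^sub>R f \<omega>)" "integrable M (\<lambda>\<omega>. indicator A \<omega> *\<^sub>R g \<omega>)"
    by (rule integrable_mult_indicator[OF AM f(1)], rule integrable_mult_indicator[OF AM g(1)])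
  define h where "h \<omega> = indicator A \<omega> *\<^sub>R f \<omega> - indicator A \<omega> *\<^sub>R g \<omega>" for \<omega>
  have hi: "integrable M h" unfolding h_def using i by (rule Bochner_Integration.integrable_diff)
  have h0: "0 \<le> h \<omega>" for \<omega> by (auto simp: h_def A_def indicator_def)
  have "integral\<^sup>L M h = (LINT \<omega>:A|M. f \<omega>) - (LINT \<omega>:A|M. g \<omega>)"
    unfolding h_def set_lebesgue_integral_def using i by (rule Bochner_Integration.integral_diff)
  then have "integral\<^sup>L M h \<le> 0" using le[OF A] by simp
  moreover have "0 \<le> integral\<^sup>L M h" by (rule integral_nonneg_AE) (simp add: h0)
  ultimately have "integral\<^sup>L M h = 0" by simp
  then have "AE \<omega> in M. h \<omega> = 0"
    using integral_nonneg_eq_0_iff_AE[OF hi] h0 by simp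
  then show ?thesis using AE_space
    by eventually_elim (use G in \<open>auto simp: h_def A_def subalgebra_def indicator_def split: if_splits\<close>)
qed

context finite_measure_subalgebra
begin

lemma set_integrable_of_integrable:
  fixes f :: "'a \<Rightarrow> real"
  assumes "integrable M f" "A \<in> sets F"
  shows "set_integrable M A f"
  unfolding set_integrable_def using assms sets_subalgebra by (intro integrable_mult_indicator) auto

lemma set_integral_inner_L1_approx:
  fixes \<eta> \<zeta> :: "'a \<Rightarrow> 'b::euclidean_space"
  assumes "integrable M \<eta>" "integrable M \<zeta>" "A \<in> sets F"
  shows "(LINT \<omega>:A|M. u \<bullet> \<eta> \<omega>) \<le> (LINT \<omega>:A|M. u \<bullet> \<zeta> \<omega>) + norm u * (LINT \<omega>|M. norm (\<eta> \<omega> - \<zeta> \<omega>))"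
proof -
  have i: "integrable M (\<lambda>\<omega>. indicator A \<omega> *\<^sub>R (u \<bullet> \<eta> \<omega>))"
    "integrable M (\<lambda>\<omega>. indicator A \<omega> *\<^sub>R (u \<bullet> \<zeta> \<omega>))"
    "integrable M (\<lambda>\<omega>. norm u * norm (\<eta> \<omega> - \<zeta> \<omega>))"
    using assms sets_subalgebra by (auto intro!: integrable_mult_indicator simp del: real_scaleR_def)
  have "(LINT \<omega>:A|M. u \<bullet> \<eta> \<omega>) \<le>
      (LINT \<omega>|M. indicator A \<omega> *\<^sub>R (u \<bullet> \<zeta> \<omega>) + norm u * norm (\<eta> \<omega> - \<zeta> \<omega>))"
    unfolding set_lebesgue_integral_def
  proof (rule integral_mono[OF i(1) Bochner_Integration.integrable_add[OF i(2,3)]])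
    fix \<omega>
    have "u \<bullet> \<eta> \<omega> - u \<bullet> \<zeta> \<omega> \<le> norm u * norm (\<eta> \<omega> - \<zeta> \<omega>)"
      using norm_cauchy_schwarz[of u "\<eta> \<omega> - \<zeta> \<omega>"] by (simp add: inner_diff_right)
    then show "indicator A \<omega> *\<^sub>R (u \<bullet> \<eta> \<omega>) \<le> indicator A \<omega> *\<^sub>R (u \<bullet> \<zeta> \<omega>) + norm u * norm (\<eta> \<omega> - \<zeta> \<omega>)"
      by (auto simp: indicator_def)
  qed
  also have "\<dots> = (LINT \<omega>:A|M. u \<bullet> \<zeta> \<omega>) + norm u * (LINT \<omega>|M. norm (\<eta> \<omega> - \<zeta> \<omega>))"
    unfolding set_lebesgue_integral_def using i by (simp add: Bochner_Integration.integral_add)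
  finally show ?thesis .
qed

text \<open>For \<open>\<eta>\<close> of the form \<open>vec_cond_exp M F \<xi>\<close> the integral
  over an event of \<open>F\<close> is that of \<open>\<xi>\<close> itself, which lies in
  \<open>X\<close>; the bound then passes to the \<open>L1\<close> closure.\<close>

lemma set_integral_inner_le_ssup:
  fixes X :: "'a \<Rightarrow> 'b::euclidean_space set"
  assumes X: "random_closed_set M X" "integrably_bounded M X" and Y: "is_set_cond_exp M F X Y"
    and \<eta>: "\<eta> \<in> selections1 M F Y" and A: "A \<in> sets F"
  shows "(LINT \<omega>:A|M. u \<bullet> \<eta> \<omega>) \<le> (LINT \<omega>:A|M. ssup u (X \<omega>))"
proof (rule field_le_epsilon)
  fix e :: real assume e: "e > 0"
  have nu: "norm u + 1 > 0" by (simp add: add_nonneg_pos)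
  have "\<eta> \<in> L1_closure M F (vec_cond_exp M F ` selections1 M M X)"
    using \<eta> Y by (simp add: is_set_cond_exp_def)
  moreover have "e / (norm u + 1) > 0" using e nu by simp
  ultimately obtain \<xi> where \<xi>: "\<xi> \<in> selections1 M M X"
    and close: "(LINT \<omega>|M. norm (\<eta> \<omega> - vec_cond_exp M F \<xi> \<omega>)) < e / (norm u + 1)"
    unfolding L1_closure_def by blast
  have \<xi>i: "integrable M \<xi>" "AE \<omega> in M. \<xi> \<omega> \<in> X \<omega>" using \<xi> by (auto simp: selections1_def)
  have \<eta>i: "integrable M \<eta>" using \<eta> by (simp add: selections1_def)
  have "(LINT \<omega>:A|M. u \<bullet> \<eta> \<omega>) \<le> (LINT \<omega>:A|M. u \<bullet> vec_cond_exp M F \<xi> \<omega>)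
      + norm u * (LINT \<omega>|M. norm (\<eta> \<omega> - vec_cond_exp M F \<xi> \<omega>))"
    by (rule set_integral_inner_L1_approx[OF \<eta>i integrable_vec_cond_exp[OF \<xi>i(1)] A])
  also have "(LINT \<omega>:A|M. u \<bullet> vec_cond_exp M F \<xi> \<omega>) = (LINT \<omega>:A|M. u \<bullet> \<xi> \<omega>)"
    by (rule set_integral_inner_vec_cond_exp[OF \<xi>i(1) A])
  also have "\<dots> \<le> (LINT \<omega>:A|M. ssup u (X \<omega>))"
  proof (rule set_integral_mono_AE)
    show "AE \<omega>\<in>A in M. u \<bullet> \<xi> \<omega> \<le> ssup u (X \<omega>)"
      using \<xi>i(2) integrably_bounded_AE_bounded[OF X] by eventually_elim (auto intro: ssup_upper)
  qed (use \<xi>i integrable_ssup[OF X] A in \<open>auto intro!: set_integrable_of_integrable\<close>)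
  also have "norm u * (LINT \<omega>|M. norm (\<eta> \<omega> - vec_cond_exp M F \<xi> \<omega>)) \<le> norm u * (e / (norm u + 1))"
    using close by (intro mult_left_mono) auto
  also have "\<dots> \<le> e" using e nu by (simp add: field_simps)
  finally show "(LINT \<omega>:A|M. u \<bullet> \<eta> \<omega>) \<le> (LINT \<omega>:A|M. ssup u (X \<omega>)) + e" by simp
qed

lemma is_set_cond_exp_vec_cond_exp:
  fixes X :: "'a \<Rightarrow> 'b::euclidean_space set"
  assumes Y: "is_set_cond_exp M F X Y" and \<xi>: "\<xi> \<in> selections1 M M X"
  shows "vec_cond_exp M F \<xi> \<in> selections1 M F Y"
proof -
  have "vec_cond_exp M F \<xi> \<in> L1_closure M F (vec_cond_exp M F ` selections1 M M X)"
    unfolding L1_closure_def using \<xi>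
    by (auto simp: selections1_def intro!: integrable_vec_cond_exp bexI[of _ \<xi>])
  then show ?thesis using Y by (simp add: is_set_cond_exp_def)
qed

text \<open>The bound of \<open>set_integral_inner_le_ssup\<close> is attained up to
  \<open>e\<close>. A single \<open>\<eta>\<close> serves all events, and the error stands under the
  integral, so that an almost sure inequality can be deduced.\<close>

lemma near_max_cond_exp_selection:
  fixes X :: "'a \<Rightarrow> 'b::euclidean_space set"
  assumes X: "random_closed_set M X" "integrably_bounded M X" and Y: "is_set_cond_exp M F X Y"
    and e: "e > 0"
  obtains \<eta> where "\<eta> \<in> selections1 M F Y"
    "\<And>A. A \<in> sets F \<Longrightarrow> (LINT \<omega>:A|M. ssup u (X \<omega>)) \<le> (LINT \<omega>:A|M. u \<bullet> \<eta> \<omega> + e)"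
proof -
  obtain \<xi> where \<xi>: "\<xi> \<in> borel_measurable M" "\<And>\<omega>. \<omega> \<in> space M \<Longrightarrow> \<xi> \<omega> \<in> X \<omega>"
    "\<And>\<omega>. \<omega> \<in> space M \<Longrightarrow> bounded (X \<omega>) \<Longrightarrow> ssup u (X \<omega>) - e < u \<bullet> \<xi> \<omega>"
    using near_max_selection[OF X(1) e] by metis
  have \<xi>S: "\<xi> \<in> selections1 M M X"
    using X \<xi> by (intro selections1I) (auto simp: subalgebra_def)
  then have \<xi>i: "integrable M \<xi>" by (simp add: selections1_def)
  have "(LINT \<omega>:A|M. ssup u (X \<omega>)) \<le> (LINT \<omega>:A|M. u \<bullet> vec_cond_exp M F \<xi> \<omega> + e)"
    if A: "A \<in> sets F" for A
  proof -
    have "(LINT \<omega>:A|M. ssup u (X \<omega>)) \<le> (LINT \<omega>:A|M. u \<bullet> \<xi> \<omega> + e)"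
    proof (rule set_integral_mono_AE)
      show "AE \<omega>\<in>A in M. ssup u (X \<omega>) \<le> u \<bullet> \<xi> \<omega> + e"
        using integrably_bounded_AE_bounded[OF X] AE_space
        by eventually_elim (use \<xi>(3) in force)
    qed (use \<xi>i integrable_ssup[OF X] A in \<open>auto intro!: set_integrable_of_integrable\<close>)
    also have "\<dots> = (LINT \<omega>:A|M. u \<bullet> \<xi> \<omega>) + (LINT \<omega>:A|M. e)"
      using \<xi>i A by (intro set_integral_add(2)) (auto intro!: set_integrable_of_integrable)
    also have "(LINT \<omega>:A|M. u \<bullet> \<xi> \<omega>) = (LINT \<omega>:A|M. u \<bullet> vec_cond_exp M F \<xi> \<omega>)"
      by (rule set_integral_inner_vec_cond_exp[OF \<xi>i A, symmetric])
    also have "\<dots> + (LINT \<omega>:A|M. e) = (LINT \<omega>:A|M. u \<bullet> vec_cond_exp M F \<xi> \<omega> + e)"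
      using integrable_vec_cond_exp[OF \<xi>i] A
      by (intro set_integral_add(2)[symmetric]) (auto intro!: set_integrable_of_integrable)
    finally show ?thesis .
  qed
  with is_set_cond_exp_vec_cond_exp[OF Y \<xi>S] that show thesis by blast
qed

lemma AE_le_real_cond_exp_ssup:
  fixes X :: "'a \<Rightarrow> 'b::euclidean_space set"
  assumes X: "random_closed_set M X" "integrably_bounded M X" and Y: "is_set_cond_exp M F X Y"
    and \<eta>: "\<eta> \<in> selections1 M F Y"
  shows "AE \<omega> in M. u \<bullet> \<eta> \<omega> \<le> real_cond_exp M F (\<lambda>\<omega>. ssup u (X \<omega>)) \<omega>"
proof (rule AE_le_if_set_integral_le[OF subalg])
  show "integrable M (\<lambda>\<omega>. u \<bullet> \<eta> \<omega>)" "(\<lambda>\<omega>. u \<bullet> \<eta> \<omega>) \<in> borel_measurable F"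
    using \<eta> by (auto simp: selections1_def)
  show "(LINT \<omega>:A|M. u \<bullet> \<eta> \<omega>) \<le> (LINT \<omega>:A|M. real_cond_exp M F (\<lambda>\<omega>. ssup u (X \<omega>)) \<omega>)"
    if "A \<in> sets F" for A
    using set_integral_inner_le_ssup[OF X Y \<eta> that] real_cond_exp_intA[OF integrable_ssup[OF X] that]
    by metis
qed (use real_cond_exp_int(1)[OF integrable_ssup[OF X]] in auto)

text \<open>The real conditional expectations of \<open>ssup\<close> in the directions
  \<open>b\<close> and \<open>- b\<close> bound every \<open>g k\<close>; these countably many
  inequalities share one null set, and closures of bounded sets are bounded.\<close>

lemma AE_bounded_cond_exp:
  fixes X :: "'a \<Rightarrow> 'b::euclidean_space set"
  assumes X: "random_closed_set M X" "integrably_bounded M X"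
    and Y: "is_set_cond_exp M F X (\<lambda>\<omega>. closure (range (\<lambda>k. g k \<omega>)))"
    and g: "\<And>k::nat. g k \<in> selections1 M F (\<lambda>\<omega>. closure (range (\<lambda>k. g k \<omega>)))"
  shows "AE \<omega> in M. bounded (closure (range (\<lambda>k. g k \<omega>)))"
proof -
  define H where "H u = real_cond_exp M F (\<lambda>\<omega>. ssup u (X \<omega>))" for u
  have "AE \<omega> in M. \<forall>b\<in>Basis \<union> uminus ` Basis. \<forall>k. b \<bullet> g k \<omega> \<le> H b \<omega>"
    unfolding H_def AE_all_countable
    by (intro AE_finite_allI) (auto simp: AE_all_countable intro!: AE_le_real_cond_exp_ssup[OF X Y g])
  then show ?thesis
  proof eventually_elim
    case (elim \<omega>)
    have "norm (g k \<omega>) \<le> (\<Sum>b\<in>Basis. \<bar>H b \<omega>\<bar> + \<bar>H (- b) \<omega>\<bar>)" for k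
    proof -
      have "norm (g k \<omega>) \<le> (\<Sum>b\<in>Basis. \<bar>g k \<omega> \<bullet> b\<bar>)" by (rule norm_le_l1)
      also have "\<dots> \<le> (\<Sum>b\<in>Basis. \<bar>H b \<omega>\<bar> + \<bar>H (- b) \<omega>\<bar>)"
      proof (rule sum_mono)
        fix b :: 'b assume "b \<in> Basis"
        then have "b \<bullet> g k \<omega> \<le> H b \<omega>" "(- b) \<bullet> g k \<omega> \<le> H (- b) \<omega>" using elim by blast+
        then show "\<bar>g k \<omega> \<bullet> b\<bar> \<le> \<bar>H b \<omega>\<bar> + \<bar>H (- b) \<omega>\<bar>" by (simp add: inner_commute)
      qed
      finally show ?thesis .
    qed
    then show ?case by (intro bounded_closure) (auto simp: bounded_iff)
  qed
qed

section \<open>Convexity of the set-valued conditional expectation\<close>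

lemma vec_cond_exp_linear:
  assumes "integrable M \<xi>" "integrable M \<zeta>"
  shows "AE \<omega> in M. vec_cond_exp M F (\<lambda>\<omega>. a *\<^sub>R \<xi> \<omega> + c *\<^sub>R \<zeta> \<omega>) \<omega> =
    a *\<^sub>R vec_cond_exp M F \<xi> \<omega> + c *\<^sub>R vec_cond_exp M F \<zeta> \<omega>"
proof -
  have "AE \<omega> in M. \<forall>b\<in>Basis. real_cond_exp M F (\<lambda>\<omega>. (a *\<^sub>R \<xi> \<omega> + c *\<^sub>R \<zeta> \<omega>) \<bullet> b) \<omega> =
     a * real_cond_exp M F (\<lambda>\<omega>. \<xi> \<omega> \<bullet> b) \<omega> + c * real_cond_exp M F (\<lambda>\<omega>. \<zeta> \<omega> \<bullet> b) \<omega>"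
  proof (rule AE_finite_allI)
    fix b
    have i: "integrable M (\<lambda>\<omega>. \<xi> \<omega> \<bullet> b)" "integrable M (\<lambda>\<omega>. \<zeta> \<omega> \<bullet> b)" using assms by auto
    have "AE \<omega> in M. real_cond_exp M F (\<lambda>\<omega>. a * (\<xi> \<omega> \<bullet> b) + c * (\<zeta> \<omega> \<bullet> b)) \<omega> =
      real_cond_exp M F (\<lambda>\<omega>. a * (\<xi> \<omega> \<bullet> b)) \<omega> + real_cond_exp M F (\<lambda>\<omega>. c * (\<zeta> \<omega> \<bullet> b)) \<omega>"
      using i by (intro real_cond_exp_add) auto
    with real_cond_exp_cmult[OF i(1), of a] real_cond_exp_cmult[OF i(2), of c]
    show "AE \<omega> in M. real_cond_exp M F (\<lambda>\<omega>. (a *\<^sub>R \<xi> \<omega> + c *\<^sub>R \<zeta> \<omega>) \<bullet> b) \<omega> =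
     a * real_cond_exp M F (\<lambda>\<omega>. \<xi> \<omega> \<bullet> b) \<omega> + c * real_cond_exp M F (\<lambda>\<omega>. \<zeta> \<omega> \<bullet> b) \<omega>"
      by eventually_elim (simp add: inner_add_left)
  qed simp
  then show ?thesis
    by eventually_elim
      (simp add: vec_cond_exp_def scaleR_sum_right scaleR_add_left sum.distrib)
qed

text \<open>Convex combinations commute with conditional expectation and with \<open>L1\<close>
  limits. The two errors are weighted by \<open>1 - q\<close> and \<open>q\<close>, so the total
  stays below \<open>e\<close> without halving it.\<close>

lemma cond_exp_selections1_convex:
  fixes X :: "'a \<Rightarrow> 'b::euclidean_space set"
  assumes conv: "AE \<omega> in M. convex (X \<omega>)" and Y: "is_set_cond_exp M F X Y"
    and \<eta>: "\<eta> \<in> selections1 M F Y" "\<eta>' \<in> selections1 M F Y" and q: "0 < q" "q < 1"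
  shows "(\<lambda>\<omega>. (1 - q) *\<^sub>R \<eta> \<omega> + q *\<^sub>R \<eta>' \<omega>) \<in> selections1 M F Y"
proof -
  let ?E = "vec_cond_exp M F" and ?S = "selections1 M M X"
  have eq: "selections1 M F Y = L1_closure M F (?E ` ?S)"
    using Y by (simp add: is_set_cond_exp_def)
  have i: "integrable M \<eta>" "integrable M \<eta>'" and [measurable]: "\<eta> \<in> borel_measurable F" "\<eta>' \<in> borel_measurable F"
    using \<eta> by (auto simp: selections1_def)
  have "\<exists>\<zeta>\<in>?E ` ?S. (LINT \<omega>|M. norm ((1 - q) *\<^sub>R \<eta> \<omega> + q *\<^sub>R \<eta>' \<omega> - \<zeta> \<omega>)) < e" if e: "e > 0" for e
  proof -
    obtain \<xi> where \<xi>: "\<xi> \<in> ?S" "(LINT \<omega>|M. norm (\<eta> \<omega> - ?E \<xi> \<omega>)) < e"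
      using \<eta>(1) e unfolding eq L1_closure_def by blast
    obtain \<xi>' where \<xi>': "\<xi>' \<in> ?S" "(LINT \<omega>|M. norm (\<eta>' \<omega> - ?E \<xi>' \<omega>)) < e"
      using \<eta>(2) e unfolding eq L1_closure_def by blast
    have \<xi>i: "integrable M \<xi>" "integrable M \<xi>'" using \<xi> \<xi>' by (auto simp: selections1_def)
    define \<zeta> where "\<zeta> = (\<lambda>\<omega>. (1 - q) *\<^sub>R \<xi> \<omega> + q *\<^sub>R \<xi>' \<omega>)"
    have "AE \<omega> in M. \<xi> \<omega> \<in> X \<omega>" "AE \<omega> in M. \<xi>' \<omega> \<in> X \<omega>"
      using \<xi> \<xi>' by (auto simp: selections1_def)
    with conv have "AE \<omega> in M. \<zeta> \<omega> \<in> X \<omega>"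
      by eventually_elim (use q in \<open>auto simp: \<zeta>_def intro!: convexD\<close>)
    then have \<zeta>: "\<zeta> \<in> ?S" using \<xi>i by (auto simp: selections1_def \<zeta>_def)
    then have \<zeta>i: "integrable M \<zeta>" by (simp add: selections1_def)
    have Ei: "integrable M (\<lambda>\<omega>. norm (\<eta> \<omega> - ?E \<xi> \<omega>))" "integrable M (\<lambda>\<omega>. norm (\<eta>' \<omega> - ?E \<xi>' \<omega>))"
      using integrable_vec_cond_exp[OF \<xi>i(1)] integrable_vec_cond_exp[OF \<xi>i(2)] i by auto
    have "(LINT \<omega>|M. norm ((1 - q) *\<^sub>R \<eta> \<omega> + q *\<^sub>R \<eta>' \<omega> - ?E \<zeta> \<omega>)) \<le>
      (LINT \<omega>|M. (1 - q) * norm (\<eta> \<omega> - ?E \<xi> \<omega>) + q * norm (\<eta>' \<omega> - ?E \<xi>' \<omega>))"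
    proof (rule integral_mono_AE)
      show "AE \<omega> in M. norm ((1 - q) *\<^sub>R \<eta> \<omega> + q *\<^sub>R \<eta>' \<omega> - ?E \<zeta> \<omega>) \<le>
          (1 - q) * norm (\<eta> \<omega> - ?E \<xi> \<omega>) + q * norm (\<eta>' \<omega> - ?E \<xi>' \<omega>)"
        using vec_cond_exp_linear[OF \<xi>i, of "1 - q" q]
      proof eventually_elim
        case (elim \<omega>)
        have "(1 - q) *\<^sub>R \<eta> \<omega> + q *\<^sub>R \<eta>' \<omega> - ?E \<zeta> \<omega> =
          (1 - q) *\<^sub>R (\<eta> \<omega> - ?E \<xi> \<omega>) + q *\<^sub>R (\<eta>' \<omega> - ?E \<xi>' \<omega>)"
          unfolding \<zeta>_def elim by (simp add: algebra_simps)
        then show ?case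
          using norm_triangle_ineq[of "(1 - q) *\<^sub>R (\<eta> \<omega> - ?E \<xi> \<omega>)" "q *\<^sub>R (\<eta>' \<omega> - ?E \<xi>' \<omega>)"] q by simp
      qed
    qed (use Ei i integrable_vec_cond_exp[OF \<zeta>i] in auto)
    also have "\<dots> = (1 - q) * (LINT \<omega>|M. norm (\<eta> \<omega> - ?E \<xi> \<omega>)) + q * (LINT \<omega>|M. norm (\<eta>' \<omega> - ?E \<xi>' \<omega>))"
      using Ei by simp
    also have "\<dots> < (1 - q) * e + q * e"
      using \<xi> \<xi>' q by (intro add_strict_mono mult_strict_left_mono) auto
    finally show ?thesis using \<zeta> by (auto simp: algebra_simps)
  qed
  then show ?thesis unfolding eq L1_closure_def using i by auto
qed

lemma AE_convex_cond_exp: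
  fixes X :: "'a \<Rightarrow> 'b::euclidean_space set"
  assumes conv: "AE \<omega> in M. convex (X \<omega>)"
    and Y: "is_set_cond_exp M F X (\<lambda>\<omega>. closure (range (\<lambda>k. g k \<omega>)))"
    and g: "\<And>k::nat. g k \<in> selections1 M F (\<lambda>\<omega>. closure (range (\<lambda>k. g k \<omega>)))"
  shows "AE \<omega> in M. convex (closure (range (\<lambda>k. g k \<omega>)))"
proof -
  define Q :: "real set" where "Q = \<rat> \<inter> {0<..<1}"
  have Q: "countable Q" unfolding Q_def using countable_rat by blast
  have "AE \<omega> in M. \<forall>q\<in>Q. \<forall>i j. (1 - q) *\<^sub>R g i \<omega> + q *\<^sub>R g j \<omega> \<in> closure (range (\<lambda>k. g k \<omega>))"
    unfolding AE_ball_countable[OF Q] AE_all_countable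
    using cond_exp_selections1_convex[OF conv Y g g] by (auto simp: selections1_def Q_def)
  then show ?thesis
  proof eventually_elim
    case (elim \<omega>)
    let ?Y = "closure (range (\<lambda>k. g k \<omega>))"
    show ?case
    proof (rule closed_convexI_rational)
      fix x y q assume xy: "x \<in> ?Y" "y \<in> ?Y" and q: "q \<in> \<rat>" "0 < q" "q < (1::real)"
      have vc: "closed ((\<lambda>x. (1 - q) *\<^sub>R x + c) -` ?Y)" "closed ((\<lambda>x. c + q *\<^sub>R x) -` ?Y)" for c
        by (intro closed_vimage closed_closure continuous_intros)+
      \<comment> \<open>The combination is known only for members of the sequence; it is extended by
        closure in one variable at a time, to all \<open>x\<close> with \<open>g j \<omega>\<close>
        fixed and from there to all \<open>y\<close>.\<close>
      have 1: "(1 - q) *\<^sub>R x + q *\<^sub>R g j \<omega> \<in> ?Y" for j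
      proof -
        have "?Y \<subseteq> (\<lambda>x. (1 - q) *\<^sub>R x + q *\<^sub>R g j \<omega>) -` ?Y"
          using elim q by (intro closure_minimal vc) (auto simp: Q_def)
        then show ?thesis using xy by auto
      qed
      have "?Y \<subseteq> (\<lambda>y. (1 - q) *\<^sub>R x + q *\<^sub>R y) -` ?Y"
        using 1 by (intro closure_minimal vc) auto
      then show "(1 - q) *\<^sub>R x + q *\<^sub>R y \<in> ?Y" using xy by auto
    qed simp
  qed
qed

text \<open>In each direction a near-maximal selection of the conditional expectation reaches the
  support function of \<open>Z\<close> up to \<open>1 / real (Suc n)\<close>. Countably many
  \<open>u\<close> and \<open>n\<close> share a null set, outside which compactness and convexity of
  the larger set turn the inequalities into inclusion.\<close>

lemma AE_subset_cond_exp: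
  fixes X Z :: "'a \<Rightarrow> 'b::euclidean_space set"
  assumes W: "countable W" "cball 0 1 \<subseteq> closure W"
    and X: "random_closed_set M X" "integrably_bounded M X" "AE \<omega> in M. convex (X \<omega>)"
    and Y: "is_set_cond_exp M F X (\<lambda>\<omega>. closure (range (\<lambda>k. g k \<omega>)))"
    and g: "\<And>k::nat. g k \<in> selections1 M F (\<lambda>\<omega>. closure (range (\<lambda>k. g k \<omega>)))"
    and Z: "random_closed_set F Z" "integrably_bounded M Z"
    and le: "\<And>u A. u \<in> W \<Longrightarrow> A \<in> sets F \<Longrightarrow> (LINT \<omega>:A|M. ssup u (Z \<omega>)) \<le> (LINT \<omega>:A|M. ssup u (X \<omega>))"
  shows "AE \<omega> in M. Z \<omega> \<subseteq> closure (range (\<lambda>k. g k \<omega>))"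
proof -
  let ?Y = "\<lambda>\<omega>. closure (range (\<lambda>k. g k \<omega>))"
  have ZM: "random_closed_set M Z" using random_closed_set_subalgebra[OF Z(1) subalg] .
  have "AE \<omega> in M. \<exists>y\<in>?Y \<omega>. ssup u (Z \<omega>) \<le> u \<bullet> y + 1 / real (Suc n)" if u: "u \<in> W" for u n
  proof -
    have "1 / real (Suc n) > 0" by simp
    then obtain \<eta> where \<eta>: "\<eta> \<in> selections1 M F ?Y"
      "\<And>A. A \<in> sets F \<Longrightarrow> (LINT \<omega>:A|M. ssup u (X \<omega>)) \<le> (LINT \<omega>:A|M. u \<bullet> \<eta> \<omega> + 1 / real (Suc n))"
      using near_max_cond_exp_selection[OF X(1,2) Y, of "1 / real (Suc n)" u] by metis
    have "AE \<omega> in M. ssup u (Z \<omega>) \<le> u \<bullet> \<eta> \<omega> + 1 / real (Suc n)"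
    proof (rule AE_le_if_set_integral_le[OF subalg])
      show "integrable M (\<lambda>\<omega>. ssup u (Z \<omega>))" by (rule integrable_ssup[OF ZM Z(2)])
      show "(\<lambda>\<omega>. ssup u (Z \<omega>)) \<in> borel_measurable F" by (rule borel_measurable_ssup[OF Z(1)])
      show "(LINT \<omega>:A|M. ssup u (Z \<omega>)) \<le> (LINT \<omega>:A|M. u \<bullet> \<eta> \<omega> + 1 / real (Suc n))"
        if "A \<in> sets F" for A using le[OF u that] \<eta>(2)[OF that] by linarith
    qed (use \<eta>(1) in \<open>auto simp: selections1_def\<close>)
    moreover have "AE \<omega> in M. \<eta> \<omega> \<in> ?Y \<omega>" using \<eta>(1) by (simp add: selections1_def)
    ultimately show ?thesis by eventually_elim auto
  qed
  then have "AE \<omega> in M. \<forall>u\<in>W. \<forall>n. \<exists>y\<in>?Y \<omega>. ssup u (Z \<omega>) \<le> u \<bullet> y + 1 / real (Suc n)"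
    unfolding AE_ball_countable[OF W(1)] AE_all_countable by blast
  with AE_convex_cond_exp[OF X(3) Y g] AE_bounded_cond_exp[OF X(1,2) Y g]
    integrably_bounded_AE_bounded[OF ZM Z(2)]
  show ?thesis
  proof eventually_elim
    case (elim \<omega>)
    show ?case
    proof (rule subset_if_ssup_le[OF _ elim(1) _ W(2) elim(3)])
      fix u assume u: "u \<in> W"
      have "ssup u (Z \<omega>) \<le> ssup u (?Y \<omega>) + e" if e: "e > 0" for e
      proof -
        obtain n where n: "1 / real (Suc n) < e" using e nat_approx_posE by metis
        obtain y where "y \<in> ?Y \<omega>" "ssup u (Z \<omega>) \<le> u \<bullet> y + 1 / real (Suc n)" using elim(4) u by blast
        with ssup_upper[OF elim(2), of y u] n show ?thesis by linarith
      qed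
      then show "ssup u (Z \<omega>) \<le> ssup u (?Y \<omega>)" by (rule field_le_epsilon)
    qed (use elim(2) in \<open>auto simp: compact_eq_bounded_closed\<close>)
  qed
qed

text \<open>Here \<open>Z\<close> is the larger set and supplies the convexity. Every
  \<open>g k\<close> satisfies the countably many inequalities which cut out \<open>Z\<close>, and
  closedness absorbs the limit points.\<close>

lemma AE_cond_exp_subset:
  fixes X Z :: "'a \<Rightarrow> 'b::euclidean_space set"
  assumes W: "countable W" "cball 0 1 \<subseteq> closure W"
    and X: "random_closed_set M X" "integrably_bounded M X"
    and Y: "is_set_cond_exp M F X (\<lambda>\<omega>. closure (range (\<lambda>k. g k \<omega>)))"
    and g: "\<And>k::nat. g k \<in> selections1 M F (\<lambda>\<omega>. closure (range (\<lambda>k. g k \<omega>)))"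
    and Z: "random_closed_set F Z" "integrably_bounded M Z" "AE \<omega> in M. convex (Z \<omega>)"
    and le: "\<And>u A. u \<in> W \<Longrightarrow> A \<in> sets F \<Longrightarrow> (LINT \<omega>:A|M. ssup u (X \<omega>)) \<le> (LINT \<omega>:A|M. ssup u (Z \<omega>))"
  shows "AE \<omega> in M. closure (range (\<lambda>k. g k \<omega>)) \<subseteq> Z \<omega>"
proof -
  have ZM: "random_closed_set M Z" using random_closed_set_subalgebra[OF Z(1) subalg] .
  have "AE \<omega> in M. u \<bullet> g k \<omega> \<le> ssup u (Z \<omega>)" if u: "u \<in> W" for u k
  proof (rule AE_le_if_set_integral_le[OF subalg])
    show "integrable M (\<lambda>\<omega>. ssup u (Z \<omega>))" by (rule integrable_ssup[OF ZM Z(2)])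
    show "(\<lambda>\<omega>. ssup u (Z \<omega>)) \<in> borel_measurable F" by (rule borel_measurable_ssup[OF Z(1)])
    show "(LINT \<omega>:A|M. u \<bullet> g k \<omega>) \<le> (LINT \<omega>:A|M. ssup u (Z \<omega>))"
      if A: "A \<in> sets F" for A
      using le[OF u A] set_integral_inner_le_ssup[OF X Y g A, of u k] by linarith
  qed (use g[of k] in \<open>auto simp: selections1_def\<close>)
  then have "AE \<omega> in M. \<forall>u\<in>W. \<forall>k. u \<bullet> g k \<omega> \<le> ssup u (Z \<omega>)"
    unfolding AE_ball_countable[OF W(1)] AE_all_countable by blast
  with Z(3) integrably_bounded_AE_bounded[OF ZM Z(2)] AE_space
  show ?thesis
  proof eventually_elim
    case (elim \<omega>)
    have Z': "closed (Z \<omega>)" "Z \<omega> \<noteq> {}" using random_closed_setD[OF ZM elim(3)] by auto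
    have "g k \<omega> \<in> Z \<omega>" for k
      using mem_iff_ssup[OF _ elim(1) Z'(2) W(2)] elim(2,4) Z'(1) by (simp add: compact_eq_bounded_closed)
    then show ?case using Z'(1) by (intro closure_minimal) auto
  qed
qed

end

section \<open>Uniform integrability and monotone extension\<close>

context finite_measure
begin

text \<open>Fatou's lemma for the absolute values. It will supply integrability of the limit as well
  as the tail estimate for the limit.\<close>

lemma integrable_limit_if_L1_bounded:
  fixes f :: "nat \<Rightarrow> 'a \<Rightarrow> real"
  assumes f: "\<And>n. integrable M (f n)" and h: "h \<in> borel_measurable M"
    and lim: "AE \<omega> in M. (\<lambda>n. f n \<omega>) \<longlonglongrightarrow> h \<omega>"
    and B: "\<And>n. (LINT \<omega>|M. \<bar>f n \<omega>\<bar>) \<le> B"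
  shows "integrable M h" "(LINT \<omega>|M. \<bar>h \<omega>\<bar>) \<le> B"
proof -
  have [measurable]: "\<And>n. f n \<in> borel_measurable M" "h \<in> borel_measurable M" using f h by auto
  have "(\<integral>\<^sup>+\<omega>. ennreal \<bar>h \<omega>\<bar> \<partial>M) = (\<integral>\<^sup>+\<omega>. liminf (\<lambda>n. ennreal \<bar>f n \<omega>\<bar>) \<partial>M)"
  proof (rule nn_integral_cong_AE)
    show "AE \<omega> in M. ennreal \<bar>h \<omega>\<bar> = liminf (\<lambda>n. ennreal \<bar>f n \<omega>\<bar>)"
      using lim
    proof eventually_elim
      case (elim \<omega>)
      have "(\<lambda>n. ennreal \<bar>f n \<omega>\<bar>) \<longlonglongrightarrow> ennreal \<bar>h \<omega>\<bar>"
        using elim by (intro tendsto_ennrealI tendsto_rabs)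
      from lim_imp_Liminf[OF sequentially_bot this] show ?case by simp
    qed
  qed
  also have "\<dots> \<le> liminf (\<lambda>n. \<integral>\<^sup>+\<omega>. ennreal \<bar>f n \<omega>\<bar> \<partial>M)"
    by (rule nn_integral_liminf) measurable
  also have "\<dots> \<le> ennreal B"
  proof (rule Liminf_le)
    have "(\<integral>\<^sup>+\<omega>. ennreal \<bar>f n \<omega>\<bar> \<partial>M) \<le> ennreal B" for n
      using f B by (subst nn_integral_eq_integral) (auto intro: ennreal_leI)
    then show "\<forall>\<^sub>F n in sequentially. (\<integral>\<^sup>+\<omega>. ennreal \<bar>f n \<omega>\<bar> \<partial>M) \<le> ennreal B" by simp
  qed simp
  finally have le: "(\<integral>\<^sup>+\<omega>. ennreal \<bar>h \<omega>\<bar> \<partial>M) \<le> ennreal B" .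
  then show i: "integrable M h"
    by (intro integrableI_bounded) (auto simp: le_less_trans[OF _ ennreal_less_top])
  have "0 \<le> B" using B[of 0] by (rule order_trans[rotated]) simp
  then show "(LINT \<omega>|M. \<bar>h \<omega>\<bar>) \<le> B"
    using le i by (subst (asm) nn_integral_eq_integral) auto
qed

text \<open>Vitali's theorem. Uniform integrability is expressed by the excess over a level
  \<open>K\<close> rather than by the integral over the event above \<open>K\<close>, because the
  excess of a real submartingale has a nondecreasing integral in time.\<close>

lemma tendsto_set_integral_if_uniformly_integrable:
  fixes f :: "nat \<Rightarrow> 'a \<Rightarrow> real"
  assumes f: "\<And>n. integrable M (f n)" and h: "h \<in> borel_measurable M"
    and lim: "AE \<omega> in M. (\<lambda>n. f n \<omega>) \<longlonglongrightarrow> h \<omega>"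
    and ui: "\<And>e. e > 0 \<Longrightarrow> \<exists>K\<ge>0. \<forall>n. (LINT \<omega>|M. max 0 (\<bar>f n \<omega>\<bar> - K)) \<le> e"
  shows "integrable M h"
    and "A \<in> sets M \<Longrightarrow> (\<lambda>n. LINT \<omega>:A|M. f n \<omega>) \<longlonglongrightarrow> (LINT \<omega>:A|M. h \<omega>)"
proof -
  have [measurable]: "\<And>n. f n \<in> borel_measurable M" "h \<in> borel_measurable M" using f h by auto
  have exc: "integrable M (\<lambda>\<omega>. max 0 (\<bar>g \<omega>\<bar> - K))" if "integrable M g" for g :: "'a \<Rightarrow> real" and K
    using that by (intro integrable_max) auto
  show hi: "integrable M h"
  proof -
    obtain K where K: "K \<ge> 0" "\<And>n. (LINT \<omega>|M. max 0 (\<bar>f n \<omega>\<bar> - K)) \<le> 1"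
      using ui[of 1] by auto
    have "(LINT \<omega>|M. \<bar>f n \<omega>\<bar>) \<le> K * measure M (space M) + 1" for n
    proof -
      have "(LINT \<omega>|M. \<bar>f n \<omega>\<bar>) \<le> (LINT \<omega>|M. K + max 0 (\<bar>f n \<omega>\<bar> - K))"
        using f exc by (intro integral_mono) auto
      also have "\<dots> = K * measure M (space M) + (LINT \<omega>|M. max 0 (\<bar>f n \<omega>\<bar> - K))"
        using exc[OF f] by simp
      finally show ?thesis using K(2)[of n] by simp
    qed
    then show ?thesis by (rule integrable_limit_if_L1_bounded(1)[OF f h lim])
  qed
  assume A: "A \<in> sets M"
  show "(\<lambda>n. LINT \<omega>:A|M. f n \<omega>) \<longlonglongrightarrow> (LINT \<omega>:A|M. h \<omega>)"
  proof (rule tendstoI)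
    fix e :: real assume e: "e > 0"
    obtain K where K: "K \<ge> 0" "\<And>n. (LINT \<omega>|M. max 0 (\<bar>f n \<omega>\<bar> - K)) \<le> e / 4"
      using ui[of "e / 4"] e by auto
    have hK: "(LINT \<omega>|M. max 0 (\<bar>h \<omega>\<bar> - K)) \<le> e / 4"
    proof -
      have "(LINT \<omega>|M. \<bar>max 0 (\<bar>h \<omega>\<bar> - K)\<bar>) \<le> e / 4"
      proof (rule integrable_limit_if_L1_bounded(2)[where f = "\<lambda>n \<omega>. max 0 (\<bar>f n \<omega>\<bar> - K)"])
        show "AE \<omega> in M. (\<lambda>n. max 0 (\<bar>f n \<omega>\<bar> - K)) \<longlonglongrightarrow> max 0 (\<bar>h \<omega>\<bar> - K)"
          using lim by eventually_elim (intro tendsto_intros)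
      qed (use exc[OF f] K in auto)
      then show ?thesis by simp
    qed
    \<comment> \<open>\<open>T\<close> clips to the interval from \<open>- K\<close> to
      \<open>K\<close>, and what it removes from \<open>x\<close> has modulus
      \<open>max 0 (\<bar>x\<bar> - K)\<close>. The clipped functions converge by dominated
      convergence, so three terms of at most \<open>e / 4\<close> remain.\<close>
    define T :: "real \<Rightarrow> real" where "T x = max (- K) (min K x)" for x
    have T: "\<bar>x - y\<bar> \<le> \<bar>T x - T y\<bar> + max 0 (\<bar>x\<bar> - K) + max 0 (\<bar>y\<bar> - K)" for x y
      using K(1) unfolding T_def by (auto simp: max_def min_def abs_if split: if_splits)
    have Tb: "\<bar>T x - T y\<bar> \<le> 2 * K" for x y
      using K(1) by (auto simp: T_def max_def min_def abs_if)
    have [measurable]: "T \<in> borel_measurable borel" unfolding T_def by measurable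
    have "(\<lambda>n. LINT \<omega>|M. \<bar>T (f n \<omega>) - T (h \<omega>)\<bar>) \<longlonglongrightarrow> (LINT \<omega>|M. 0)"
    proof (rule integral_dominated_convergence[where w = "\<lambda>_. 2 * K"])
      show "AE \<omega> in M. (\<lambda>n. \<bar>T (f n \<omega>) - T (h \<omega>)\<bar>) \<longlonglongrightarrow> 0"
        using lim
      proof eventually_elim
        case (elim \<omega>)
        have "(\<lambda>n. \<bar>T (f n \<omega>) - T (h \<omega>)\<bar>) \<longlonglongrightarrow> \<bar>T (h \<omega>) - T (h \<omega>)\<bar>"
          unfolding T_def by (intro tendsto_intros elim)
        then show ?case by simp
      qed
    qed (use Tb in auto)
    then have "\<forall>\<^sub>F n in sequentially. (LINT \<omega>|M. \<bar>T (f n \<omega>) - T (h \<omega>)\<bar>) < e / 4"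
      using e by (intro order_tendstoD(2)[where y = 0]) auto
    then show "\<forall>\<^sub>F n in sequentially. dist (LINT \<omega>:A|M. f n \<omega>) (LINT \<omega>:A|M. h \<omega>) < e"
    proof eventually_elim
      case (elim n)
      have Ti: "integrable M (\<lambda>\<omega>. \<bar>T (f n \<omega>) - T (h \<omega>)\<bar>)"
        by (rule integrable_const_bound[where B = "2 * K"]) (use Tb in auto)
      have si: "set_integrable M A (f n)" "set_integrable M A h"
        unfolding set_integrable_def
        using A f hi by (auto intro!: integrable_mult_indicator simp del: real_scaleR_def)
      have "\<bar>(LINT \<omega>:A|M. f n \<omega>) - (LINT \<omega>:A|M. h \<omega>)\<bar> = \<bar>LINT \<omega>:A|M. f n \<omega> - h \<omega>\<bar>"
        using si by (simp add: set_integral_diff)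
      also have "\<dots> \<le> (LINT \<omega>|M. \<bar>indicator A \<omega> *\<^sub>R (f n \<omega> - h \<omega>)\<bar>)"
        unfolding set_lebesgue_integral_def by (rule integral_abs_bound)
      also have "\<dots> \<le> (LINT \<omega>|M. \<bar>T (f n \<omega>) - T (h \<omega>)\<bar> + max 0 (\<bar>f n \<omega>\<bar> - K) + max 0 (\<bar>h \<omega>\<bar> - K))"
      proof (rule integral_mono)
        show "integrable M (\<lambda>\<omega>. \<bar>indicator A \<omega> *\<^sub>R (f n \<omega> - h \<omega>)\<bar>)"
          using A f hi by (intro integrable_abs integrable_mult_indicator Bochner_Integration.integrable_diff) auto
        show "\<bar>indicator A \<omega> *\<^sub>R (f n \<omega> - h \<omega>)\<bar> \<le>
            \<bar>T (f n \<omega>) - T (h \<omega>)\<bar> + max 0 (\<bar>f n \<omega>\<bar> - K) + max 0 (\<bar>h \<omega>\<bar> - K)" for \<omega>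
          using T[of "f n \<omega>" "h \<omega>"] by (auto simp: indicator_def)
      qed (use Ti exc[OF f, of n] exc[OF hi] in auto)
      also have "\<dots> = (LINT \<omega>|M. \<bar>T (f n \<omega>) - T (h \<omega>)\<bar>) + (LINT \<omega>|M. max 0 (\<bar>f n \<omega>\<bar> - K))
          + (LINT \<omega>|M. max 0 (\<bar>h \<omega>\<bar> - K))"
        using Ti exc[OF f, of n] exc[OF hi] by simp
      also have "\<dots> < e" using elim K(2)[of n] hK e by simp
      finally show ?case by (simp add: dist_real_def)
    qed
  qed
qed

text \<open>Dominated convergence along integer levels. The excess decreases in \<open>K\<close>,
  which covers all larger levels and lets several thresholds be merged by a maximum.\<close>

lemma ex_integral_excess_le:
  fixes f :: "'a \<Rightarrow> real"
  assumes f: "integrable M f" and e: "e > 0"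
  shows "\<exists>K\<^sub>0. \<forall>K\<ge>K\<^sub>0. (LINT \<omega>|M. max 0 (f \<omega> - K)) \<le> e"
proof -
  have [measurable]: "f \<in> borel_measurable M" using f by auto
  have "(\<lambda>n. LINT \<omega>|M. max 0 (f \<omega> - real n)) \<longlonglongrightarrow> (LINT \<omega>|M. 0)"
  proof (rule integral_dominated_convergence[where w = "\<lambda>\<omega>. \<bar>f \<omega>\<bar>"])
    show "AE \<omega> in M. (\<lambda>n. max 0 (f \<omega> - real n)) \<longlonglongrightarrow> 0"
    proof (rule AE_I2, rule tendsto_eventually)
      fix \<omega>
      obtain N where N: "f \<omega> \<le> real N" using real_arch_simple by blast
      show "\<forall>\<^sub>F n in sequentially. max 0 (f \<omega> - real n) = 0"
        using eventually_ge_at_top[of N] by eventually_elim (use N in auto)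
    qed
  qed (use f in auto)
  then have "\<forall>\<^sub>F n in sequentially. (LINT \<omega>|M. max 0 (f \<omega> - real n)) < e"
    using e by (intro order_tendstoD(2)[where y = 0]) auto
  then obtain N where N: "(LINT \<omega>|M. max 0 (f \<omega> - real N)) < e" by (auto simp: eventually_sequentially)
  have "(LINT \<omega>|M. max 0 (f \<omega> - K)) \<le> e" if "K \<ge> real N" for K
  proof -
    have "(LINT \<omega>|M. max 0 (f \<omega> - K)) \<le> (LINT \<omega>|M. max 0 (f \<omega> - real N))"
      using f that by (intro integral_mono integrable_max) auto
    then show ?thesis using N by simp
  qed
  then show ?thesis by blast
qed

text \<open>A Jensen inequality that works with events: where \<open>f\<close> exceeds
  \<open>K\<close>, an event of \<open>G\<close>, the excess is \<open>f - K\<close>; there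
  \<open>f\<close> is exchanged for \<open>g\<close>, whose excess dominates \<open>g - K\<close>
  and is nonnegative elsewhere.\<close>

lemma integral_excess_mono:
  fixes f g :: "'a \<Rightarrow> real"
  assumes G: "subalgebra M G" and f: "integrable M f" "f \<in> borel_measurable G" and g: "integrable M g"
    and le: "\<And>A. A \<in> sets G \<Longrightarrow> (LINT \<omega>:A|M. f \<omega>) \<le> (LINT \<omega>:A|M. g \<omega>)"
  shows "(LINT \<omega>|M. max 0 (f \<omega> - K)) \<le> (LINT \<omega>|M. max 0 (g \<omega> - K))"
proof -
  note [measurable] = f(2)
  define A where "A = {\<omega>\<in>space G. K < f \<omega>}"
  have A[measurable]: "A \<in> sets G" unfolding A_def by measurable
  have AM: "A \<in> sets M" using A G by (auto simp: subalgebra_def)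
  have si: "set_integrable M A f" "set_integrable M A g" "set_integrable M A (\<lambda>_. K)"
    unfolding set_integrable_def
    using f(1) g by (auto intro!: integrable_mult_indicator[OF AM] simp del: real_scaleR_def)
  have "(LINT \<omega>|M. max 0 (f \<omega> - K)) = (LINT \<omega>:A|M. f \<omega> - K)"
    unfolding set_lebesgue_integral_def
    by (rule Bochner_Integration.integral_cong)
      (use G in \<open>auto simp: A_def indicator_def subalgebra_def\<close>)
  also have "\<dots> = (LINT \<omega>:A|M. f \<omega>) - (LINT \<omega>:A|M. K)" using si by (intro set_integral_diff)
  also have "\<dots> \<le> (LINT \<omega>:A|M. g \<omega>) - (LINT \<omega>:A|M. K)" using le[OF A] by simp
  also have "\<dots> = (LINT \<omega>:A|M. g \<omega> - K)" using si by (intro set_integral_diff(2)[symmetric])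
  also have "\<dots> \<le> (LINT \<omega>|M. max 0 (g \<omega> - K))"
    unfolding set_lebesgue_integral_def
  proof (rule integral_mono)
    show "integrable M (\<lambda>\<omega>. indicator A \<omega> *\<^sub>R (g \<omega> - K))"
      using g by (intro integrable_mult_indicator[OF AM]) auto
    show "integrable M (\<lambda>\<omega>. max 0 (g \<omega> - K))" using g by (intro integrable_max) auto
  qed (auto simp: indicator_def)
  finally show ?thesis .
qed

text \<open>Symmetric differences are weighted by the modulus of \<open>h\<close>, since integrals
  of \<open>h\<close> over events are to be compared. Complements leave the distance unchanged, and
  a countable union is replaced by a finite one up to a small remainder.\<close>

lemma approximation_by_algebra:
  fixes h :: "'a \<Rightarrow> real"
  assumes h: "integrable M h" and alg: "algebra (space M) \<A>" and sub: "\<A> \<subseteq> sets M"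
    and B: "B \<in> sigma_sets (space M) \<A>" and e: "e > 0"
  shows "\<exists>A\<in>\<A>. (LINT \<omega>|M. \<bar>indicator A \<omega> - indicator B \<omega>\<bar> * \<bar>h \<omega>\<bar>) < e"
proof -
  interpret algebra "space M" \<A> by fact
  have [measurable]: "h \<in> borel_measurable M" using h by auto
  define D where "D A B = (LINT \<omega>|M. \<bar>indicator A \<omega> - indicator B \<omega>\<bar> * \<bar>h \<omega>\<bar>)" for A B
  have Di: "integrable M (\<lambda>\<omega>. \<bar>indicator A \<omega> - indicator B \<omega>\<bar> * \<bar>h \<omega>\<bar>)"
    if [measurable]: "A \<in> sets M" "B \<in> sets M" for A B
    by (rule Bochner_Integration.integrable_bound[OF h]) (auto simp: indicator_def)
  have sM: "sigma_sets (space M) \<A> \<subseteq> sets M" using sub by (rule sets.sigma_sets_subset)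
  have "\<forall>e>0. \<exists>A\<in>\<A>. D A B < e" using B
  proof (induction rule: sigma_sets.induct)
    case (Basic a)
    then show ?case by (auto simp: D_def intro!: bexI[of _ a])
  next
    case Empty
    then show ?case by (auto simp: D_def intro!: bexI[of _ "{}"])
  next
    case (Compl a)
    have "D (space M - A) (space M - a) = D A a" for A
      unfolding D_def by (rule Bochner_Integration.integral_cong) (auto simp: indicator_def)
    then show ?case using Compl.IH by (metis compl_sets)
  next
    case (Union a)
    have aM[measurable]: "a i \<in> sets M" for i using Union.hyps sM by blast
    show ?case
    proof (intro allI impI)
      fix e :: real assume e: "e > 0"
      define U where "U n = (\<Union>i<n. a i)" for n :: nat
      have [measurable]: "U n \<in> sets M" for n unfolding U_def by measurable
      have "(\<lambda>n. D (U n) (\<Union>i. a i)) \<longlonglongrightarrow> (LINT \<omega>|M. 0)"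
        unfolding D_def
      proof (rule integral_dominated_convergence[where w = "\<lambda>\<omega>. \<bar>h \<omega>\<bar>"])
        show "AE \<omega> in M. (\<lambda>n. \<bar>indicator (U n) \<omega> - indicator (\<Union>i. a i) \<omega>\<bar> * \<bar>h \<omega>\<bar>) \<longlonglongrightarrow> 0"
        proof (rule AE_I2, rule tendsto_eventually)
          fix \<omega>
          show "\<forall>\<^sub>F n in sequentially. \<bar>indicator (U n) \<omega> - indicator (\<Union>i. a i) \<omega>\<bar> * \<bar>h \<omega>\<bar> = 0"
          proof (cases "\<omega> \<in> (\<Union>i. a i)")
            case True
            then obtain i where i: "\<omega> \<in> a i" by auto
            show ?thesis using eventually_gt_at_top[of i]
              by eventually_elim (use i in \<open>auto simp: U_def indicator_def\<close>)
          qed (auto simp: U_def indicator_def)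
        qed
      qed (use h in \<open>auto simp: indicator_def\<close>)
      then have "\<forall>\<^sub>F n in sequentially. D (U n) (\<Union>i. a i) < e / 2"
        using e by (intro order_tendstoD(2)[where y = 0]) auto
      then obtain n where n: "D (U n) (\<Union>i. a i) < e / 2" by (auto simp: eventually_sequentially)
      \<comment> \<open>Each of the \<open>n\<close> sets may err by this much, which adds up to at
        most \<open>e / 2\<close>; \<open>Suc n\<close> avoids a division by zero when
        \<open>n\<close> is \<open>0\<close>.\<close>
      have "e / (2 * real (Suc n)) > 0" using e by simp
      then have "\<forall>i. \<exists>A\<in>\<A>. D A (a i) < e / (2 * real (Suc n))" using Union.IH by blast
      then obtain A where A: "\<And>i. A i \<in> \<A>" "\<And>i. D (A i) (a i) < e / (2 * real (Suc n))" by metis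
      have [measurable]: "A i \<in> sets M" for i using A sub by blast
      define V where "V = (\<Union>i<n. A i)"
      have V: "V \<in> \<A>" unfolding V_def using A by (intro finite_UN) auto
      have [measurable]: "V \<in> sets M" using V sub by blast
      have "D V (\<Union>i. a i) \<le> (LINT \<omega>|M. (\<Sum>i<n. \<bar>indicator (A i) \<omega> - indicator (a i) \<omega>\<bar> * \<bar>h \<omega>\<bar>) +
          \<bar>indicator (U n) \<omega> - indicator (\<Union>i. a i) \<omega>\<bar> * \<bar>h \<omega>\<bar>)"
        unfolding D_def
      proof (rule integral_mono)
        fix \<omega>
        \<comment> \<open>If \<open>A i\<close> and \<open>a i\<close> agree at the point for all
          \<open>i < n\<close>, so do their unions; otherwise one summand is already
          \<open>1\<close>.\<close>
        have s: "\<bar>indicator V \<omega> - indicator (U n) \<omega> :: real\<bar> \<le> (\<Sum>i<n. \<bar>indicator (A i) \<omega> - indicator (a i) \<omega>\<bar>)"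
        proof (cases "\<exists>i<n. (\<omega> \<in> A i) \<noteq> (\<omega> \<in> a i)")
          case True
          then obtain i where i: "i < n" "(\<omega> \<in> A i) \<noteq> (\<omega> \<in> a i)" by auto
          have "\<bar>indicator V \<omega> - indicator (U n) \<omega> :: real\<bar> \<le> 1" by (auto simp: indicator_def)
          also have "1 = \<bar>indicator (A i) \<omega> - indicator (a i) \<omega> :: real\<bar>" using i by (auto simp: indicator_def)
          also have "\<dots> \<le> (\<Sum>i<n. \<bar>indicator (A i) \<omega> - indicator (a i) \<omega>\<bar>)"
            using i by (intro member_le_sum) auto
          finally show ?thesis .
        next
          case False
          then have "\<omega> \<in> V \<longleftrightarrow> \<omega> \<in> U n" by (auto simp: V_def U_def)
          then show ?thesis by (simp add: indicator_def sum_nonneg)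
        qed
        have "\<bar>indicator V \<omega> - indicator (\<Union>i. a i) \<omega> :: real\<bar> \<le>
            (\<Sum>i<n. \<bar>indicator (A i) \<omega> - indicator (a i) \<omega>\<bar>) + \<bar>indicator (U n) \<omega> - indicator (\<Union>i. a i) \<omega>\<bar>"
          using s by linarith
        then have "\<bar>indicator V \<omega> - indicator (\<Union>i. a i) \<omega>\<bar> * \<bar>h \<omega>\<bar> \<le>
            ((\<Sum>i<n. \<bar>indicator (A i) \<omega> - indicator (a i) \<omega>\<bar>) + \<bar>indicator (U n) \<omega> - indicator (\<Union>i. a i) \<omega>\<bar>) * \<bar>h \<omega>\<bar>"
          by (rule mult_right_mono) simp
        then show "\<bar>indicator V \<omega> - indicator (\<Union>i. a i) \<omega>\<bar> * \<bar>h \<omega>\<bar> \<le>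
            (\<Sum>i<n. \<bar>indicator (A i) \<omega> - indicator (a i) \<omega>\<bar> * \<bar>h \<omega>\<bar>) + \<bar>indicator (U n) \<omega> - indicator (\<Union>i. a i) \<omega>\<bar> * \<bar>h \<omega>\<bar>"
          by (simp add: distrib_right sum_distrib_right)
      qed (use Di in auto)
      also have "\<dots> = (\<Sum>i<n. D (A i) (a i)) + D (U n) (\<Union>i. a i)"
        unfolding D_def using Di by (subst Bochner_Integration.integral_add) (auto simp: Bochner_Integration.integral_sum)
      also have "(\<Sum>i<n. D (A i) (a i)) \<le> (\<Sum>i<n. e / (2 * real (Suc n)))"
        using A(2) by (intro sum_mono less_imp_le)
      also have "\<dots> \<le> e / 2" using e by (simp add: field_simps)
      finally have "D V (\<Union>i. a i) < e" using n by simp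
      then show "\<exists>A\<in>\<A>. D A (\<Union>i. a i) < e" using V by blast
    qed
  qed
  then show ?thesis using e by (simp add: D_def)
qed

text \<open>The events with nonnegative integral are not closed under complements in general, so a
  Dynkin argument does not apply directly. Approximating \<open>B\<close> in the weighted distance
  changes the integral of \<open>h\<close> by less than \<open>e\<close>.\<close>

lemma set_integral_nonneg_sigma_sets:
  fixes h :: "'a \<Rightarrow> real"
  assumes h: "integrable M h" and alg: "algebra (space M) \<A>" and sub: "\<A> \<subseteq> sets M"
    and nonneg: "\<And>A. A \<in> \<A> \<Longrightarrow> 0 \<le> (LINT \<omega>:A|M. h \<omega>)"
    and B: "B \<in> sigma_sets (space M) \<A>"
  shows "0 \<le> (LINT \<omega>:B|M. h \<omega>)"
proof (rule field_le_epsilon)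
  fix e :: real assume "e > 0"
  then obtain A where A: "A \<in> \<A>" "(LINT \<omega>|M. \<bar>indicator A \<omega> - indicator B \<omega>\<bar> * \<bar>h \<omega>\<bar>) < e"
    using approximation_by_algebra[OF h alg sub B] by blast
  have [measurable]: "h \<in> borel_measurable M" using h by auto
  have M[measurable]: "A \<in> sets M" "B \<in> sets M"
    using A sub B sets.sigma_sets_subset[OF sub] by auto
  have i: "integrable M (\<lambda>\<omega>. indicator A \<omega> *\<^sub>R h \<omega>)" "integrable M (\<lambda>\<omega>. indicator B \<omega> *\<^sub>R h \<omega>)"
    by (intro integrable_mult_indicator M h)+
  have "integrable M (\<lambda>\<omega>. \<bar>indicator A \<omega> - indicator B \<omega>\<bar> * \<bar>h \<omega>\<bar>)"
    by (rule Bochner_Integration.integrable_bound[OF h]) (auto simp: indicator_def)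
  then have "(LINT \<omega>|M. indicator A \<omega> *\<^sub>R h \<omega> - indicator B \<omega> *\<^sub>R h \<omega>) \<le>
      (LINT \<omega>|M. \<bar>indicator A \<omega> - indicator B \<omega>\<bar> * \<bar>h \<omega>\<bar>)"
    using i by (intro integral_mono Bochner_Integration.integrable_diff) (auto simp: indicator_def)
  moreover have "(LINT \<omega>|M. indicator A \<omega> *\<^sub>R h \<omega> - indicator B \<omega> *\<^sub>R h \<omega>) =
      (LINT \<omega>:A|M. h \<omega>) - (LINT \<omega>:B|M. h \<omega>)"
    unfolding set_lebesgue_integral_def using i by (rule Bochner_Integration.integral_diff)
  ultimately show "0 \<le> (LINT \<omega>:B|M. h \<omega>) + e" using nonneg[OF A(1)] A(2) by linarith
qed

end

section \<open>Left limits of a set-valued submartingale\<close>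

text \<open>Measurability of limits and the convergence theorems for integrals ask for sequences, so
  the rational approach from the left is sampled by one.\<close>

lemma left_sequence_rat:
  assumes "t > (0::real)"
  obtains r :: "nat \<Rightarrow> real" where "\<And>n. r n \<in> \<rat>" "\<And>n. 0 < r n" "\<And>n. r n < t"
    "filterlim r (rat_left t) sequentially"
proof -
  have "\<exists>q\<in>\<rat>. max 0 (t - 1 / real (Suc n)) < q \<and> q < t" for n
    using assms by (intro Rats_dense_in_real) auto
  then obtain r where r: "\<And>n. r n \<in> \<rat>" "\<And>n. max 0 (t - 1 / real (Suc n)) < r n" "\<And>n. r n < t"
    by metis
  have "r \<longlonglongrightarrow> t"
  proof (rule tendsto_sandwich)
    have "(\<lambda>n. t - inverse (real (Suc n))) \<longlonglongrightarrow> t - 0"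
      by (intro tendsto_diff tendsto_const LIMSEQ_inverse_real_of_nat)
    then show "(\<lambda>n. t - 1 / real (Suc n)) \<longlonglongrightarrow> t" by (simp add: inverse_eq_divide)
    show "\<forall>\<^sub>F n in sequentially. t - 1 / real (Suc n) \<le> r n" "\<forall>\<^sub>F n in sequentially. r n \<le> t"
      using r by (auto intro!: always_eventually less_imp_le)
  qed simp
  moreover have "r n \<in> \<rat> \<inter> {0..<t} \<and> r n \<noteq> t \<and> 0 < r n" for n using r(1,2,3)[of n] by auto
  ultimately show thesis using r that[of r] by (auto simp: filterlim_at)
qed

text \<open>Linear functionals commute with the expectation of a selection, and near-maximal
  selections give the reverse estimate up to \<open>e\<close>. This translates the continuity
  condition of the theorem into one about integrals of \<open>ssup\<close>.\<close>

lemma (in prob_space) support_fun_set_expectation: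
  fixes X :: "'a \<Rightarrow> 'b::euclidean_space set"
  assumes X: "random_closed_set M X" "integrably_bounded M X"
  shows "support_fun u (set_expectation M X) = ereal (LINT \<omega>|M. ssup u (X \<omega>))"
proof -
  have "support_fun u (set_expectation M X) = (SUP \<xi>\<in>selections1 M M X. ereal (u \<bullet> integral\<^sup>L M \<xi>))"
    unfolding set_expectation_def support_fun_closure by (simp add: support_fun_def image_comp o_def)
  also have "\<dots> = ereal (LINT \<omega>|M. ssup u (X \<omega>))"
  proof (rule antisym)
    show "(SUP \<xi>\<in>selections1 M M X. ereal (u \<bullet> integral\<^sup>L M \<xi>)) \<le> ereal (LINT \<omega>|M. ssup u (X \<omega>))"
    proof (rule SUP_least)
      fix \<xi> assume "\<xi> \<in> selections1 M M X"
      then have \<xi>: "integrable M \<xi>" "AE \<omega> in M. \<xi> \<omega> \<in> X \<omega>" by (auto simp: selections1_def)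
      have "u \<bullet> integral\<^sup>L M \<xi> = (LINT \<omega>|M. u \<bullet> \<xi> \<omega>)" using \<xi> by simp
      also have "\<dots> \<le> (LINT \<omega>|M. ssup u (X \<omega>))"
      proof (rule integral_mono_AE)
        show "AE \<omega> in M. u \<bullet> \<xi> \<omega> \<le> ssup u (X \<omega>)"
          using \<xi>(2) integrably_bounded_AE_bounded[OF X] by eventually_elim (rule ssup_upper)
      qed (use \<xi> integrable_ssup[OF X] in auto)
      finally show "ereal (u \<bullet> integral\<^sup>L M \<xi>) \<le> ereal (LINT \<omega>|M. ssup u (X \<omega>))" by simp
    qed
    show "ereal (LINT \<omega>|M. ssup u (X \<omega>)) \<le> (SUP \<xi>\<in>selections1 M M X. ereal (u \<bullet> integral\<^sup>L M \<xi>))"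
    proof (rule ereal_le_epsilon2)
      fix e :: real assume e: "0 < e"
      obtain \<xi> where \<xi>: "\<xi> \<in> borel_measurable M" "\<And>\<omega>. \<omega> \<in> space M \<Longrightarrow> \<xi> \<omega> \<in> X \<omega>"
        "\<And>\<omega>. \<omega> \<in> space M \<Longrightarrow> bounded (X \<omega>) \<Longrightarrow> ssup u (X \<omega>) - e < u \<bullet> \<xi> \<omega>"
        using near_max_selection[OF X(1) e] by metis
      have \<xi>S: "\<xi> \<in> selections1 M M X"
        using X \<xi> by (intro selections1I) (auto simp: subalgebra_def)
      then have \<xi>i: "integrable M \<xi>" by (simp add: selections1_def)
      have "(LINT \<omega>|M. ssup u (X \<omega>)) \<le> (LINT \<omega>|M. u \<bullet> \<xi> \<omega> + e)"
      proof (rule integral_mono_AE)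
        show "AE \<omega> in M. ssup u (X \<omega>) \<le> u \<bullet> \<xi> \<omega> + e"
          using integrably_bounded_AE_bounded[OF X] AE_space
          by eventually_elim (use \<xi>(3) in force)
      qed (use \<xi>i integrable_ssup[OF X] in auto)
      also have "\<dots> = u \<bullet> integral\<^sup>L M \<xi> + e" using \<xi>i by (simp add: prob_space)
      finally have "ereal (LINT \<omega>|M. ssup u (X \<omega>)) \<le> ereal (u \<bullet> integral\<^sup>L M \<xi>) + ereal e" by simp
      also have "\<dots> \<le> (SUP \<xi>\<in>selections1 M M X. ereal (u \<bullet> integral\<^sup>L M \<xi>)) + ereal e"
        by (intro add_mono SUP_upper \<xi>S) simp
      finally show "ereal (LINT \<omega>|M. ssup u (X \<omega>)) \<le>
          (SUP \<xi>\<in>selections1 M M X. ereal (u \<bullet> integral\<^sup>L M \<xi>)) + ereal e" .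
    qed
  qed
  finally show ?thesis .
qed

lemma (in finite_measure) integrably_boundedI_ssup:
  fixes X :: "'a \<Rightarrow> 'b::euclidean_space set"
  assumes i: "\<And>u. integrable M (\<lambda>\<omega>. ssup u (X \<omega>))" and b: "AE \<omega> in M. bounded (X \<omega>)"
  shows "integrably_bounded M X"
proof -
  define g where "g \<omega> = (\<Sum>b\<in>Basis. \<bar>ssup b (X \<omega>)\<bar> + \<bar>ssup (- b) (X \<omega>)\<bar>)" for \<omega>
  have gi: "integrable M g" unfolding g_def using i by auto
  have "(\<integral>\<^sup>+\<omega>. set_norm (X \<omega>) \<partial>M) \<le> (\<integral>\<^sup>+\<omega>. ennreal (g \<omega>) \<partial>M)"
  proof (rule nn_integral_mono_AE)
    show "AE \<omega> in M. set_norm (X \<omega>) \<le> ennreal (g \<omega>)"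
      using b
    proof eventually_elim
      case (elim \<omega>)
      then show ?case unfolding set_norm_def g_def
        by (intro SUP_least ennreal_leI norm_le_sum_ssup)
    qed
  qed
  also have "\<dots> < \<infinity>"
    using nn_integral_eq_integral[OF gi] by (simp add: g_def sum_nonneg)
  finally show ?thesis by (simp add: integrably_bounded_def)
qed

locale regular_set_submartingale = prob_space P for P :: "'w measure" +
  fixes F :: "real \<Rightarrow> 'w measure" and M :: "real \<Rightarrow> 'w \<Rightarrow> 'b::euclidean_space set"
    and \<Omega>' :: "'w set" and W :: "'b set"
  assumes filtration: "filtration_of P F"
    and augmented: "augmented_filtration P F"
    and left_cont: "left_continuous_filtration P F"
    and W: "countable W" "cball 0 1 \<subseteq> closure W"
    and submart: "set_submartingale P F M"
    and convex_M: "convex_process P M"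
    and bounded_M: "integrably_bounded_process P M"
    and regular: "regularity_event P M \<Omega>'"
begin

abbreviation "Mm \<equiv> left_limit_process \<Omega>' M"

lemma subalg_F: "t \<ge> 0 \<Longrightarrow> subalgebra P (F t)"
  using filtration by (simp add: filtration_of_def)

lemma subalg_F_mono: "0 \<le> s \<Longrightarrow> s \<le> t \<Longrightarrow> subalgebra (F t) (F s)"
  using filtration by (simp add: filtration_of_def)

lemma space_F: "t \<ge> 0 \<Longrightarrow> space (F t) = space P"
  using subalg_F by (simp add: subalgebra_def)

lemma sets_F_subset: "t \<ge> 0 \<Longrightarrow> sets (F t) \<subseteq> sets P"
  using subalg_F by (simp add: subalgebra_def)

lemma sets_F_mono: "0 \<le> s \<Longrightarrow> s \<le> t \<Longrightarrow> sets (F s) \<subseteq> sets (F t)"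
  using subalg_F_mono by (simp add: subalgebra_def)

lemma finite_measure_subalgebra_F: "t \<ge> 0 \<Longrightarrow> finite_measure_subalgebra P (F t)"
  using subalg_F by unfold_locales

lemma random_closed_set_M: "t \<ge> 0 \<Longrightarrow> random_closed_set (F t) (M t)"
  using submart by (simp add: set_submartingale_def adapted_set_process_def)

lemma random_closed_set_M_P: "t \<ge> 0 \<Longrightarrow> random_closed_set P (M t)"
  using random_closed_set_subalgebra[OF random_closed_set_M subalg_F] .

lemma integrably_bounded_M: "t \<ge> 0 \<Longrightarrow> integrably_bounded P (M t)"
  using bounded_M by (simp add: integrably_bounded_process_def)

text \<open>A near-maximal selection of \<open>M s\<close> is almost surely a selection of the
  conditional expectation of \<open>M t\<close>, to which \<open>set_integral_inner_le_ssup\<close>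
  applies.\<close>

lemma set_integral_ssup_M_mono:
  assumes st: "0 \<le> s" "s \<le> t" and A: "A \<in> sets (F s)"
  shows "(LINT \<omega>:A|P. ssup u (M s \<omega>)) \<le> (LINT \<omega>:A|P. ssup u (M t \<omega>))"
proof (rule field_le_epsilon)
  fix e :: real assume e: "e > 0"
  interpret S: finite_measure_subalgebra P "F s" using finite_measure_subalgebra_F st by simp
  have t0: "0 \<le> t" using st by simp
  obtain Y where Y: "is_set_cond_exp P (F s) (M t) Y" "AE \<omega> in P. M s \<omega> \<subseteq> Y \<omega>"
    using submart st unfolding set_submartingale_def by blast
  obtain \<eta> where \<eta>: "\<eta> \<in> borel_measurable (F s)" "\<And>\<omega>. \<omega> \<in> space (F s) \<Longrightarrow> \<eta> \<omega> \<in> M s \<omega>"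
    "\<And>\<omega>. \<omega> \<in> space (F s) \<Longrightarrow> bounded (M s \<omega>) \<Longrightarrow> ssup u (M s \<omega>) - e < u \<bullet> \<eta> \<omega>"
    using near_max_selection[OF random_closed_set_M[OF st(1)] e] by metis
  have "AE \<omega> in P. \<eta> \<omega> \<in> M s \<omega>" using \<eta>(2) space_F[OF st(1)] by auto
  then have "\<eta> \<in> selections1 P (F s) (M s)"
    using \<eta>(1) by (intro selections1I[OF random_closed_set_M_P[OF st(1)] integrably_bounded_M[OF st(1)] subalg_F[OF st(1)]])
  then have \<eta>i: "integrable P \<eta>" and \<eta>Y: "\<eta> \<in> selections1 P (F s) Y"
    using Y(2) by (auto simp: selections1_def elim: AE_mp)
  have AP: "A \<in> sets P" using A sets_F_subset st by blast
  have "(LINT \<omega>:A|P. ssup u (M s \<omega>)) \<le> (LINT \<omega>:A|P. u \<bullet> \<eta> \<omega> + e)"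
  proof (rule set_integral_mono_AE)
    show "AE \<omega>\<in>A in P. ssup u (M s \<omega>) \<le> u \<bullet> \<eta> \<omega> + e"
      using integrably_bounded_AE_bounded[OF random_closed_set_M_P integrably_bounded_M, OF st(1) st(1)] AE_space
      by eventually_elim (use \<eta>(3) space_F[OF st(1)] in force)
  qed (use \<eta>i integrable_ssup[OF random_closed_set_M_P integrably_bounded_M] st A in \<open>auto intro!: S.set_integrable_of_integrable\<close>)
  also have "\<dots> = (LINT \<omega>:A|P. u \<bullet> \<eta> \<omega>) + (LINT \<omega>:A|P. e)"
    using \<eta>i A by (intro set_integral_add(2)) (auto intro!: S.set_integrable_of_integrable)
  also have "(LINT \<omega>:A|P. e) = measure P A * e"
    using AP by (simp add: set_lebesgue_integral_def)
  \<comment> \<open>The total mass is \<open>1\<close>, so the constant error integrates to at most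
    \<open>e\<close> over any event.\<close>
  also have "\<dots> \<le> e" using e by (simp add: mult_left_le_one_le)
  also have "(LINT \<omega>:A|P. u \<bullet> \<eta> \<omega>) \<le> (LINT \<omega>:A|P. ssup u (M t \<omega>))"
    by (rule S.set_integral_inner_le_ssup[OF random_closed_set_M_P[OF t0] integrably_bounded_M[OF t0] Y(1) \<eta>Y A])
  finally show "(LINT \<omega>:A|P. ssup u (M s \<omega>)) \<le> (LINT \<omega>:A|P. ssup u (M t \<omega>)) + e" by simp
qed

text \<open>With equality of the sets the roles can be exchanged: a near-maximal selection of the
  conditional expectation lies in \<open>M s\<close>.\<close>

lemma set_integral_ssup_M_antimono:
  assumes mart: "set_martingale P F M" and st: "0 \<le> s" "s \<le> t" and A: "A \<in> sets (F s)"
  shows "(LINT \<omega>:A|P. ssup u (M t \<omega>)) \<le> (LINT \<omega>:A|P. ssup u (M s \<omega>))"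
proof (rule field_le_epsilon)
  fix e :: real assume e: "e > 0"
  interpret S: finite_measure_subalgebra P "F s" using finite_measure_subalgebra_F st by simp
  have t0: "0 \<le> t" using st by simp
  obtain Y where Y: "is_set_cond_exp P (F s) (M t) Y" "AE \<omega> in P. M s \<omega> = Y \<omega>"
    using mart st unfolding set_martingale_def by blast
  obtain \<eta> where \<eta>: "\<eta> \<in> selections1 P (F s) Y"
    "\<And>A. A \<in> sets (F s) \<Longrightarrow> (LINT \<omega>:A|P. ssup u (M t \<omega>)) \<le> (LINT \<omega>:A|P. u \<bullet> \<eta> \<omega> + e)"
    using S.near_max_cond_exp_selection[OF random_closed_set_M_P[OF t0] integrably_bounded_M[OF t0] Y(1) e] by metis
  have \<eta>i: "integrable P \<eta>" "AE \<omega> in P. \<eta> \<omega> \<in> Y \<omega>" using \<eta>(1) by (auto simp: selections1_def)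
  have AP: "A \<in> sets P" using A sets_F_subset st by blast
  have "(LINT \<omega>:A|P. ssup u (M t \<omega>)) \<le> (LINT \<omega>:A|P. u \<bullet> \<eta> \<omega> + e)" by (rule \<eta>(2)[OF A])
  also have "\<dots> = (LINT \<omega>:A|P. u \<bullet> \<eta> \<omega>) + (LINT \<omega>:A|P. e)"
    using \<eta>i A by (intro set_integral_add(2)) (auto intro!: S.set_integrable_of_integrable)
  also have "(LINT \<omega>:A|P. e) = measure P A * e"
    using AP by (simp add: set_lebesgue_integral_def)
  also have "\<dots> \<le> e" using e by (simp add: mult_left_le_one_le)
  also have "(LINT \<omega>:A|P. u \<bullet> \<eta> \<omega>) \<le> (LINT \<omega>:A|P. ssup u (M s \<omega>))"
  proof (rule set_integral_mono_AE)
    show "AE \<omega>\<in>A in P. u \<bullet> \<eta> \<omega> \<le> ssup u (M s \<omega>)"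
      using integrably_bounded_AE_bounded[OF random_closed_set_M_P integrably_bounded_M, OF st(1) st(1)] \<eta>i(2) Y(2)
      by eventually_elim (auto intro: ssup_upper)
  qed (use \<eta>i integrable_ssup[OF random_closed_set_M_P integrably_bounded_M] st A in \<open>auto intro!: S.set_integrable_of_integrable\<close>)
  finally show "(LINT \<omega>:A|P. ssup u (M t \<omega>)) \<le> (LINT \<omega>:A|P. ssup u (M s \<omega>)) + e" by simp
qed

lemma regular_sets: "\<Omega>' \<in> sets P" and AE_regular: "AE \<omega> in P. \<omega> \<in> \<Omega>'"
  using regular prob_eq_1[of \<Omega>'] by (auto simp: regularity_event_def)

lemma regular_space: "\<omega> \<in> \<Omega>' \<Longrightarrow> \<omega> \<in> space P"
  using sets.sets_into_space[OF regular_sets] by blast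

text \<open>The complement is null and belongs to \<open>F 0\<close> by augmentation. Since the left
  limits are set to \<open>{0}\<close> off this event, their adaptedness rests on it.\<close>

lemma regular_sets_F:
  assumes "t \<ge> 0" shows "\<Omega>' \<in> sets (F t)"
proof -
  have "space P - \<Omega>' \<in> null_sets P"
    using AE_regular regular_sets by (intro AE_iff_null_sets[THEN iffD2]) (auto elim: AE_mp)
  then have "space P - \<Omega>' \<in> sets (F 0)" using augmented by (auto simp: augmented_filtration_def)
  then have "space P - \<Omega>' \<in> sets (F t)" using sets_F_mono[of 0 t] assms by auto
  then have "space (F t) - (space P - \<Omega>') \<in> sets (F t)" by (rule sets.compl_sets)
  moreover have "space (F t) - (space P - \<Omega>') = \<Omega>'"
    using space_F[OF assms] sets.sets_into_space[OF regular_sets] by auto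
  ultimately show ?thesis by simp
qed

section \<open>The left limits as random closed sets\<close>

lemma M_nonempty: "t \<ge> 0 \<Longrightarrow> \<omega> \<in> space P \<Longrightarrow> M t \<omega> \<noteq> {}"
  using random_closed_setD[OF random_closed_set_M_P] by blast

text \<open>The definite description in \<open>hausdorff_lim\<close> is resolved by uniqueness of
  Hausdorff limits, which is available for nonempty approximating sets because
  \<open>infdist\<close> from an empty set is \<open>0\<close>.\<close>

lemma left_limit:
  assumes \<omega>: "\<omega> \<in> \<Omega>'" and t: "t > 0"
  shows "hausdorff_tendsto (\<lambda>r. M r \<omega>) (Mm t \<omega>) (rat_left t)" "compact (Mm t \<omega>)" "convex (Mm t \<omega>)"
proof -
  obtain L where L: "compact L" "convex L" "hausdorff_tendsto (\<lambda>r. M r \<omega>) L (rat_left t)"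
    using regular \<omega> t unfolding regularity_event_def by blast
  have "\<forall>\<^sub>F r in rat_left t. M r \<omega> \<noteq> {}"
    using rat_left_ge[OF t t] by eventually_elim (use M_nonempty regular_space[OF \<omega>] in auto)
  then have "hausdorff_lim (rat_left t) (\<lambda>r. M r \<omega>) = L"
    by (rule hausdorff_lim_eq[OF L(3) rat_left_nontriv[OF t]])
  then have "Mm t \<omega> = L" using \<omega> t by (simp add: left_limit_process_def)
  with L show "hausdorff_tendsto (\<lambda>r. M r \<omega>) (Mm t \<omega>) (rat_left t)" "compact (Mm t \<omega>)" "convex (Mm t \<omega>)"
    by auto
qed

lemma Mm_0 [simp]: "Mm 0 \<omega> = M 0 \<omega>"
  by (simp add: left_limit_process_def)

lemma Mm_irregular: "\<omega> \<notin> \<Omega>' \<Longrightarrow> t > 0 \<Longrightarrow> Mm t \<omega> = {0}"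
  by (simp add: left_limit_process_def)

lemma Mm_compact_convex:
  assumes "t > 0" shows "compact (Mm t \<omega>)" "convex (Mm t \<omega>)" "Mm t \<omega> \<noteq> {}"
  using left_limit[of \<omega> t] Mm_irregular[of \<omega> t] assms
  by (cases "\<omega> \<in> \<Omega>'"; auto simp: hausdorff_tendsto_def)+

lemma eventually_M_nonempty:
  "\<omega> \<in> \<Omega>' \<Longrightarrow> t > 0 \<Longrightarrow> \<forall>\<^sub>F r in rat_left t. M r \<omega> \<noteq> {}"
  using rat_left_ge[of t 0] M_nonempty[OF _ regular_space] by (auto elim!: eventually_mono)

lemma random_closed_set_Mm:
  assumes t: "t \<ge> 0" shows "random_closed_set (F t) (Mm t)"
proof (cases "t = 0")
  case True
  then show ?thesis using random_closed_set_M[of 0] by (simp add: left_limit_process_def[abs_def])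
next
  case False
  then have t0: "t > 0" using t by simp
  obtain r where r: "\<And>n. r n \<in> \<rat>" "\<And>n. 0 < r n" "\<And>n. r n < t" "filterlim r (rat_left t) sequentially"
    using left_sequence_rat[OF t0] by metis
  have [measurable]: "\<Omega>' \<in> sets (F t)" by (rule regular_sets_F[OF t])
  show ?thesis
  proof (rule random_closed_setI)
    fix c
    have [measurable]: "(\<lambda>\<omega>. infdist c (M (r n) \<omega>)) \<in> borel_measurable (F t)" for n
      using measurable_from_subalg[OF subalg_F_mono borel_measurable_infdist_random_closed_set[OF random_closed_set_M]]
        r(2,3)[of n] by (simp add: less_imp_le)
    show "(\<lambda>\<omega>. infdist c (Mm t \<omega>)) \<in> borel_measurable (F t)"
    proof (rule borel_measurable_LIMSEQ_real)
      fix \<omega> :: 'w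
      \<comment> \<open>Off \<open>\<Omega>'\<close> the left limit is \<open>{0}\<close>, so the
        approximating distances are replaced by the constant distance from that set. All of them are
        measurable in \<open>F t\<close>, as \<open>r n < t\<close>.\<close>
      show "(\<lambda>n. if \<omega> \<in> \<Omega>' then infdist c (M (r n) \<omega>) else infdist c {0}) \<longlonglongrightarrow> infdist c (Mm t \<omega>)"
      proof (cases "\<omega> \<in> \<Omega>'")
        case True
        have "((\<lambda>r. infdist c (M r \<omega>)) \<longlongrightarrow> infdist c (Mm t \<omega>)) (rat_left t)"
          by (rule tendsto_infdist_hausdorff[OF left_limit(1) eventually_M_nonempty]) fact+
        then show ?thesis using filterlim_compose[OF _ r(4)] True by simp
      qed (simp add: Mm_irregular t0)
    qed measurable
  qed (use Mm_compact_convex[OF t0] in \<open>auto intro: compact_imp_closed\<close>)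
qed

lemma random_closed_set_Mm_P: "t \<ge> 0 \<Longrightarrow> random_closed_set P (Mm t)"
  using random_closed_set_subalgebra[OF random_closed_set_Mm subalg_F] .

text \<open>\<open>K\<close> depends on \<open>u\<close>, \<open>t\<close> and \<open>e\<close> but
  not on \<open>s\<close>, which is the uniformity required by Vitali's theorem. The modulus exceeds
  \<open>K\<close> only if one of the two directions does, and each excess has its integral bounded
  by the one at time \<open>t\<close>.\<close>

lemma excess_M_le:
  assumes t: "t \<ge> 0" and e: "e > 0"
  obtains K where "K \<ge> 0"
    "\<And>s. 0 \<le> s \<Longrightarrow> s \<le> t \<Longrightarrow> (LINT \<omega>|P. max 0 (\<bar>ssup u (M s \<omega>)\<bar> - K)) \<le> e"
proof -
  have i: "integrable P (\<lambda>\<omega>. ssup v (M s \<omega>))" if "s \<ge> 0" for s v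
    using integrable_ssup[OF random_closed_set_M_P integrably_bounded_M] that by blast
  obtain K1 where K1: "\<And>K. K \<ge> K1 \<Longrightarrow> (LINT \<omega>|P. max 0 (ssup u (M t \<omega>) - K)) \<le> e / 2"
    using ex_integral_excess_le[OF i[OF t], of "e / 2" u] e by auto
  obtain K2 where K2: "\<And>K. K \<ge> K2 \<Longrightarrow> (LINT \<omega>|P. max 0 (ssup (- u) (M t \<omega>) - K)) \<le> e / 2"
    using ex_integral_excess_le[OF i[OF t], of "e / 2" "- u"] e by auto
  define K where "K = Max {0, K1, K2}"
  have K: "K \<ge> 0" "K \<ge> K1" "K \<ge> K2" by (auto simp: K_def)
  have "(LINT \<omega>|P. max 0 (\<bar>ssup u (M s \<omega>)\<bar> - K)) \<le> e" if s: "0 \<le> s" "s \<le> t" for s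
  proof -
    have ex: "(LINT \<omega>|P. max 0 (ssup v (M s \<omega>) - K)) \<le> (LINT \<omega>|P. max 0 (ssup v (M t \<omega>) - K))" for v
      by (rule integral_excess_mono[OF subalg_F[OF s(1)] i[OF s(1)]
        borel_measurable_ssup[OF random_closed_set_M[OF s(1)]] i[OF t] set_integral_ssup_M_mono[OF s]])
    have mi: "integrable P (\<lambda>\<omega>. max 0 (ssup v (M s \<omega>) - K))" for v
      using i[OF s(1)] by (intro integrable_max) auto
    have "(LINT \<omega>|P. max 0 (\<bar>ssup u (M s \<omega>)\<bar> - K)) \<le>
       (LINT \<omega>|P. max 0 (ssup u (M s \<omega>) - K) + max 0 (ssup (- u) (M s \<omega>) - K))"
    proof (rule integral_mono_AE)
      show "AE \<omega> in P. max 0 (\<bar>ssup u (M s \<omega>)\<bar> - K) \<le>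
          max 0 (ssup u (M s \<omega>) - K) + max 0 (ssup (- u) (M s \<omega>) - K)"
        using integrably_bounded_AE_bounded[OF random_closed_set_M_P integrably_bounded_M, OF s(1) s(1)] AE_space
      proof eventually_elim
        case (elim \<omega>)
        obtain x where x: "x \<in> M s \<omega>" using M_nonempty[OF s(1) elim(2)] by auto
        have "- ssup u (M s \<omega>) \<le> ssup (- u) (M s \<omega>)"
          using ssup_upper[OF elim(1) x, of u] ssup_upper[OF elim(1) x, of "- u"] by simp
        then show ?case by (auto simp: max_def abs_if)
      qed
      show "integrable P (\<lambda>\<omega>. max 0 (\<bar>ssup u (M s \<omega>)\<bar> - K))"
        using i[OF s(1)] by (intro integrable_max) auto
    qed (use mi in auto)
    also have "\<dots> = (LINT \<omega>|P. max 0 (ssup u (M s \<omega>) - K)) + (LINT \<omega>|P. max 0 (ssup (- u) (M s \<omega>) - K))"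
      using mi by simp
    also have "\<dots> \<le> e" using ex[of u] ex[of "- u"] K1[OF K(2)] K2[OF K(3)] by simp
    finally show ?thesis .
  qed
  with K(1) that show thesis by blast
qed

lemma ssup_Mm_limit:
  assumes t: "t > 0" and r: "\<And>n. 0 < r n" "\<And>n. r n < t" "filterlim r (rat_left t) sequentially"
  shows "integrable P (\<lambda>\<omega>. ssup u (Mm t \<omega>))"
    and "A \<in> sets P \<Longrightarrow> (\<lambda>n. LINT \<omega>:A|P. ssup u (M (r n) \<omega>)) \<longlonglongrightarrow> (LINT \<omega>:A|P. ssup u (Mm t \<omega>))"
proof -
  have i: "integrable P (\<lambda>\<omega>. ssup u (M (r n) \<omega>))" for n
    using integrable_ssup[OF random_closed_set_M_P integrably_bounded_M] r(1)[of n] by simp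
  have m: "(\<lambda>\<omega>. ssup u (Mm t \<omega>)) \<in> borel_measurable P"
    using t by (intro borel_measurable_ssup random_closed_set_Mm_P) simp
  have lim: "AE \<omega> in P. (\<lambda>n. ssup u (M (r n) \<omega>)) \<longlonglongrightarrow> ssup u (Mm t \<omega>)"
    using AE_regular
  proof eventually_elim
    case (elim \<omega>)
    have "((\<lambda>r. ssup u (M r \<omega>)) \<longlongrightarrow> ssup u (Mm t \<omega>)) (rat_left t)"
      using left_limit[OF elim t] eventually_M_nonempty[OF elim t]
      by (intro tendsto_ssup compact_imp_bounded)
    then show ?case by (rule filterlim_compose[OF _ r(3)])
  qed
  have ui: "\<exists>K\<ge>0. \<forall>n. (LINT \<omega>|P. max 0 (\<bar>ssup u (M (r n) \<omega>)\<bar> - K)) \<le> e" if "e > 0" for e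
    using excess_M_le[OF less_imp_le[OF t] that, of u] r(1,2) by (metis less_imp_le)
  show "integrable P (\<lambda>\<omega>. ssup u (Mm t \<omega>))"
    by (rule tendsto_set_integral_if_uniformly_integrable(1)[OF i m lim ui])
  show "A \<in> sets P \<Longrightarrow> (\<lambda>n. LINT \<omega>:A|P. ssup u (M (r n) \<omega>)) \<longlonglongrightarrow> (LINT \<omega>:A|P. ssup u (Mm t \<omega>))"
    by (rule tendsto_set_integral_if_uniformly_integrable(2)[OF i m lim ui])
qed

text \<open>The norms of the approximating sets need not have a common integrable majorant, so the
  bound comes from the support functions of the limit, whose integrability is already known.\<close>

lemma integrably_bounded_Mm:
  assumes "t \<ge> 0" shows "integrably_bounded P (Mm t)"
proof (cases "t = 0")
  case True
  then show ?thesis using integrably_bounded_M[of 0] by (simp add: left_limit_process_def[abs_def])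
next
  case False
  then have t: "t > 0" using assms by simp
  obtain r where r: "\<And>n. r n \<in> \<rat>" "\<And>n. 0 < r n" "\<And>n. r n < t" "filterlim r (rat_left t) sequentially"
    using left_sequence_rat[OF t] by metis
  show ?thesis
    using ssup_Mm_limit(1)[OF t r(2,3,4)] Mm_compact_convex[OF t]
    by (intro integrably_boundedI_ssup) (auto intro: compact_imp_bounded)
qed

lemma integrable_ssup_Mm: "t \<ge> 0 \<Longrightarrow> integrable P (\<lambda>\<omega>. ssup u (Mm t \<omega>))"
  using integrable_ssup[OF random_closed_set_Mm_P integrably_bounded_Mm] .

lemma AE_convex_Mm: "t \<ge> 0 \<Longrightarrow> AE \<omega> in P. convex (Mm t \<omega>)"
  using convex_M Mm_compact_convex(2)[of t]
  by (cases "t = 0") (auto simp: convex_process_def)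

section \<open>From events before \<open>t\<close> to events of \<open>F t\<close>\<close>

lemma sets_F_left_limit:
  assumes t: "t > 0"
  shows "algebra (space P) (\<Union>r\<in>{0..<t}. sets (F r))"
    "sets (F t) = sigma_sets (space P) (\<Union>r\<in>{0..<t}. sets (F r))"
proof -
  show "sets (F t) = sigma_sets (space P) (\<Union>r\<in>{0..<t}. sets (F r))"
    using left_cont t by (simp add: left_continuous_filtration_def)
  show "algebra (space P) (\<Union>r\<in>{0..<t}. sets (F r))"
    unfolding algebra_iff_Un
  proof (intro conjI ballI)
    show "(\<Union>r\<in>{0..<t}. sets (F r)) \<subseteq> Pow (space P)"
      using sets.space_closed space_F by fastforce
    show "{} \<in> (\<Union>r\<in>{0..<t}. sets (F r))" using t by (auto intro!: bexI[of _ 0])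
  next
    fix A assume "A \<in> (\<Union>r\<in>{0..<t}. sets (F r))"
    then obtain r where r: "0 \<le> r" "r < t" "A \<in> sets (F r)" by auto
    then have "space P - A \<in> sets (F r)" using sets.compl_sets[of A "F r"] space_F by simp
    with r show "space P - A \<in> (\<Union>r\<in>{0..<t}. sets (F r))" by auto
  next
    fix A B assume "A \<in> (\<Union>r\<in>{0..<t}. sets (F r))" "B \<in> (\<Union>r\<in>{0..<t}. sets (F r))"
    then obtain r s where rs: "0 \<le> r" "r < t" "A \<in> sets (F r)" "0 \<le> s" "s < t" "B \<in> sets (F s)" by auto
    \<comment> \<open>Both events are known at the later of the two times, which is still before
      \<open>t\<close>. A countable union may involve times tending to \<open>t\<close>, so only an
      algebra results.\<close>
    then have "A \<in> sets (F (max r s))" "B \<in> sets (F (max r s))"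
      using sets_F_mono[of r "max r s"] sets_F_mono[of s "max r s"] by auto
    then have "A \<union> B \<in> sets (F (max r s))" by (rule sets.Un)
    moreover have "max r s \<in> {0..<t}" using rs by auto
    ultimately show "A \<union> B \<in> (\<Union>r\<in>{0..<t}. sets (F r))" by blast
  qed
qed

text \<open>Inequalities tested on events strictly before \<open>t\<close> reach \<open>F t\<close>
  through the generating algebra, applied to the difference \<open>g - f\<close>.\<close>

lemma set_integral_le_left_limit:
  fixes f g :: "'w \<Rightarrow> real"
  assumes t: "t > 0" and f: "integrable P f" and g: "integrable P g"
    and le: "\<And>s A. 0 \<le> s \<Longrightarrow> s < t \<Longrightarrow> A \<in> sets (F s) \<Longrightarrow> (LINT \<omega>:A|P. f \<omega>) \<le> (LINT \<omega>:A|P. g \<omega>)"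
    and A: "A \<in> sets (F t)"
  shows "(LINT \<omega>:A|P. f \<omega>) \<le> (LINT \<omega>:A|P. g \<omega>)"
proof -
  have sub: "(\<Union>r\<in>{0..<t}. sets (F r)) \<subseteq> sets P" by (intro UN_least sets_F_subset) simp
  have si: "set_integrable P B f" "set_integrable P B g" if "B \<in> sets P" for B
    unfolding set_integrable_def using integrable_mult_indicator[OF that f] integrable_mult_indicator[OF that g] by auto
  have "0 \<le> (LINT \<omega>:A|P. g \<omega> - f \<omega>)"
  proof (rule set_integral_nonneg_sigma_sets[OF _ sets_F_left_limit(1)[OF t] sub])
    fix B assume "B \<in> (\<Union>r\<in>{0..<t}. sets (F r))"
    then obtain s where s: "0 \<le> s" "s < t" "B \<in> sets (F s)" by auto
    then have "B \<in> sets P" using sets_F_subset by blast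
    then show "0 \<le> (LINT \<omega>:B|P. g \<omega> - f \<omega>)" using le[OF s] si by (simp add: set_integral_diff)
  qed (use f g A sets_F_left_limit(2)[OF t] in auto)
  moreover have "A \<in> sets P" using A sets_F_subset[of t] t by auto
  ultimately show ?thesis using si by (simp add: set_integral_diff)
qed

lemma set_integral_ssup_Mm_le_M:
  assumes t: "t > 0" and A: "A \<in> sets (F t)"
  shows "(LINT \<omega>:A|P. ssup u (Mm t \<omega>)) \<le> (LINT \<omega>:A|P. ssup u (M t \<omega>))"
proof (rule set_integral_le_left_limit[OF t _ _ _ A])
  obtain r where r: "\<And>n. r n \<in> \<rat>" "\<And>n. 0 < r n" "\<And>n. r n < t" "filterlim r (rat_left t) sequentially"
    using left_sequence_rat[OF t] by metis
  fix s A assume s: "0 \<le> s" "s < t" "A \<in> sets (F s)"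
  have AP: "A \<in> sets P" using sets_F_subset s by blast
  show "(LINT \<omega>:A|P. ssup u (Mm t \<omega>)) \<le> (LINT \<omega>:A|P. ssup u (M t \<omega>))"
  proof (rule tendsto_upperbound[OF ssup_Mm_limit(2)[OF t r(2,3,4) AP]])
    \<comment> \<open>The submartingale inequality between \<open>r n\<close> and \<open>t\<close>
      needs \<open>A\<close> to be an event at time \<open>r n\<close>, hence \<open>r n\<close>
      beyond \<open>s\<close>; as \<open>r n\<close> tends to \<open>t\<close>, this excludes at
      most finitely many \<open>n\<close>.\<close>
    have "\<forall>\<^sub>F n in sequentially. s < r n"
      using filterlim_iff[THEN iffD1, OF r(4), rule_format, OF rat_left_ge[OF t s(2)]]
      by eventually_elim simp
    then show "\<forall>\<^sub>F n in sequentially. (LINT \<omega>:A|P. ssup u (M (r n) \<omega>)) \<le> (LINT \<omega>:A|P. ssup u (M t \<omega>))"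
    proof eventually_elim
      case (elim n)
      have "A \<in> sets (F (r n))" using sets_F_mono[of s "r n"] s elim by auto
      then show ?case using r(2,3)[of n] by (intro set_integral_ssup_M_mono) auto
    qed
  qed simp
qed (use t integrable_ssup_Mm integrable_ssup[OF random_closed_set_M_P integrably_bounded_M] in auto)

lemma set_integral_ssup_M_le_Mm:
  assumes st: "0 \<le> s" "s < t" and A: "A \<in> sets (F s)"
  shows "(LINT \<omega>:A|P. ssup u (M s \<omega>)) \<le> (LINT \<omega>:A|P. ssup u (Mm t \<omega>))"
proof -
  have t: "t > 0" using st by simp
  obtain r where r: "\<And>n. r n \<in> \<rat>" "\<And>n. 0 < r n" "\<And>n. r n < t" "filterlim r (rat_left t) sequentially"
    using left_sequence_rat[OF t] by metis
  have AP: "A \<in> sets P" using sets_F_subset st A by blast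
  show ?thesis
  proof (rule tendsto_lowerbound[OF ssup_Mm_limit(2)[OF t r(2,3,4) AP]])
    have "\<forall>\<^sub>F n in sequentially. s < r n"
      using filterlim_iff[THEN iffD1, OF r(4), rule_format, OF rat_left_ge[OF t st(2)]]
      by eventually_elim simp
    then show "\<forall>\<^sub>F n in sequentially. (LINT \<omega>:A|P. ssup u (M s \<omega>)) \<le> (LINT \<omega>:A|P. ssup u (M (r n) \<omega>))"
      by eventually_elim (use st A in \<open>auto intro: set_integral_ssup_M_mono\<close>)
  qed simp
qed

text \<open>Between two left limits stands the original process: the value at \<open>s\<close>
  dominates its left limit and is dominated by the left limit at a strictly later \<open>t\<close>.
  The case \<open>s = t\<close> is therefore separate.\<close>

lemma set_integral_ssup_Mm_mono:
  assumes st: "0 \<le> s" "s \<le> t" and A: "A \<in> sets (F s)"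
  shows "(LINT \<omega>:A|P. ssup u (Mm s \<omega>)) \<le> (LINT \<omega>:A|P. ssup u (Mm t \<omega>))"
proof (cases "s = t")
  case False
  then have "s < t" using st by simp
  have "(LINT \<omega>:A|P. ssup u (Mm s \<omega>)) \<le> (LINT \<omega>:A|P. ssup u (M s \<omega>))"
    using set_integral_ssup_Mm_le_M[OF _ A] st by (cases "s = 0") auto
  also have "\<dots> \<le> (LINT \<omega>:A|P. ssup u (Mm t \<omega>))"
    by (rule set_integral_ssup_M_le_Mm) fact+
  finally show ?thesis .
qed simp

lemma set_integral_ssup_M_le_Mm_if_martingale:
  assumes mart: "set_martingale P F M" and t: "t > 0" and A: "A \<in> sets (F t)"
  shows "(LINT \<omega>:A|P. ssup u (M t \<omega>)) \<le> (LINT \<omega>:A|P. ssup u (Mm t \<omega>))"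
proof (rule set_integral_le_left_limit[OF t _ _ _ A])
  fix s A assume s: "0 \<le> s" "s < t" "A \<in> sets (F s)"
  have "(LINT \<omega>:A|P. ssup u (M t \<omega>)) \<le> (LINT \<omega>:A|P. ssup u (M s \<omega>))"
    using s by (intro set_integral_ssup_M_antimono[OF mart]) auto
  also have "\<dots> \<le> (LINT \<omega>:A|P. ssup u (Mm t \<omega>))"
    by (rule set_integral_ssup_M_le_Mm) fact+
  finally show "(LINT \<omega>:A|P. ssup u (M t \<omega>)) \<le> (LINT \<omega>:A|P. ssup u (Mm t \<omega>))" .
qed (use t integrable_ssup_Mm integrable_ssup[OF random_closed_set_M_P integrably_bounded_M] in auto)

text \<open>The left limit at \<open>t\<close> lies below \<open>M t\<close>, the martingale
  property leads back to \<open>M s\<close>, and for a martingale \<open>M s\<close> does not exceed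
  its own left limit.\<close>

lemma set_integral_ssup_Mm_antimono:
  assumes mart: "set_martingale P F M" and st: "0 \<le> s" "s \<le> t" and A: "A \<in> sets (F s)"
  shows "(LINT \<omega>:A|P. ssup u (Mm t \<omega>)) \<le> (LINT \<omega>:A|P. ssup u (Mm s \<omega>))"
proof -
  have At: "A \<in> sets (F t)" using sets_F_mono[OF st] A by blast
  have "(LINT \<omega>:A|P. ssup u (Mm t \<omega>)) \<le> (LINT \<omega>:A|P. ssup u (M t \<omega>))"
    using set_integral_ssup_Mm_le_M[OF _ At] st by (cases "t = 0") auto
  also have "\<dots> \<le> (LINT \<omega>:A|P. ssup u (M s \<omega>))"
    by (rule set_integral_ssup_M_antimono[OF mart st A])
  also have "\<dots> \<le> (LINT \<omega>:A|P. ssup u (Mm s \<omega>))"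
    using set_integral_ssup_M_le_Mm_if_martingale[OF mart _ A] st by (cases "s = 0") auto
  finally show ?thesis .
qed

section \<open>Inclusion in \<open>M t\<close> and the criterion for equality\<close>

lemma AE_ssup_Mm_le_M:
  assumes t: "t > 0" shows "AE \<omega> in P. ssup u (Mm t \<omega>) \<le> ssup u (M t \<omega>)"
proof -
  have t': "t \<ge> 0" using t by simp
  show ?thesis
    by (rule AE_le_if_set_integral_le[OF subalg_F[OF t'] integrable_ssup_Mm[OF t']
      borel_measurable_ssup[OF random_closed_set_Mm[OF t']] integrable_ssup[OF random_closed_set_M_P integrably_bounded_M, OF t' t']
      borel_measurable_ssup[OF random_closed_set_M[OF t']] set_integral_ssup_Mm_le_M[OF t]])
qed

lemma AE_compact_convex_M:
  "t \<ge> 0 \<Longrightarrow> AE \<omega> in P. compact (M t \<omega>) \<and> convex (M t \<omega>) \<and> M t \<omega> \<noteq> {}"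
proof -
  assume t: "t \<ge> 0"
  have "AE \<omega> in P. convex (M t \<omega>)" using convex_M t by (simp add: convex_process_def)
  with integrably_bounded_AE_bounded[OF random_closed_set_M_P[OF t] integrably_bounded_M[OF t]] AE_space show ?thesis
    by eventually_elim (use random_closed_setD[OF random_closed_set_M_P[OF t]] in \<open>auto simp: compact_eq_bounded_closed\<close>)
qed

lemma AE_Mm_subset_M:
  assumes t: "t > 0" shows "AE \<omega> in P. Mm t \<omega> \<subseteq> M t \<omega>"
proof -
  have "AE \<omega> in P. \<forall>u\<in>W. ssup u (Mm t \<omega>) \<le> ssup u (M t \<omega>)"
    unfolding AE_ball_countable[OF W(1)] using AE_ssup_Mm_le_M[OF t] by blast
  with AE_compact_convex_M[OF less_imp_le[OF t]] show ?thesis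
  proof eventually_elim
    case (elim \<omega>)
    show ?case
      by (rule subset_if_ssup_le[OF _ _ _ W(2)])
        (use elim compact_imp_bounded[OF Mm_compact_convex(1)[OF t]] in simp_all)
  qed
qed

text \<open>An almost surely nonnegative difference with zero integral vanishes, which upgrades
  equality of integrals to equality of support functions on \<open>W\<close>, hence of compact
  convex sets.\<close>

lemma AE_Mm_eq_M_iff:
  assumes t: "t > 0"
  shows "(AE \<omega> in P. Mm t \<omega> = M t \<omega>) \<longleftrightarrow>
    (\<forall>u\<in>W. (LINT \<omega>|P. ssup u (Mm t \<omega>)) = (LINT \<omega>|P. ssup u (M t \<omega>)))" (is "?L \<longleftrightarrow> ?R")
proof
  assume eq: ?L
  show ?R
  proof
    fix u
    show "(LINT \<omega>|P. ssup u (Mm t \<omega>)) = (LINT \<omega>|P. ssup u (M t \<omega>))"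
      using eq t borel_measurable_ssup[OF random_closed_set_Mm_P, of t] borel_measurable_ssup[OF random_closed_set_M_P, of t]
      by (intro integral_cong_AE) auto
  qed
next
  assume eq: ?R
  have i: "integrable P (\<lambda>\<omega>. ssup u (Mm t \<omega>))" "integrable P (\<lambda>\<omega>. ssup u (M t \<omega>))" for u
    using t integrable_ssup_Mm[of t] integrable_ssup[OF random_closed_set_M_P integrably_bounded_M, of t] by auto
  have "AE \<omega> in P. ssup u (M t \<omega>) - ssup u (Mm t \<omega>) = 0" if "u \<in> W" for u
  proof (rule integral_nonneg_eq_0_iff_AE[THEN iffD1])
    show "AE \<omega> in P. 0 \<le> ssup u (M t \<omega>) - ssup u (Mm t \<omega>)"
      using AE_ssup_Mm_le_M[OF t] by eventually_elim simp
    show "(LINT \<omega>|P. ssup u (M t \<omega>) - ssup u (Mm t \<omega>)) = 0"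
      using i eq that by simp
  qed (use i in auto)
  then have "AE \<omega> in P. \<forall>u\<in>W. ssup u (M t \<omega>) - ssup u (Mm t \<omega>) = 0"
    unfolding AE_ball_countable[OF W(1)] by blast
  with AE_compact_convex_M[OF less_imp_le[OF t]] show ?L
  proof eventually_elim
    case (elim \<omega>)
    note c = Mm_compact_convex[OF t, of \<omega>]
    show ?case
    proof (rule antisym)
      show "Mm t \<omega> \<subseteq> M t \<omega>"
        by (rule subset_if_ssup_le[OF _ _ _ W(2)]) (use elim compact_imp_bounded[OF c(1)] in simp_all)
      show "M t \<omega> \<subseteq> Mm t \<omega>"
        by (rule subset_if_ssup_le[OF c W(2)]) (use elim compact_imp_bounded[of "M t \<omega>"] in simp_all)
    qed
  qed
qed

text \<open>The integrals are nondecreasing in time, so one sequence of rationals determines their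
  left limit over all real times; by uniform integrability it is the integral belonging to
  \<open>Mm t\<close>.\<close>

lemma tendsto_integral_ssup_M_iff:
  assumes t: "t > 0"
  shows "((\<lambda>r. LINT \<omega>|P. ssup u (M r \<omega>)) \<longlongrightarrow> (LINT \<omega>|P. ssup u (M t \<omega>))) (at_left t) \<longleftrightarrow>
    (LINT \<omega>|P. ssup u (Mm t \<omega>)) = (LINT \<omega>|P. ssup u (M t \<omega>))"
proof -
  define \<phi> where "\<phi> = (\<lambda>r. LINT \<omega>|P. ssup u (M r \<omega>))"
  obtain r where r: "\<And>n. r n \<in> \<rat>" "\<And>n. 0 < r n" "\<And>n. r n < t" "filterlim r (rat_left t) sequentially"
    using left_sequence_rat[OF t] by metis
  have full: "(LINT \<omega>:space P|P. f \<omega>) = (LINT \<omega>|P. f \<omega>)" for f :: "'w \<Rightarrow> real"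
    by (simp add: set_integral_space set_lebesgue_integral_def cong: Bochner_Integration.integral_cong)
  have mono: "\<phi> s \<le> \<phi> s'" if "0 \<le> s" "s \<le> s'" for s s'
    using set_integral_ssup_M_mono[OF that, of "space P"] sets.top[of "F s"] space_F[OF that(1)]
    by (simp add: full \<phi>_def)
  have lim: "(\<lambda>n. \<phi> (r n)) \<longlonglongrightarrow> (LINT \<omega>|P. ssup u (Mm t \<omega>))"
    using ssup_Mm_limit(2)[OF t r(2,3,4) sets.top] by (simp add: full \<phi>_def)
  have rl: "filterlim r (at_left t) sequentially"
    using r(3,4) by (auto simp: filterlim_at less_imp_neq)
  have "(\<phi> \<longlongrightarrow> \<phi> t) (at_left t) \<longleftrightarrow> (LINT \<omega>|P. ssup u (Mm t \<omega>)) = \<phi> t"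
  proof
    assume "(\<phi> \<longlongrightarrow> \<phi> t) (at_left t)"
    then have "(\<lambda>n. \<phi> (r n)) \<longlonglongrightarrow> \<phi> t" by (rule filterlim_compose[OF _ rl])
    then show "(LINT \<omega>|P. ssup u (Mm t \<omega>)) = \<phi> t" using lim LIMSEQ_unique by blast
  next
    assume eq: "(LINT \<omega>|P. ssup u (Mm t \<omega>)) = \<phi> t"
    show "(\<phi> \<longlongrightarrow> \<phi> t) (at_left t)"
    proof (rule order_tendstoI)
      fix a assume "a < \<phi> t"
      then have "\<forall>\<^sub>F n in sequentially. a < \<phi> (r n)" using lim eq order_tendstoD(1) by metis
      then obtain n where n: "a < \<phi> (r n)" by (auto simp: eventually_sequentially)
      show "\<forall>\<^sub>F s in at_left t. a < \<phi> s"
        using eventually_at_left_real[OF r(3)[of n]]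
      proof eventually_elim
        case (elim s)
        then show ?case using n mono[of "r n" s] r(2)[of n] by simp
      qed
    next
      fix a assume a: "\<phi> t < a"
      show "\<forall>\<^sub>F s in at_left t. \<phi> s < a"
        using eventually_at_left_real[OF t]
      proof eventually_elim
        case (elim s)
        then show ?case using a mono[of s t] by simp
      qed
    qed
  qed
  then show ?thesis unfolding \<phi>_def .
qed

text \<open>Finite values at nonnegative times allow the continuity in the extended reals to be read
  in the reals; to the left of \<open>t > 0\<close> only positive times matter eventually.\<close>

lemma continuous_support_fun_set_expectation_iff:
  assumes t: "t > 0"
  shows "continuous (at_left t) (\<lambda>r. support_fun u (set_expectation P (M r))) \<longleftrightarrow>
    (LINT \<omega>|P. ssup u (Mm t \<omega>)) = (LINT \<omega>|P. ssup u (M t \<omega>))"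
proof -
  have eq: "support_fun u (set_expectation P (M r)) = ereal (LINT \<omega>|P. ssup u (M r \<omega>))" if "r \<ge> 0" for r
    using support_fun_set_expectation[OF random_closed_set_M_P[OF that] integrably_bounded_M[OF that]] .
  have "continuous (at_left t) (\<lambda>r. support_fun u (set_expectation P (M r))) \<longleftrightarrow>
     ((\<lambda>r. support_fun u (set_expectation P (M r))) \<longlongrightarrow> ereal (LINT \<omega>|P. ssup u (M t \<omega>))) (at_left t)"
    using eq[of t] t by (simp add: continuous_within)
  also have "\<dots> \<longleftrightarrow> ((\<lambda>r. ereal (LINT \<omega>|P. ssup u (M r \<omega>))) \<longlongrightarrow> ereal (LINT \<omega>|P. ssup u (M t \<omega>))) (at_left t)"
    by (intro tendsto_cong eventually_mono[OF eventually_at_left_real[OF t]]) (simp add: eq)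
  also have "\<dots> \<longleftrightarrow> (LINT \<omega>|P. ssup u (Mm t \<omega>)) = (LINT \<omega>|P. ssup u (M t \<omega>))"
    using tendsto_integral_ssup_M_iff[OF t] by simp
  finally show ?thesis .
qed

section \<open>Path regularity of the left limits\<close>

lemma ex_right_limit:
  assumes \<omega>: "\<omega> \<in> \<Omega>'" and t: "t \<ge> 0"
  shows "\<exists>L. hausdorff_tendsto (\<lambda>t. Mm t \<omega>) L (at_right t)"
proof -
  obtain L where L: "compact L" "hausdorff_tendsto (\<lambda>r. M r \<omega>) L (rat_right t)"
    using regular \<omega> t unfolding regularity_event_def by blast
  have ne: "L \<noteq> {}" using L by (simp add: hausdorff_tendsto_def)
  have "hausdorff_tendsto (\<lambda>t. Mm t \<omega>) L (at_right t)"
  proof (rule hausdorff_tendstoI)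
    fix e :: real assume e: "e > 0"
    obtain d where d: "d > 0" "\<And>r. r \<in> \<rat> \<Longrightarrow> t < r \<Longrightarrow> r < t + d \<Longrightarrow>
        (\<forall>x\<in>M r \<omega>. infdist x L < e / 2) \<and> (\<forall>y\<in>L. infdist y (M r \<omega>) < e / 2)"
      using hausdorff_tendsto_infdist[OF L(2) half_gt_zero[OF e]]
      unfolding eventually_at by (force simp: dist_real_def)
    have "t < t + d" using d(1) by simp
    from eventually_at_right_real[OF this]
    show "\<forall>\<^sub>F s in at_right t. (\<forall>x\<in>Mm s \<omega>. infdist x L \<le> e) \<and> (\<forall>y\<in>L. infdist y (Mm s \<omega>) \<le> e)"
    proof eventually_elim
      case (elim s)
      have s: "s > 0" using elim t by simp
      have "(\<forall>x\<in>Mm s \<omega>. infdist x L \<le> 2 * (e / 2)) \<and> (\<forall>y\<in>L. infdist y (Mm s \<omega>) \<le> 2 * (e / 2))"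
        by (rule close_left_limit[OF d(2) left_limit(1)[OF \<omega> s] M_nonempty[OF _ regular_space[OF \<omega>]] s])
          (use elim ne e in auto)
      then show ?case by simp
    qed
  qed (use L ne compact_imp_closed in auto)
  then show ?thesis by blast
qed

lemma left_continuous_Mm:
  assumes \<omega>: "\<omega> \<in> \<Omega>'" and t: "t > 0"
  shows "hausdorff_tendsto (\<lambda>t. Mm t \<omega>) (Mm t \<omega>) (at_left t)"
proof (rule hausdorff_tendstoI)
  fix e :: real assume e: "e > 0"
  \<comment> \<open>The lower end is raised to \<open>0\<close> because \<open>rat_left\<close> runs
    through nonnegative times only; the half of \<open>e\<close> available at rational times is
    doubled by \<open>close_left_limit\<close>.\<close>
  obtain d where d: "d > 0" "\<And>r. r \<in> \<rat> \<Longrightarrow> max 0 (t - d) < r \<Longrightarrow> r < t \<Longrightarrow>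
      (\<forall>x\<in>M r \<omega>. infdist x (Mm t \<omega>) < e / 2) \<and> (\<forall>y\<in>Mm t \<omega>. infdist y (M r \<omega>) < e / 2)"
    using hausdorff_tendsto_infdist[OF left_limit(1)[OF \<omega> t] half_gt_zero[OF e]]
    unfolding eventually_at by (force simp: dist_real_def)
  have "max 0 (t - d) < t" using d t by simp
  from eventually_at_left_real[OF this]
  show "\<forall>\<^sub>F s in at_left t. (\<forall>x\<in>Mm s \<omega>. infdist x (Mm t \<omega>) \<le> e) \<and> (\<forall>y\<in>Mm t \<omega>. infdist y (Mm s \<omega>) \<le> e)"
  proof eventually_elim
    case (elim s)
    have s: "s > 0" using elim by simp
    have "(\<forall>x\<in>Mm s \<omega>. infdist x (Mm t \<omega>) \<le> 2 * (e / 2)) \<and> (\<forall>y\<in>Mm t \<omega>. infdist y (Mm s \<omega>) \<le> 2 * (e / 2))"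
      by (rule close_left_limit[where a = "max 0 (t - d)", OF d(2) left_limit(1)[OF \<omega> s]
          M_nonempty[OF _ regular_space[OF \<omega>]] s])
        (use elim e Mm_compact_convex(3)[OF t] in auto)
    then show ?case by simp
  qed
qed (use Mm_compact_convex[OF t] compact_imp_closed in auto)

text \<open>Off \<open>\<Omega>'\<close> the path equals \<open>{0}\<close> at all positive times.
  Its value \<open>M 0 \<omega>\<close> at time \<open>0\<close> does no harm: left continuity is
  required for \<open>t > 0\<close> only, and the right limit at \<open>0\<close> does not see the
  point \<open>0\<close> itself.\<close>

lemma hausdorff_caglad_Mm: "hausdorff_caglad (\<lambda>t. Mm t \<omega>)"
proof (cases "\<omega> \<in> \<Omega>'")
  case True
  then show ?thesis using left_continuous_Mm ex_right_limit by (simp add: hausdorff_caglad_def)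
next
  case False
  have "hausdorff_tendsto (\<lambda>t. Mm t \<omega>) {0} (at_left t)" if "t > 0" for t
  proof (rule hausdorff_tendstoI)
    show "\<forall>\<^sub>F s in at_left t. (\<forall>x\<in>Mm s \<omega>. infdist x {0} \<le> e) \<and> (\<forall>y\<in>{0}. infdist y (Mm s \<omega>) \<le> e)"
      if "e > 0" for e :: real
      using eventually_at_left_real[OF \<open>t > 0\<close>]
      by eventually_elim (use that False in \<open>simp add: Mm_irregular\<close>)
  qed auto
  moreover have "hausdorff_tendsto (\<lambda>t. Mm t \<omega>) {0} (at_right t)" if "t \<ge> 0" for t
  proof (rule hausdorff_tendstoI)
    show "\<forall>\<^sub>F s in at_right t. (\<forall>x\<in>Mm s \<omega>. infdist x {0} \<le> e) \<and> (\<forall>y\<in>{0}. infdist y (Mm s \<omega>) \<le> e)"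
      if "e > 0" for e :: real
      using eventually_at_right_less[of t]
      by eventually_elim (use that False \<open>t \<ge> 0\<close> in \<open>simp add: Mm_irregular\<close>)
  qed auto
  ultimately show ?thesis using False by (auto simp: hausdorff_caglad_def Mm_irregular)
qed

section \<open>Submartingale and martingale property of the left limits\<close>

lemma set_integrable_Mm:
  assumes t: "t \<ge> 0" shows "set_integrable_rv P (Mm t)"
proof -
  obtain \<xi> where \<xi>: "\<xi> \<in> borel_measurable P" "\<And>\<omega>. \<omega> \<in> space P \<Longrightarrow> \<xi> \<omega> \<in> Mm t \<omega>"
    using random_closed_set_selection[OF random_closed_set_Mm_P[OF t]] by metis
  then have "\<xi> \<in> selections1 P P (Mm t)"
    by (intro selections1I[OF random_closed_set_Mm_P[OF t] integrably_bounded_Mm[OF t]]) (auto simp: subalgebra_def)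
  then show ?thesis by (auto simp: set_integrable_rv_def)
qed

text \<open>Both properties use the same version \<open>Y\<close>, so the martingale clause is an
  additional conclusion. Equality combines the inclusion valid for submartingales with its converse,
  which relies on convexity of \<open>Mm s\<close>.\<close>

lemma cond_exp_Mm:
  assumes st: "0 \<le> s" "s \<le> t"
  obtains Y where "is_set_cond_exp P (F s) (Mm t) Y" "AE \<omega> in P. Mm s \<omega> \<subseteq> Y \<omega>"
    "set_martingale P F M \<Longrightarrow> AE \<omega> in P. Mm s \<omega> = Y \<omega>"
proof -
  interpret S: finite_measure_subalgebra P "F s" using finite_measure_subalgebra_F st by simp
  have t: "t \<ge> 0" using st by simp
  obtain g where g: "is_set_cond_exp P (F s) (Mm t) (\<lambda>\<omega>. closure (range (\<lambda>k. g k \<omega>)))"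
    "\<And>k::nat. g k \<in> selections1 P (F s) (\<lambda>\<omega>. closure (range (\<lambda>k. g k \<omega>)))"
    using S.ex_set_cond_exp[OF set_integrable_Mm[OF t]] by metis
  have sub: "AE \<omega> in P. Mm s \<omega> \<subseteq> closure (range (\<lambda>k. g k \<omega>))"
    by (rule S.AE_subset_cond_exp[OF W random_closed_set_Mm_P[OF t] integrably_bounded_Mm[OF t] AE_convex_Mm[OF t] g
      random_closed_set_Mm[OF st(1)] integrably_bounded_Mm[OF st(1)] set_integral_ssup_Mm_mono[OF st]])
  moreover have "AE \<omega> in P. Mm s \<omega> = closure (range (\<lambda>k. g k \<omega>))" if mart: "set_martingale P F M"
  proof -
    have "AE \<omega> in P. closure (range (\<lambda>k. g k \<omega>)) \<subseteq> Mm s \<omega>"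
      by (rule S.AE_cond_exp_subset[OF W random_closed_set_Mm_P[OF t] integrably_bounded_Mm[OF t] g
        random_closed_set_Mm[OF st(1)] integrably_bounded_Mm[OF st(1)] AE_convex_Mm[OF st(1)]
        set_integral_ssup_Mm_antimono[OF mart st]])
    with sub show ?thesis by eventually_elim (rule antisym)
  qed
  ultimately show thesis using g(1) that by blast
qed

lemma set_submartingale_Mm: "set_submartingale P F Mm"
  unfolding set_submartingale_def adapted_set_process_def integrable_process_def
proof (intro conjI allI impI; (elim conjE)?)
  fix s t :: real assume "0 \<le> s" "s \<le> t"
  then show "\<exists>Y. is_set_cond_exp P (F s) (Mm t) Y \<and> (AE \<omega> in P. Mm s \<omega> \<subseteq> Y \<omega>)"
    using cond_exp_Mm by metis
qed (auto intro: random_closed_set_Mm set_integrable_Mm)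

lemma set_martingale_Mm: "set_martingale P F M \<Longrightarrow> set_martingale P F Mm"
  unfolding set_martingale_def[of P F Mm] adapted_set_process_def integrable_process_def
proof (intro conjI allI impI; (elim conjE)?)
  fix s t :: real assume "set_martingale P F M" "0 \<le> s" "s \<le> t"
  then show "\<exists>Y. is_set_cond_exp P (F s) (Mm t) Y \<and> (AE \<omega> in P. Mm s \<omega> = Y \<omega>)"
    using cond_exp_Mm by metis
qed (auto intro: random_closed_set_Mm set_integrable_Mm)

end

theorem theorem4p6:
  fixes P :: "'w measure"
    and F :: "real \<Rightarrow> 'w measure"
    and M Mm :: "real \<Rightarrow> 'w \<Rightarrow> 'b::euclidean_space set"
    and \<Omega>' :: "'w set"
    and W :: "'b set"
  assumes "prob_space P"
    and "filtration_of P F"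
    and "augmented_filtration P F"
    and "left_continuous_filtration P F"
    and "countable W" and "W \<subseteq> cball 0 1" and "cball 0 1 \<subseteq> closure W" and "0 \<notin> W"
    and "set_submartingale P F M"
    and "convex_process P M"
    and "integrably_bounded_process P M"
    and "regularity_event P M \<Omega>'"
    and "Mm = left_limit_process \<Omega>' M"
  shows "(\<forall>t>0.
            random_closed_set (F t) (Mm t) \<and>
            integrably_bounded P (Mm t) \<and>
            (AE \<omega> in P. compact (Mm t \<omega>) \<and> convex (Mm t \<omega>)) \<and>
            (AE \<omega> in P. Mm t \<omega> \<subseteq> M t \<omega>) \<and>
            ((AE \<omega> in P. Mm t \<omega> = M t \<omega>) \<longleftrightarrow>
              (\<forall>u\<in>W. continuous (at_left t) (\<lambda>r. support_fun u (set_expectation P (M r))))))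
       \<and> ((\<forall>\<omega>\<in>space P. hausdorff_caglad (\<lambda>t. Mm t \<omega>)) \<and>
          convex_process P Mm \<and>
          integrably_bounded_process P Mm \<and>
          set_submartingale P F Mm \<and>
          (set_martingale P F M \<longrightarrow> set_martingale P F Mm))"
proof -
  interpret prob_space P by fact
  interpret S: regular_set_submartingale P F M \<Omega>' W
    by unfold_locales fact+
  show ?thesis
    unfolding \<open>Mm = left_limit_process \<Omega>' M\<close> convex_process_def integrably_bounded_process_def
  proof (intro conjI allI ballI impI)
    fix t :: real assume t: "t > 0"
    show "random_closed_set (F t) (S.Mm t)" "integrably_bounded P (S.Mm t)"
      using S.random_closed_set_Mm S.integrably_bounded_Mm t by simp_all
    show "AE \<omega> in P. compact (S.Mm t \<omega>) \<and> convex (S.Mm t \<omega>)"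
      using S.Mm_compact_convex[OF t] by simp
    show "AE \<omega> in P. S.Mm t \<omega> \<subseteq> M t \<omega>" by (rule S.AE_Mm_subset_M[OF t])
    show "(AE \<omega> in P. S.Mm t \<omega> = M t \<omega>) \<longleftrightarrow>
        (\<forall>u\<in>W. continuous (at_left t) (\<lambda>r. support_fun u (set_expectation P (M r))))"
      unfolding S.AE_Mm_eq_M_iff[OF t] S.continuous_support_fun_set_expectation_iff[OF t] ..
  qed (simp_all only: S.hausdorff_caglad_Mm S.AE_convex_Mm S.integrably_bounded_Mm S.set_submartingale_Mm S.set_martingale_Mm)
qed

end
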